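(* (Local stability of the Edwards–Anderson model.) Assume that the common law $\nu_0$ of the couplings is symmetric and continuous with support $\mathbb{R}$ (in the sense made precise in the context), and let $\kappa_J$ be a metastate of the Edwards–Anderson model on $\mathbb{Z}^d$ at inverse temperature $\beta$ with periodic boundary conditions. Let $W\subset\mathbb{Z}^d$ be finite, and for a deterministic collection $J'=(J'_{xy}: \{x,y\}\in W^* )$ of real numbers define $$H'_W(\sigma)=\sum_{\{x,y\}\in W^*}J'_{xy}\,\sigma_x\sigma_y .$$ Let $s\in\mathbb{N}$, let $F$ be a continuous real function of the overlaps of $s$ replicas, and write $F(\vec\sigma)=F(R(\sigma^i,\sigma^j):1\le i<j\le s)$. Then for $\nu$-almost all $J$ and for almost all $J'$ (with respect to the product law $\nu_0^{\otimes W^*}$), $$\int\kappa_J(d\Gamma)\,\frac{\Gamma^{\times s}\big(e^{\beta\sum_{i=1}^s H'_W(\sigma^i)}F(\vec\sigma)\big)}{\Gamma\big(e^{\beta H'_W(\sigma)}\big)^s}=\int\kappa_J(d\Gamma)\,\Gamma^{\times s}\big(F(\vec\sigma)\big).$$ In other words, $Q_J$ and $Q'_J$ have the same law, where $Q_J$ is the ROSt constructed from $\kappa_J$ and the edge overlap $R$, and $Q'_J$ is defined in the same way but with each $\Gamma$ replaced by the measure $\dfrac{e^{\beta H'_W(\sigma)}\,\Gamma(d\sigma)}{\Gamma(e^{\beta H'_W(\sigma)})}$.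
   Context: Fix $d\ge 1$ and $\beta>0$. Edges are unordered nearest-neighbor pairs $\{x,y\}$ of $\mathbb{Z}^d$; for finite $\Lambda\subset\mathbb{Z}^d$, $\Lambda^*$ is the set of edges with both endpoints in $\Lambda$. The couplings $J=(J_{xy})$, indexed by all edges of $\mathbb{Z}^d$, are i.i.d. with common symmetric law $\nu_0$ on $\mathbb{R}$; their joint (product) law is $\nu(dJ)$. "Continuous with support $\mathbb{R}$" means that $\nu_0$ has a density with respect to Lebesgue measure which is strictly positive almost everywhere on $\mathbb{R}$. For a box $\Lambda$, the Edwards–Anderson (EA) Hamiltonian on $\{-1,+1\}^\Lambda$ is $H_{\Lambda,J}(\sigma)=-\sum_{\{x,y\}}J_{xy}\sigma_x\sigma_y$, summed over the edges of $\Lambda^*$ and the additional wrap-around edges giving $\Lambda$ periodic boundary conditions (the edge from $x\in\Lambda$ to $x+e_i$ taken modulo $\Lambda$ carries the coupling $J_{x,x+e_i}$). The Gibbs measure is $G_{\Lambda,\beta,J}(\sigma)=e^{-\beta H_{\Lambda,J}(\sigma)}/Z_{\Lambda,J}(\beta)$, with $Z_{\Lambda,J}(\beta)=\sum_\sigma e^{-\beta H_{\Lambda,J}(\sigma)}$. Metastate: let $(\Lambda_n)$ be a sequence of boxes converging to $\mathbb{Z}^d$ along which the laws $\nu(dJ)\prod_{i\in\mathbb{N}}G_{\Lambda_n,\beta,J}$ of $(J,\{\sigma^i\}_{i\in\mathbb{N}})$ converge in the sense of finite-dimensional distributions (finitely many couplings, replicas and sites) to a law $M$ on $(J,\{\sigma^i\}_{i\in\mathbb{N}})$,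 $\sigma^i\in\{-1,+1\}^{\mathbb{Z}^d}$ (such sequences exist by compactness). By exchangeability and de Finetti's theorem, $M=\nu(dJ)\int\kappa_J(d\Gamma)\prod_{i\in\mathbb{N}}\Gamma$, where, for $\nu$-almost all $J$, $\kappa_J$ is a probability measure on the space of Borel probability measures $\Gamma$ on $\{-1,+1\}^{\mathbb{Z}^d}$ (product topology). Any such $\kappa_J$ is called a metastate. $\Gamma(f)$ is the integral of $f$ against $\Gamma$ and $\Gamma^{\times s}$ is the $s$-fold product measure. The edge overlap is $R(\sigma,\sigma')=\lim_{W\to\mathbb{Z}^d}\frac1{|W^*|}\sum_{\{x,y\}\in W^*}\sigma_x\sigma_y\sigma'_x\sigma'_y$ (limit along cubes centered at the origin), which exists for $M$-almost all pairs of replicas. A Random Overlap Structure (ROSt) is a random $\mathbb{N}\times\mathbb{N}$ covariance matrix $\{q_{ij}\}$ with $1$'s on the diagonal whose law is invariant under $q_{ij}\mapsto q_{\pi(i)\pi(j)}$ for every finite permutation $\pi$. The ROSt $Q_J=\{q_{ij}(J)\}$ has law determined by $\mathbb{E}[F(q_{ij}(J):1\le i<j\le s)]=\int\kappa_J(d\Gamma)\,\Gamma^{\times s}\big(F(R(\sigma^i,\sigma^j):1\le i<j\le s)\big)$ for all $s\in\mathbb{N}$ and all continuous $F$. *)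

theory Defs
  imports "HOL-Probability.Probability"
begin

section \<open>Lattice, edges, boxes\<close>

text \<open>\<open>\<int>\<^sup>d\<close> is the type \<open>int ^ 'd\<close> with \<open>d = CARD('d) \<ge> 1\<close>. An edge is the two-element set of its
  endpoints, and a spin configuration is a real-valued function with values in \<open>{-1, 1}\<close>.\<close>

type_synonym 'd site = "int ^ 'd"
type_synonym 'd edge = "'d site set"
type_synonym 'd couplings = "'d edge \<Rightarrow> real"
type_synonym 'd config = "'d site \<Rightarrow> real"

definition edges :: "('d::finite) edge set" where
  "edges = {{x, y} |x y. (\<Sum>i\<in>UNIV. \<bar>x $ i - y $ i\<bar>) = 1}"

definition edges_in :: "('d::finite) site set \<Rightarrow> 'd edge set" where
  "edges_in W = {e \<in> edges. e \<subseteq> W}"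

definition lattice_box :: "('d::finite) site \<Rightarrow> 'd site \<Rightarrow> 'd site set" where
  "lattice_box a b = {x. \<forall>i. a $ i \<le> x $ i \<and> x $ i \<le> b $ i}"

definition cube :: "nat \<Rightarrow> ('d::finite) site set" where
  "cube n = lattice_box (\<chi> i. - int n) (\<chi> i. int n)"

text \<open>The representative of \<open>x\<close> modulo the box \<open>lattice_box a b\<close>, which has side lengths
  \<open>b $ i - a $ i + 1\<close>.\<close>

definition wrap :: "('d::finite) site \<Rightarrow> 'd site \<Rightarrow> 'd site \<Rightarrow> 'd site" where
  "wrap a b x = (\<chi> i. a $ i + (x $ i - a $ i) mod (b $ i - a $ i + 1))"

section \<open>Couplings\<close>

definition symmetric_law :: "real measure \<Rightarrow> bool" where
  "symmetric_law \<nu>\<^sub>0 \<longleftrightarrow> prob_space \<nu>\<^sub>0 \<and> sets \<nu>\<^sub>0 = sets borel \<and> distr \<nu>\<^sub>0 borel uminus = \<nu>\<^sub>0"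

definition continuous_full_support :: "real measure \<Rightarrow> bool" where
  "continuous_full_support \<nu>\<^sub>0 \<longleftrightarrow>
     (\<exists>f \<in> borel_measurable borel. (AE x in lborel. 0 < f x) \<and>
        \<nu>\<^sub>0 = density lborel (\<lambda>x. ennreal (f x)))"

definition coupling_law :: "real measure \<Rightarrow> ('d::finite) couplings measure" where
  "coupling_law \<nu>\<^sub>0 = PiM edges (\<lambda>_. \<nu>\<^sub>0)"

section \<open>Finite-volume Gibbs measures with periodic boundary conditions\<close>

definition spin_space :: "'d site set \<Rightarrow> 'd config measure" where
  "spin_space \<Lambda> = PiM \<Lambda> (\<lambda>_. count_space {-1, 1})"

text \<open>One term for each \<open>x\<close> in the box and each coordinate direction: these are the edges with both
  endpoints in the box, each counted once, and the wrap-around edges.\<close>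

definition EA_hamiltonian ::
    "('d::finite) site \<Rightarrow> 'd site \<Rightarrow> 'd couplings \<Rightarrow> 'd config \<Rightarrow> real" where
  "EA_hamiltonian a b J \<sigma> =
     - (\<Sum>x\<in>lattice_box a b. \<Sum>i\<in>UNIV. J {x, x + axis i 1} * \<sigma> x * \<sigma> (wrap a b (x + axis i 1)))"

definition partition_fun ::
    "real \<Rightarrow> ('d::finite) site \<Rightarrow> 'd site \<Rightarrow> 'd couplings \<Rightarrow> real" where
  "partition_fun \<beta> a b J =
     (\<Sum>\<sigma>\<in>lattice_box a b \<rightarrow>\<^sub>E {-1, 1}. exp (- \<beta> * EA_hamiltonian a b J \<sigma>))"

definition gibbs ::
    "real \<Rightarrow> ('d::finite) site \<Rightarrow> 'd site \<Rightarrow> 'd couplings \<Rightarrow> 'd config measure" where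
  "gibbs \<beta> a b J = point_measure (lattice_box a b \<rightarrow>\<^sub>E {-1, 1})
     (\<lambda>\<sigma>. ennreal (exp (- \<beta> * EA_hamiltonian a b J \<sigma>) / partition_fun \<beta> a b J))"

section \<open>Metastates\<close>

text \<open>The law \<open>\<nu>(dJ) P\<^sub>J(d\<sigma>)\<close> of the couplings together with a sequence of replicas in the volume
  \<open>\<Lambda>\<close>, where \<open>P\<^sub>J\<close> is the conditional law of the replicas given \<open>J\<close>.\<close>

definition replica_law ::
    "real measure \<Rightarrow> ('d::finite) site set \<Rightarrow> ('d couplings \<Rightarrow> (nat \<Rightarrow> 'd config) measure) \<Rightarrow>
     ('d couplings \<times> (nat \<Rightarrow> 'd config)) measure" where
  "replica_law \<nu>\<^sub>0 \<Lambda> P = coupling_law \<nu>\<^sub>0 \<bind>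
     (\<lambda>J. distr (P J) (coupling_law \<nu>\<^sub>0 \<Otimes>\<^sub>M PiM UNIV (\<lambda>_. spin_space \<Lambda>)) (Pair J))"

text \<open>The law \<open>\<integral>K(d\<Gamma>) \<Prod>\<^sub>i \<Gamma>\<close> of a sequence of replicas, for \<open>K\<close> a measure on the space of
  measures.\<close>

definition mixture :: "'d config measure measure \<Rightarrow> (nat \<Rightarrow> 'd config) measure" where
  "mixture K = K \<bind> (\<lambda>\<Gamma>. PiM UNIV (\<lambda>_. \<Gamma>))"

text \<open>Finitely many couplings \<open>A\<close>, replicas \<open>i < k\<close> and sites \<open>V\<close>. The values outside of these are
  set to the constant \<open>undefined\<close>, so that a bounded continuous function of the finitely many
  retained coordinates is the same as a bounded continuous function (for the product topology)
  composed with this projection.\<close>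

definition fin_proj ::
    "'d edge set \<Rightarrow> nat \<Rightarrow> 'd site set \<Rightarrow> 'd couplings \<times> (nat \<Rightarrow> 'd config) \<Rightarrow>
     'd couplings \<times> (nat \<Rightarrow> 'd config)" where
  "fin_proj A k V = (\<lambda>(J, \<sigma>). (restrict J A, restrict (\<lambda>i. restrict (\<sigma> i) V) {..<k}))"

definition fdd_converges ::
    "(nat \<Rightarrow> (('d::finite) couplings \<times> (nat \<Rightarrow> 'd config)) measure) \<Rightarrow>
     ('d couplings \<times> (nat \<Rightarrow> 'd config)) measure \<Rightarrow> bool" where
  "fdd_converges L M \<longleftrightarrow>
     (\<forall>A k V. finite A \<longrightarrow> A \<subseteq> edges \<longrightarrow> finite V \<longrightarrow>
       (\<forall>g :: 'd couplings \<times> (nat \<Rightarrow> 'd config) \<Rightarrow> real.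
          continuous_on UNIV g \<longrightarrow> bounded (range g) \<longrightarrow>
          (\<lambda>n. \<integral>\<omega>. g (fin_proj A k V \<omega>) \<partial>L n) \<longlonglongrightarrow> (\<integral>\<omega>. g (fin_proj A k V \<omega>) \<partial>M)))"

definition boxes_to_lattice :: "(nat \<Rightarrow> ('d::finite) site) \<Rightarrow> (nat \<Rightarrow> 'd site) \<Rightarrow> bool" where
  "boxes_to_lattice a b \<longleftrightarrow> (\<forall>x. \<forall>\<^sub>F n in sequentially. x \<in> lattice_box (a n) (b n))"

text \<open>The probability measures on \<open>{-1, 1}\<^bsup>\<int>\<^sup>d\<^esup>\<close> form the measurable space
  \<open>prob_algebra (spin_space UNIV)\<close>, so \<open>\<kappa> J\<close> lies in \<open>prob_algebra (prob_algebra (spin_space UNIV))\<close>.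
  A metastate is defined only almost surely, hence the measurable version \<open>\<kappa>'\<close>.\<close>

definition metastate ::
    "real measure \<Rightarrow> real \<Rightarrow> (('d::finite) couplings \<Rightarrow> 'd config measure measure) \<Rightarrow> bool" where
  "metastate \<nu>\<^sub>0 \<beta> \<kappa> \<longleftrightarrow>
     (\<exists>a b. \<exists>\<kappa>' \<in> coupling_law \<nu>\<^sub>0 \<rightarrow>\<^sub>M prob_algebra (prob_algebra (spin_space UNIV)).
        boxes_to_lattice a b \<and>
        (AE J in coupling_law \<nu>\<^sub>0. \<kappa> J = \<kappa>' J) \<and>
        fdd_converges
          (\<lambda>n. replica_law \<nu>\<^sub>0 (lattice_box (a n) (b n)) (\<lambda>J. PiM UNIV (\<lambda>_. gibbs \<beta> (a n) (b n) J)))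
          (replica_law \<nu>\<^sub>0 UNIV (\<lambda>J. mixture (\<kappa>' J))))"

section \<open>Edge overlap and the random overlap structure\<close>

text \<open>Where the limit does not exist, \<open>lim\<close> is an unspecified constant; for replicas sampled from a
  metastate this happens with probability zero.\<close>

definition edge_overlap :: "('d::finite) config \<Rightarrow> 'd config \<Rightarrow> real" where
  "edge_overlap \<sigma> \<sigma>' =
     lim (\<lambda>n. (\<Sum>e\<in>edges_in (cube n). (\<Prod>x\<in>e. \<sigma> x) * (\<Prod>x\<in>e. \<sigma>' x))
       / real (card (edges_in (cube n) :: 'd edge set)))"

text \<open>The \<open>s\<close> replicas are numbered \<open>0, \<dots>, s - 1\<close>.\<close>

definition overlaps :: "nat \<Rightarrow> (nat \<Rightarrow> ('d::finite) config) \<Rightarrow> nat \<times> nat \<Rightarrow> real" where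
  "overlaps s \<sigma> = restrict (\<lambda>(i, j). edge_overlap (\<sigma> i) (\<sigma> j)) {(i, j). i < j \<and> j < s}"

text \<open>The law of the random matrix \<open>q\<^sub>i\<^sub>j\<close> of the overlaps of replicas sampled from \<open>\<integral>K(d\<Gamma>) \<Prod>\<^sub>i \<Gamma>\<close>;
  the law of \<open>Q\<^sub>J\<close> is \<open>rost_law (\<kappa> J)\<close>.\<close>

definition rost_law :: "('d::finite) config measure measure \<Rightarrow> (nat \<times> nat \<Rightarrow> real) measure" where
  "rost_law K = distr (mixture K) (PiM UNIV (\<lambda>_. borel))
     (\<lambda>\<sigma> (i, j). if i = j then 1 else edge_overlap (\<sigma> i) (\<sigma> j))"

section \<open>Local perturbation\<close>

definition local_energy :: "('d::finite) site set \<Rightarrow> 'd couplings \<Rightarrow> 'd config \<Rightarrow> real" where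
  "local_energy W J' \<sigma> = (\<Sum>e\<in>edges_in W. J' e * (\<Prod>x\<in>e. \<sigma> x))"

definition tilt ::
    "real \<Rightarrow> ('d::finite) site set \<Rightarrow> 'd couplings \<Rightarrow> 'd config measure \<Rightarrow> 'd config measure" where
  "tilt \<beta> W J' \<Gamma> = density \<Gamma>
     (\<lambda>\<sigma>. ennreal (exp (\<beta> * local_energy W J' \<sigma>) / (\<integral>\<tau>. exp (\<beta> * local_energy W J' \<tau>) \<partial>\<Gamma>)))"

definition tilted_metastate ::
    "real \<Rightarrow> ('d::finite) site set \<Rightarrow> 'd couplings \<Rightarrow> 'd config measure measure \<Rightarrow>
     'd config measure measure" where
  "tilted_metastate \<beta> W J' K = distr K (prob_algebra (spin_space UNIV)) (tilt \<beta> W J')"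

end

theory Submission
  imports Defs
begin

text \<open>The proof has two ingredients: the law of the overlaps in the metastate does not depend on the couplings,
  and a local perturbation of the states amounts to a change of finitely many couplings.

  \<^emph>\<open>The law of the overlaps is almost surely constant.\<close> With periodic boundary conditions, a translation of
  the torus permutes the couplings, hence preserves their law, and carries the Gibbs measure for the
  permuted couplings to the Gibbs measure for the original ones. In the limit, almost surely, translating
  the couplings \<open>J\<close> translates the states in the support of \<open>\<kappa> J\<close> (\<open>translation_covariance\<close>). The edge overlap
  of two configurations is unchanged when both are translated (\<open>edge_overlap_translate\<close>). The law of the
  overlaps is therefore a translation invariant function of \<open>J\<close>, and it is almost surely equal to a fixed
  law \<open>Q\<close>, because the law of the couplings is mixing (\<open>mixing_invariant_const\<close>, \<open>rost_law_const\<close>).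

  \<^emph>\<open>Local perturbations.\<close> In a box that contains \<open>W\<close>, adding \<open>J'\<close> to the couplings of the edges in \<open>W\<close> multiplies
  the Gibbs weights by the exponential of \<open>\<beta> H'\<close>, up to normalisation. This identity passes to the limit: for
  every \<open>J'\<close> and almost all \<open>J\<close>, sampling replicas from the tilted metastate at \<open>J\<close> is the same as sampling
  them from the metastate at \<open>J + J'\<close> (\<open>tilt_covariance\<close>, \<open>AE_mixture_tilted\<close>). Two points need care. The
  perturbed weights are normalised by \<open>\<Gamma>(e\<^bsup>\<beta>H'\<^esup>)\<close>, which is not a polynomial in correlations; it stays in a
  compact subset of the positive reals, and negative powers are approximated there uniformly by polynomials
  (\<open>stable_limit_tilted_prod\<close>). The law of \<open>J + J'\<close> has a density with respect to the law of \<open>J\<close> that is only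
  integrable; convergence of finite-dimensional distributions extends to such weights because the law of
  the couplings is the same for all boxes (\<open>stable_limit_replica_prod\<close>).

  Since the density of the single couplings is positive, null sets of couplings remain null sets after the
  shift by \<open>J'\<close> (\<open>AE_AE_shift\<close>). Hence for almost all \<open>J\<close> and \<open>J'\<close> the law of the overlaps under the tilted
  metastate is the one at \<open>J + J'\<close>, which is \<open>Q\<close>, and so is the one at \<open>J\<close>. The statement on functions of
  finitely many overlaps follows, since a continuous function is bounded on the compact set in which the
  overlaps take their values.\<close>

section \<open>Integrals, weak limits and equality of measures\<close>

lemma integral_measurable_kernel:
  fixes f :: "'a \<Rightarrow> 'b \<Rightarrow> real"
  assumes [measurable]: "(\<lambda>(x, y). f x y) \<in> borel_measurable (M \<Otimes>\<^sub>M N)"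
    and L: "L \<in> M \<rightarrow>\<^sub>M prob_algebra N"
  shows "(\<lambda>x. \<integral>y. f x y \<partial>L x) \<in> borel_measurable M"
proof -
  have [measurable]: "L \<in> M \<rightarrow>\<^sub>M subprob_algebra N"
    by (rule measurable_prob_algebraD[OF L])
  note measurable_distr2[measurable]
  have "(\<lambda>x. \<integral>z. (case z of (x, y) \<Rightarrow> f x y) \<partial>distr (L x) (M \<Otimes>\<^sub>M N) (\<lambda>y. (x, y))) \<in> borel_measurable M"
    by measurable
  then show ?thesis
    by (rule measurable_cong[THEN iffD1, rotated]) (simp add: integral_distr)
qed

lemma integral_prob_bind:
  fixes f :: "'b \<Rightarrow> real"
  assumes "f \<in> borel_measurable K" "\<And>x. x \<in> space K \<Longrightarrow> \<bar>f x\<bar>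
      \<le> B"
    and N: "N \<in> M \<rightarrow>\<^sub>M prob_algebra K" and M: "prob_space M"
  shows "integral\<^sup>L (bind M N) f = (\<integral>x. integral\<^sup>L (N x) f \<partial>M)"
proof (rule integral_bind[where B = B and B' = 1 and K = K])
  show "finite_measure M" using M by (simp add: prob_space_def)
  show "AE x in M. emeasure (N x) (space (N x)) \<le> ennreal 1"
    using measurable_space[OF N] by (auto simp: space_prob_algebra prob_space.emeasure_space_1)
qed (use assms in \<open>auto intro: measurable_prob_algebraD\<close>)

lemma (in finite_measure) integrable_mult_bounded:
  fixes G w :: "'a \<Rightarrow> real"
  assumes "integrable M G" "w \<in> borel_measurable M" "\<And>x. x \<in> space M
      \<Longrightarrow> \<bar>w x\<bar> \<le> B"
  shows "integrable M (\<lambda>x. G x * w x)"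
proof (rule Bochner_Integration.integrable_bound[of M "\<lambda>x. B * G x"])
  show "AE x in M. norm (G x * w x) \<le> norm (B * G x)"
  proof (rule AE_I2)
    fix x assume "x \<in> space M"
    then show "norm (G x * w x) \<le> norm (B * G x)"
      using mult_right_mono[OF order_trans[OF assms(3)[OF \<open>x \<in> space M\<close>] abs_ge_self], of "\<bar>G x\<bar>"]
      by (simp add: abs_mult mult.commute)
  qed
qed (use assms in auto)

lemma (in finite_measure) integral_mult_tendsto_0_closure:
  fixes w g :: "nat \<Rightarrow> 'a \<Rightarrow> real"
  assumes w: "\<And>n. w n \<in> borel_measurable M" "\<And>n x. x \<in> space M
      \<Longrightarrow> \<bar>w n x\<bar> \<le> B"
    and G: "integrable M G" and g: "\<And>m. integrable M (g m)"
    and L1: "(\<lambda>m. \<integral>x. \<bar>G x - g m x\<bar> \<partial>M)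
        \<longlonglongrightarrow> 0"
    and lim: "\<And>m. (\<lambda>n. \<integral>x. g m x * w n x \<partial>M)
        \<longlonglongrightarrow> 0"
  shows "(\<lambda>n. \<integral>x. G x * w n x \<partial>M) \<longlonglongrightarrow> 0"
proof (rule LIMSEQ_I)
  fix r :: real assume r: "0 < r"
  define C where "C = \<bar>B\<bar> + 1"
  have C: "C > 0" "\<And>n x. x \<in> space M \<Longrightarrow> \<bar>w n x\<bar> \<le> C"
    using w(2) unfolding C_def by (simp_all add: order_trans[OF w(2)])
  obtain m where m: "(\<integral>x. \<bar>G x - g m x\<bar> \<partial>M) < r / (2 * C)"
  proof -
    obtain k where "\<And>m. m \<ge> k
        \<Longrightarrow> norm ((\<integral>x. \<bar>G x - g m x\<bar> \<partial>M) - 0) < r / (2 * C)"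
      using LIMSEQ_D[OF L1, of "r / (2 * C)"] r C(1) by auto
    from this[of k] show ?thesis by (intro that[of k]) simp
  qed
  obtain N where N: "\<And>n. n \<ge> N
      \<Longrightarrow> \<bar>\<integral>x. g m x * w n x \<partial>M\<bar> < r / 2"
    using LIMSEQ_D[OF lim[of m], of "r / 2"] r by auto
  have "\<bar>\<integral>x. G x * w n x \<partial>M\<bar> < r" if "n \<ge> N" for n
  proof -
    have i1: "integrable M (\<lambda>x. G x * w n x)" "integrable M (\<lambda>x. g m x * w n x)"
      by (auto intro!: integrable_mult_bounded w(1) C(2) G g)
    have "\<bar>(\<integral>x. G x * w n x \<partial>M) - (\<integral>x. g m x * w n x \<partial>M)\<bar> = \<bar>\<integral>x. (G x - g m x) * w n x \<partial>M\<bar>"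
      by (subst Bochner_Integration.integral_diff[symmetric]) (auto simp: i1 algebra_simps)
    also have "\<dots> \<le> (\<integral>x. \<bar>(G x - g m x) * w n x\<bar> \<partial>M)"
      by (rule integral_abs_bound)
    also have "\<dots> \<le> (\<integral>x. \<bar>G x - g m x\<bar> * C \<partial>M)"
    proof (rule integral_mono)
      have "integrable M (\<lambda>x. (G x - g m x) * w n x)"
        by (auto intro!: integrable_mult_bounded w(1) C(2) G g)
      then show "integrable M (\<lambda>x. \<bar>(G x - g m x) * w n x\<bar>)" by (rule integrable_abs)
      show "integrable M (\<lambda>x. \<bar>G x - g m x\<bar> * C)" using G g by auto
    qed (auto simp: abs_mult intro!: mult_left_mono C(2))
    also have "\<dots> = C * (\<integral>x. \<bar>G x - g m x\<bar> \<partial>M)" by simp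
    also have "\<dots> < r / 2" using m C(1) by (simp add: field_simps)
    finally show ?thesis using N[OF that] by linarith
  qed
  then show "\<exists>N. \<forall>n\<ge>N. norm ((\<integral>x. G x * w n x \<partial>M) - 0) < r" by auto
qed

text \<open>A uniformly bounded sequence that tends to zero when it is integrated over the sets of an
  intersection-stable generator tends to zero weakly in \<open>L\<^sup>1\<close>. Applied to the conditional
  expectations of the replicas given the couplings, this replaces continuous functions of finitely many
  couplings by arbitrary integrable functions of all of them.\<close>

lemma (in finite_measure) integral_mult_tendsto_0_of_generator:
  fixes w :: "nat \<Rightarrow> 'a \<Rightarrow> real"
  assumes w: "\<And>n. w n \<in> borel_measurable M" "\<And>n x. x \<in> space M
      \<Longrightarrow> \<bar>w n x\<bar> \<le> B"
    and E: "Int_stable E" "E \<subseteq> Pow (space M)" "space M \<in> E" "sets M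
        = sigma_sets (space M) E"
    and lim: "\<And>A. A \<in> E \<Longrightarrow> (\<lambda>n. \<integral>x. indicator A x * w n x \<partial>M) \<longlonglongrightarrow> 0"
    and G: "integrable M G"
  shows "(\<lambda>n. \<integral>x. G x * w n x \<partial>M) \<longlonglongrightarrow> 0"
proof -
  note closure = integral_mult_tendsto_0_closure[OF w]
  have ind: "integrable M (indicator A :: 'a \<Rightarrow> real)" if "A \<in> sets M" for A
    using that by (intro integrable_real_indicator) (simp_all add: emeasure_eq_measure)
  have iw: "integrable M (\<lambda>x. g x * w n x)" if "integrable M g" for g n
    by (rule integrable_mult_bounded[OF that w])
  have *: "(\<lambda>n. \<integral>x. indicator A x * w n x \<partial>M)
      \<longlonglongrightarrow> 0" if "A \<in> sigma_sets (space M) E" for A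
    using E(1,2) that
  proof (induction rule: sigma_sets_induct_disjoint)
    case (basic A) then show ?case by (rule lim)
  next
    case empty then show ?case by simp
  next
    case (compl A)
    then have A: "A \<in> sets M" by (simp add: E(4))
    have eq: "(\<integral>x. indicator (space M - A) x * w n x \<partial>M) =
        (\<integral>x. indicator (space M) x * w n x \<partial>M) - (\<integral>x. indicator A x * w n x \<partial>M)" for n
    proof -
      have "(\<integral>x. indicator (space M - A) x * w n x \<partial>M) =
          (\<integral>x. indicator (space M) x * w n x - indicator A x * w n x \<partial>M)"
        by (intro Bochner_Integration.integral_cong) (auto split: split_indicator)
      also have "\<dots> = (\<integral>x. indicator (space M) x * w n x \<partial>M) - (\<integral>x. indicator A x * w n x \<partial>M)"
        by (rule Bochner_Integration.integral_diff) (rule iw, rule ind, use A in simp)+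
      finally show ?thesis .
    qed
    show ?case unfolding eq using tendsto_diff[OF lim[OF E(3)] compl(2)] by simp
  next
    case (union A)
    then have A: "\<And>i. A i \<in> sets M" by (auto simp: E(4))
    show ?case
    proof (rule closure[where g = "\<lambda>m. indicator (\<Union>i<m. A i)"])
      show "(\<lambda>m. \<integral>x. \<bar>indicator (\<Union>i. A i) x - indicator (\<Union>i<m. A i) x :: real\<bar> \<partial>M) \<longlonglongrightarrow> 0"
      proof -
        have "(\<lambda>m. \<integral>x. \<bar>indicator (\<Union>i. A i) x - indicator (\<Union>i<m. A i) x :: real\<bar> \<partial>M) \<longlonglongrightarrow> (\<integral>x. 0 \<partial>M)"
        proof (rule integral_dominated_convergence[where w = "\<lambda>_. 1"])
          show "AE x in M. (\<lambda>m. \<bar>indicator (\<Union>i. A i) x - indicator (\<Union>i<m. A i) x :: real\<bar>) \<longlonglongrightarrow> 0"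
          proof (rule AE_I2)
            fix x
            show "(\<lambda>m. \<bar>indicator (\<Union>i. A i) x - indicator (\<Union>i<m. A i) x :: real\<bar>) \<longlonglongrightarrow> 0"
            proof (cases "x \<in> (\<Union>i. A i)")
              case True
              then obtain i where "x \<in> A i" by auto
              then have "\<forall>\<^sub>F m in sequentially. \<bar>indicator (\<Union>i. A i) x - indicator (\<Union>i<m. A i) x :: real\<bar> = 0"
                by (intro eventually_sequentiallyI[of "Suc i"]) (auto split: split_indicator)
              then show ?thesis by (rule tendsto_eventually)
            next
              case False
              then show ?thesis by (simp add: indicator_def)
            qed
          qed
        qed (use A in \<open>auto split: split_indicator\<close>)
        then show ?thesis by simp
      qed
      show "(\<lambda>n. \<integral>x. indicator (\<Union>i<m. A i) x * w n x \<partial>M)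
          \<longlonglongrightarrow> 0" for m
      proof -
        have "(\<integral>x. indicator (\<Union>i<m. A i) x * w n x \<partial>M)
            = (\<Sum>i<m. \<integral>x. indicator (A i) x * w n x \<partial>M)" for n
        proof -
          have "indicator (\<Union>i<m. A i) x = (\<Sum>i<m. indicator (A i) x :: real)" for x
            using union(1) by (intro indicator_UN_disjoint) (auto simp: disjoint_family_on_def)
          then show ?thesis
            by (subst Bochner_Integration.integral_sum[symmetric])
              (simp_all add: sum_distrib_right iw[OF ind[OF A]])
        qed
        moreover have "(\<lambda>n. \<Sum>i<m. \<integral>x. indicator (A i) x * w n x \<partial>M)
            \<longlonglongrightarrow> (\<Sum>i<m. 0)"
          by (intro tendsto_sum union(3))
        ultimately show ?thesis by simp
      qed
    qed (use A in \<open>auto intro!: ind\<close>)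
  qed
  show ?thesis using G
  proof (induction rule: integrable_induct)
    case (base A c)
    have eq: "(\<integral>x. indicat_real A x *\<^sub>R c * w n x \<partial>M)
        = c * (\<integral>x. indicator A x * w n x \<partial>M)" for n
    proof -
      have "(\<integral>x. indicat_real A x *\<^sub>R c * w n x \<partial>M)
          = (\<integral>x. c * (indicator A x * w n x) \<partial>M)"
        by (rule Bochner_Integration.integral_cong) (simp_all add: mult.assoc mult.left_commute)
      then show ?thesis by (simp only: integral_mult_right_zero)
    qed
    have "A \<in> sigma_sets (space M) E" using base by (simp add: E(4))
    from tendsto_mult_right_zero[OF *[OF this], of c] show ?case
      unfolding eq by simp
  next
    case (add f g)
    have eq: "(\<integral>x. (f x + g x) * w n x \<partial>M)
        = (\<integral>x. f x * w n x \<partial>M) + (\<integral>x. g x * w n x \<partial>M)" for n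
      using Bochner_Integration.integral_add[OF iw[OF add(1)] iw[OF add(2)], of n n]
        by (simp add: distrib_right)
    show ?case unfolding eq using tendsto_add[OF add(3,4)] by simp
  next
    case (lim f s)
    show ?case
    proof (rule closure[where G = f and g = s])
      have "(\<lambda>m. \<integral>x. \<bar>f x - s m x\<bar> \<partial>M)
          \<longlonglongrightarrow> (\<integral>x. 0 \<partial>M)"
      proof (rule integral_dominated_convergence[where w = "\<lambda>x. 3 * \<bar>f x\<bar>"])
        show "AE x in M. (\<lambda>m. \<bar>f x - s m x\<bar>) \<longlonglongrightarrow> 0"
        proof (rule AE_I2)
          fix x assume "x \<in> space M"
          then have "(\<lambda>m. s m x) \<longlonglongrightarrow> f x" by (rule lim(2))
          then have "(\<lambda>m. \<bar>f x - s m x\<bar>)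
              \<longlonglongrightarrow> \<bar>f x - f x\<bar>" by (intro tendsto_intros)
          then show "(\<lambda>m. \<bar>f x - s m x\<bar>) \<longlonglongrightarrow> 0" by simp
        qed
        show "AE x in M. norm \<bar>f x - s m x\<bar> \<le> 3 * \<bar>f x\<bar>" for m
        proof (rule AE_I2)
          fix x assume "x \<in> space M"
          from lim(3)[OF this, of m] show "norm \<bar>f x - s m x\<bar> \<le> 3 * \<bar>f x\<bar>"
            by simp
        qed
        show "(\<lambda>x. \<bar>f x - s m x\<bar>) \<in> borel_measurable M" for m
          using borel_measurable_integrable[OF lim(1)[of m]] borel_measurable_integrable[OF lim(4)] by measurable
        show "integrable M (\<lambda>x. 3 * \<bar>f x\<bar>)" using lim(4) by auto
      qed simp
      then show "(\<lambda>m. \<integral>x. \<bar>f x - s m x\<bar> \<partial>M)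
          \<longlonglongrightarrow> 0" by simp
    qed (assumption | rule lim)+
  qed
qed

text \<open>Obtained from the previous lemma for the constant sequence \<open>u - v\<close>, integrated against itself.\<close>

lemma (in finite_measure) AE_eq_of_integral_eq:
  fixes u v :: "'a \<Rightarrow> real"
  assumes u: "u \<in> borel_measurable M" "\<And>x. x \<in> space M
      \<Longrightarrow> \<bar>u x\<bar> \<le> B"
    and v: "v \<in> borel_measurable M" "\<And>x. x \<in> space M \<Longrightarrow> \<bar>v x\<bar>
        \<le> B"
    and E: "Int_stable E" "E \<subseteq> Pow (space M)" "space M \<in> E" "sets M
        = sigma_sets (space M) E"
    and eq: "\<And>A. A \<in> E \<Longrightarrow> (\<integral>x. indicator A x * u x \<partial>M)
        = (\<integral>x. indicator A x * v x \<partial>M)"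
  shows "AE x in M. u x = v x"
proof -
  define w where "w x = u x - v x" for x
  have w: "w \<in> borel_measurable M"
    using u v unfolding w_def by auto
  have wB: "\<bar>w x\<bar> \<le> B + B" if "x \<in> space M" for x
    using u(2)[OF that] v(2)[OF that] unfolding w_def by linarith
  note w = w wB
  have iw: "integrable M w"
    using w by (intro integrable_const_bound[where B = "B + B"]) auto
  have "(\<lambda>n. \<integral>x. w x * w x \<partial>M) \<longlonglongrightarrow> 0" for n :: nat
  proof (rule integral_mult_tendsto_0_of_generator[OF w E _ iw])
    fix A assume "A \<in> E"
    then have A: "A \<in> sets M" by (simp add: E(4))
    have "(\<integral>x. indicator A x * w x \<partial>M) = 0"
      unfolding w_def right_diff_distrib
      using eq[OF \<open>A \<in> E\<close>] A
      by (subst Bochner_Integration.integral_diff)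
        (auto intro!: integrable_mult_bounded[OF _ u] integrable_mult_bounded[OF _ v]
          integrable_real_indicator simp: emeasure_eq_measure)
    then show "(\<lambda>n. \<integral>x. indicator A x * w x \<partial>M)
        \<longlonglongrightarrow> 0" by simp
  qed
  then have "(\<integral>x. w x * w x \<partial>M) = 0" by (simp add: LIMSEQ_const_iff)
  then have "AE x in M. w x * w x = 0"
    by (subst (asm) integral_nonneg_eq_0_iff_AE) (auto intro!: integrable_mult_bounded iw w)
  then show ?thesis by (auto simp: w_def)
qed

lemma Int_stable_finite_Inter:
  "Int_stable {\<Omega> \<inter> \<Inter>D | D. finite D \<and> D \<subseteq> C}"
proof (rule Int_stableI)
  fix a b assume "a \<in> {\<Omega> \<inter> \<Inter>D | D. finite D \<and> D \<subseteq> C}" "b \<in> {\<Omega> \<inter> \<Inter>D | D. finite D \<and> D \<subseteq> C}"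
  then obtain D D' where "a = \<Omega> \<inter> \<Inter>D" "b
      = \<Omega> \<inter> \<Inter>D'" "finite D" "D \<subseteq> C" "finite D'" "D' \<subseteq> C"
    by auto
  then show "a \<inter> b \<in> {\<Omega> \<inter> \<Inter>D | D. finite D \<and> D \<subseteq> C}"
    by (intro CollectI exI[of _ "D \<union> D'"]) auto
qed

lemma sigma_sets_finite_Inter:
  assumes C: "C \<subseteq> Pow \<Omega>"
  shows "sigma_sets \<Omega> {\<Omega> \<inter> \<Inter>D | D. finite D \<and> D \<subseteq> C}
      = sigma_sets \<Omega> C"
proof (rule antisym)
  interpret S: sigma_algebra \<Omega> "sigma_sets \<Omega> C" by (rule sigma_algebra_sigma_sets[OF C])
  show "sigma_sets \<Omega> {\<Omega> \<inter> \<Inter>D | D. finite D \<and> D \<subseteq> C} \<subseteq> sigma_sets \<Omega> C"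
  proof (rule S.sigma_sets_subset, safe)
    fix D assume "finite D" "D \<subseteq> C"
    then show "\<Omega> \<inter> \<Inter>D \<in> sigma_sets \<Omega> C"
    proof (induction D)
      case (insert a D)
      have "\<Omega> \<inter> \<Inter>(insert a D) = a \<inter> (\<Omega> \<inter> \<Inter>D)" by auto
      moreover have "a \<inter> (\<Omega> \<inter> \<Inter>D) \<in> sigma_sets \<Omega> C"
        by (rule S.Int) (use insert in auto)
      ultimately show ?case by (simp only:)
    qed simp
  qed
  show "sigma_sets \<Omega> C \<subseteq> sigma_sets \<Omega> {\<Omega> \<inter> \<Inter>D | D. finite D \<and> D \<subseteq> C}"
  proof (rule sigma_sets_mono', rule subsetI)
    fix c assume "c \<in> C"
    then show "c \<in> {\<Omega> \<inter> \<Inter>D | D. finite D \<and> D \<subseteq> C}"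
      using C by (intro CollectI exI[of _ "{c}"]) auto
  qed
qed

lemma AE_measure_eqI_countable_generator:
  fixes K1 K2 :: "'x \<Rightarrow> 'a measure"
  assumes C: "countable C" "C \<subseteq> Pow \<Omega>"
    and K1: "\<And>x. x \<in> space M \<Longrightarrow> prob_space (K1 x) \<and> sets (K1 x)
        = sigma_sets \<Omega> C"
    and K2: "\<And>x. x \<in> space M \<Longrightarrow> prob_space (K2 x) \<and> sets (K2 x)
        = sigma_sets \<Omega> C"
    and eq: "\<And>D. finite D \<Longrightarrow> D \<subseteq> C \<Longrightarrow>
      AE x in M. measure (K1 x) (\<Omega> \<inter> \<Inter>D) = measure (K2 x) (\<Omega> \<inter> \<Inter>D)"
  shows "AE x in M. K1 x = K2 x"
proof -
  have "countable {D. finite D \<and> D \<subseteq> C}"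
    using C(1) by (rule countable_Collect_finite_subset)
  then have "AE x in M. \<forall>D\<in>{D. finite D \<and> D \<subseteq> C}. measure (K1 x) (\<Omega> \<inter> \<Inter>D) = measure (K2 x) (\<Omega> \<inter> \<Inter>D)"
    by (subst AE_ball_countable) (use eq in auto)
  then show ?thesis
  proof (rule AE_mp, intro AE_I2 impI)
    fix x assume x: "x \<in> space M"
      and D: "\<forall>D\<in>{D. finite D \<and> D \<subseteq> C}. measure (K1 x) (\<Omega> \<inter> \<Inter>D) = measure (K2 x) (\<Omega> \<inter> \<Inter>D)"
    interpret k1: prob_space "K1 x" using K1[OF x] by simp
    interpret k2: prob_space "K2 x" using K2[OF x] by simp
    show "K1 x = K2 x"
    proof (rule measure_eqI_generator_eq[where \<Omega> = \<Omega> and A = "\<lambda>_. \<Omega>"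
          and E = "{\<Omega> \<inter> \<Inter>D | D. finite D \<and> D \<subseteq> C}"])
      show "Int_stable {\<Omega> \<inter> \<Inter>D | D. finite D \<and> D \<subseteq> C}"
        by (rule Int_stable_finite_Inter)
      show "sets (K1 x) = sigma_sets \<Omega> {\<Omega> \<inter> \<Inter>D | D. finite D \<and> D \<subseteq> C}"
        "sets (K2 x) = sigma_sets \<Omega> {\<Omega> \<inter> \<Inter>D | D. finite D \<and> D \<subseteq> C}"
        using K1[OF x] K2[OF x] by (simp_all add: sigma_sets_finite_Inter[OF C(2)])
      show "emeasure (K1 x) X = emeasure (K2 x) X"
        if "X \<in> {\<Omega> \<inter> \<Inter>D | D. finite D \<and> D \<subseteq> C}" for X
        using that D by (auto simp: k1.emeasure_eq_measure k2.emeasure_eq_measure)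
      have "\<Omega> \<in> {\<Omega> \<inter> \<Inter>D | D. finite D \<and> D \<subseteq> C}"
        by (rule CollectI, rule exI[of _ "{}"]) simp
      then show "range (\<lambda>_::nat. \<Omega>) \<subseteq> {\<Omega> \<inter> \<Inter>D | D. finite D \<and> D \<subseteq> C}" by simp
      show "emeasure (K1 x) \<Omega> \<noteq> \<infinity>" by simp
    qed auto
  qed
qed

lemma (in prob_space) AE_imp_Bex:
  assumes "AE x in M. P x" shows "\<exists>x\<in>space M. P x"
proof (rule ccontr)
  assume *: "\<not> (\<exists>x\<in>space M. P x)"
  have "AE x in M. False"
    using assms by (rule AE_mp) (use * in auto)
  then show False by (simp add: AE_False)
qed

text \<open>The exceptional null sets for countably many events are collected into a single one, so that the
  constant value can be taken to be \<open>K x\<close> at any point outside of it.\<close>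

lemma AE_const_measure_of_countable_generator:
  fixes K :: "'x \<Rightarrow> 'a measure"
  assumes M: "prob_space M" and C: "countable C" "C \<subseteq> Pow \<Omega>"
    and K: "\<And>x. x \<in> space M \<Longrightarrow> prob_space (K x) \<and> sets (K x)
        = sigma_sets \<Omega> C"
    and const: "\<And>D. finite D \<Longrightarrow> D \<subseteq> C
        \<Longrightarrow> \<exists>c. AE x in M. measure (K x) (\<Omega> \<inter> \<Inter>D) = c"
  shows "\<exists>Q. AE x in M. K x = Q"
proof -
  interpret prob_space M by fact
  obtain c where c: "\<And>D. finite D \<Longrightarrow> D \<subseteq> C
      \<Longrightarrow> AE x in M. measure (K x) (\<Omega> \<inter> \<Inter>D) = c D"
    using const by metis
  have "countable {D. finite D \<and> D \<subseteq> C}"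
    using C(1) by (rule countable_Collect_finite_subset)
  then have "AE x in M. \<forall>D\<in>{D. finite D \<and> D \<subseteq> C}. measure (K x) (\<Omega> \<inter> \<Inter>D) = c D"
    by (subst AE_ball_countable) (use c in auto)
  then have "\<exists>x\<in>space M. \<forall>D\<in>{D. finite D \<and> D \<subseteq> C}. measure (K x) (\<Omega> \<inter> \<Inter>D) = c D"
    using AE_imp_Bex by blast
  then obtain x0 where x0: "x0 \<in> space M"
    "\<And>D. finite D \<Longrightarrow> D \<subseteq> C
        \<Longrightarrow> measure (K x0) (\<Omega> \<inter> \<Inter>D) = c D" by blast
  have "AE x in M. K x = K x0"
    by (rule AE_measure_eqI_countable_generator[where ?K1.0 = K and ?K2.0 = "\<lambda>_. K x0" and M = M and C = C and \<Omega> = \<Omega>])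
      (use C c x0 K in auto)
  then show ?thesis by blast
qed


section \<open>Independent identically distributed fields\<close>

text \<open>The field \<open>J\<close> with \<open>t\<close> added on the coordinates in \<open>D\<close>; the values of \<open>t\<close> outside of \<open>D\<close> are
  irrelevant.\<close>

definition shift :: "'a set \<Rightarrow> ('a \<Rightarrow> real) \<Rightarrow> ('a \<Rightarrow> real) \<Rightarrow> 'a \<Rightarrow> real" where
  "shift D t J = (\<lambda>e. if e \<in> D then J e + t e else J e)"

text \<open>A field of independent variables with common law \<open>N\<close>, indexed by an arbitrary set \<open>I\<close>. For the
  couplings of the Edwards--Anderson model, \<open>I\<close> is the set of edges.\<close>

locale iid_field = prob_space N for N :: "real measure" +
  fixes I :: "'i set"
  assumes sets_N [measurable_cong]: "sets N = sets borel"
begin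

abbreviation iid_law :: "('i \<Rightarrow> real) measure" where "iid_law \<equiv> PiM I (\<lambda>_. N)"

sublocale P: prob_space iid_law
  by (intro prob_space_PiM prob_space_axioms)

lemma space_N: "space N = UNIV"
  using sets_eq_imp_space_eq[OF sets_N] by simp

lemma space_iid: "space iid_law = I \<rightarrow>\<^sub>E UNIV"
  by (simp add: space_PiM space_N)

text \<open>Events that restrict finitely many coordinates to closed sets. Indicators of closed sets are
  decreasing limits of continuous functions, and these events generate the product \<open>\<sigma>\<close>-algebra.\<close>

definition closed_cylinders :: "('i \<Rightarrow> real) set set" where
  "closed_cylinders = {{J \<in> I \<rightarrow>\<^sub>E UNIV. \<forall>e\<in>A. J e \<in> F e} | A F. finite A \<and> A \<subseteq> I \<and> (\<forall>e. closed (F e))}"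

lemma closed_cylinders:
  "Int_stable closed_cylinders" "closed_cylinders \<subseteq> Pow (space iid_law)" "space iid_law \<in> closed_cylinders"
  "sets iid_law = sigma_sets (space iid_law) closed_cylinders"
proof -
  show "Int_stable closed_cylinders"
  proof (rule Int_stableI)
    fix a b :: "('i \<Rightarrow> real) set" assume "a \<in> closed_cylinders" "b \<in> closed_cylinders"
    then obtain A F A' F' where a: "a
        = {J \<in> I \<rightarrow>\<^sub>E UNIV. \<forall>e\<in>A. J e \<in> F e}" "finite A" "A \<subseteq> I" "\<forall>e. closed (F e)"
      and b: "b = {J \<in> I \<rightarrow>\<^sub>E UNIV. \<forall>e\<in>A'. J e \<in> F' e}" "finite A'" "A' \<subseteq> I" "\<forall>e. closed (F' e)"
      unfolding closed_cylinders_def by blast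
    define G where "G e = (if e \<in> A then F e else UNIV) \<inter> (if e \<in> A' then F' e else UNIV)" for e
    have "a \<inter> b = {J \<in> I \<rightarrow>\<^sub>E UNIV. \<forall>e\<in>A \<union> A'. J e \<in> G e}"
      unfolding a(1) b(1) G_def by (auto split: if_splits)
    moreover have "closed (G e)" for e using a b by (auto simp: G_def)
    ultimately show "a \<inter> b \<in> closed_cylinders"
      unfolding closed_cylinders_def using a b
      by (intro CollectI exI[of _ "A \<union> A'"] exI[of _ G]) auto
  qed
  show sub: "closed_cylinders \<subseteq> Pow (space iid_law)"
    unfolding closed_cylinders_def space_iid by auto
  show "space iid_law \<in> closed_cylinders"
    unfolding closed_cylinders_def space_iid
    by (rule CollectI, rule exI[of _ "{}"], rule exI[of _ "\<lambda>_. UNIV"]) auto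
  have meas: "closed_cylinders \<subseteq> sets iid_law"
  proof
    fix a :: "('i \<Rightarrow> real) set" assume "a \<in> closed_cylinders"
    then obtain A F where a: "a = {J \<in> I \<rightarrow>\<^sub>E UNIV. \<forall>e\<in>A. J e \<in> F e}" "finite A" "A \<subseteq> I" "\<forall>e. closed (F e)"
      unfolding closed_cylinders_def by blast
    have "a = {J \<in> space iid_law. \<forall>e\<in>A. J e \<in> F e}" by (simp add: a space_iid)
    also have "\<dots> \<in> sets iid_law"
    proof (rule sets.sets_Collect_finite_All[OF _ a(2)])
      fix e assume "e \<in> A"
      then have [measurable]: "e \<in> I" using a(3) by auto
      have [measurable]: "F e \<in> sets borel" using a(4) by auto
      show "{J \<in> space iid_law. J e \<in> F e} \<in> sets iid_law" by measurable
    qed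
    finally show "a \<in> sets iid_law" .
  qed
  show "sets iid_law = sigma_sets (space iid_law) closed_cylinders"
  proof (rule antisym)
    show "sigma_sets (space iid_law) closed_cylinders \<subseteq> sets iid_law"
      by (rule sets.sigma_sets_subset[OF meas])
    interpret S: sigma_algebra "I \<rightarrow>\<^sub>E UNIV" "sigma_sets (I \<rightarrow>\<^sub>E UNIV) closed_cylinders"
      by (rule sigma_algebra_sigma_sets) (use sub in \<open>simp add: space_iid\<close>)
    have "{J \<in> I \<rightarrow>\<^sub>E UNIV. J e \<in> B} \<in> sigma_sets (I \<rightarrow>\<^sub>E UNIV) closed_cylinders"
      if "e \<in> I" "B \<in> sets borel" for e B
    proof -
      have "B \<in> sigma_sets UNIV (Collect closed)"
        using that(2) by (simp add: borel_eq_closed)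
      then show ?thesis
      proof (induction B)
        case (Basic F)
        then have "{J \<in> I \<rightarrow>\<^sub>E UNIV. J e \<in> F} \<in> closed_cylinders"
          unfolding closed_cylinders_def using that(1)
          by (intro CollectI exI[of _ "{e}"] exI[of _ "\<lambda>_. F"]) auto
        then show ?case by (rule sigma_sets.Basic)
      next
        case Empty
        then show ?case by (simp add: sigma_sets.Empty)
      next
        case (Compl B)
        have "{J \<in> I \<rightarrow>\<^sub>E UNIV. J e \<in> UNIV - B}
            = (I \<rightarrow>\<^sub>E UNIV) - {J \<in> I \<rightarrow>\<^sub>E UNIV. J e \<in> B}" by auto
        with Compl show ?case by (simp add: sigma_sets.Compl)
      next
        case (Union B)
        have "{J \<in> I \<rightarrow>\<^sub>E UNIV. J e \<in> (\<Union>i. B i)}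
            = (\<Union>i. {J \<in> I \<rightarrow>\<^sub>E UNIV. J e \<in> B i})" by auto
        with Union show ?case by (simp add: sigma_sets.Union)
      qed
    qed
    then show "sets iid_law \<subseteq> sigma_sets (space iid_law) closed_cylinders"
      unfolding sets_PiM_single space_N space_iid
      by (intro S.sigma_sets_subset) (auto simp: sets_N)
  qed
qed

text \<open>Convergence in the sense of finite-dimensional distributions only provides test functions that are
  continuous in finitely many coordinates. Since the law of the field does not depend on \<open>n\<close>, these suffice.\<close>

lemma integral_mult_tendsto_0_of_continuous_cylinders:
  fixes w :: "nat \<Rightarrow> ('i \<Rightarrow> real) \<Rightarrow> real"
  assumes w: "\<And>n. w n \<in> borel_measurable iid_law" "\<And>n x. x \<in> space iid_law
      \<Longrightarrow> \<bar>w n x\<bar> \<le> B"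
    and lim: "\<And>A g. finite A \<Longrightarrow> A \<subseteq> I
        \<Longrightarrow> (\<And>e. continuous_on UNIV (g e)) \<Longrightarrow>
      (\<And>e t. 0 \<le> g e t \<and> g e t \<le> (1::real)) \<Longrightarrow>
      (\<lambda>n. \<integral>J. (\<Prod>e\<in>A. g e (J e)) * w n J \<partial>iid_law) \<longlonglongrightarrow> 0"
    and G: "integrable iid_law G"
  shows "(\<lambda>n. \<integral>x. G x * w n x \<partial>iid_law) \<longlonglongrightarrow> 0"
proof (rule P.integral_mult_tendsto_0_of_generator[OF w closed_cylinders _ G])
  fix C :: "('i \<Rightarrow> real) set" assume "C \<in> closed_cylinders"
  then obtain A F where C: "C = {J \<in> I \<rightarrow>\<^sub>E UNIV. \<forall>e\<in>A. J e \<in> F e}" "finite A" "A \<subseteq> I" "\<forall>e. closed (F e)"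
    unfolding closed_cylinders_def by blast
  have C_sets: "C \<in> sets iid_law"
    using \<open>C \<in> closed_cylinders\<close> closed_cylinders(4) by auto
  \<comment> \<open>The distance to the empty set is \<open>0\<close> by convention, hence the case distinction.\<close>
  define g where "g m e t = (if F e = {} then 0 else max 0 (1 - real m * infdist t (F e)))" for m e t
  have g_cont: "continuous_on UNIV (g m e)" for m e
  proof (cases "F e = {}")
    case False
    then show ?thesis unfolding g_def by (auto intro!: continuous_intros)
  qed (simp add: g_def)
  have g_bounds: "0 \<le> g m e t \<and> g m e t \<le> 1" for m e t
    by (auto simp: g_def infdist_nonneg)
  have g_lim: "(\<lambda>m. g m e t) \<longlonglongrightarrow> indicator (F e) t" for e t
  proof (cases "F e = {}")
    case False
    show ?thesis
    proof (cases "t \<in> F e")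
      case True
      then show ?thesis using False by (simp add: g_def)
    next
      case t: False
      then have pos: "infdist t (F e) > 0" using C(4) False by (intro infdist_pos_not_in_closed) auto
      obtain k where k: "1 / infdist t (F e) < real k" using reals_Archimedean2 by blast
      have "\<forall>\<^sub>F m in sequentially. g m e t = 0"
      proof (rule eventually_sequentiallyI[of k])
        fix m assume "k \<le> m"
        then have "1 / infdist t (F e) \<le> real m" using k by linarith
        then have "1 \<le> real m * infdist t (F e)" using pos by (simp add: field_simps)
        then show "g m e t = 0" by (simp add: g_def)
      qed
      then show ?thesis using t by (simp add: tendsto_eventually)
    qed
  qed (simp add: g_def)
  have g_meas [measurable]: "g m e \<in> borel_measurable borel" for m e
    by (rule borel_measurable_continuous_onI[OF g_cont])
  have prod_meas: "(\<lambda>J. \<Prod>e\<in>A. g m e (J e)) \<in> borel_measurable iid_law" for m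
  proof (rule borel_measurable_prod)
    fix e assume "e \<in> A"
    then have [measurable]: "e \<in> I" using C(3) by auto
    show "(\<lambda>J. g m e (J e)) \<in> borel_measurable iid_law" by measurable
  qed
  have prod_bounds: "0 \<le> (\<Prod>e\<in>A. g m e (J e)) \<and> (\<Prod>e\<in>A. g m e (J e))
      \<le> 1" for m and J :: "'i \<Rightarrow> real"
    using g_bounds by (auto intro!: prod_nonneg prod_le_1)
  have prod_lim: "(\<lambda>m. \<Prod>e\<in>A. g m e (J e)) \<longlonglongrightarrow> indicator C J"
    if "J \<in> space iid_law" for J
  proof -
    have "(\<lambda>m. \<Prod>e\<in>A. g m e (J e))
        \<longlonglongrightarrow> (\<Prod>e\<in>A. indicator (F e) (J e))"
      by (intro tendsto_prod g_lim)
    also have "(\<Prod>e\<in>A. indicator (F e) (J e)) = (indicator C J :: real)"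
      using C(2) that by (auto simp: C(1) space_iid indicator_def)
    finally show ?thesis .
  qed
  show "(\<lambda>n. \<integral>x. indicator C x * w n x \<partial>iid_law) \<longlonglongrightarrow> 0"
  proof (rule P.integral_mult_tendsto_0_closure[OF w, where g = "\<lambda>m J. \<Prod>e\<in>A. g m e (J e)"])
    show "integrable iid_law (indicator C :: _ \<Rightarrow> real)"
      using C_sets by (intro integrable_real_indicator) (simp_all add: P.emeasure_eq_measure)
    show "integrable iid_law (\<lambda>J. \<Prod>e\<in>A. g m e (J e))" for m
      using prod_bounds prod_meas by (intro P.integrable_const_bound[where B = 1]) auto
    have "(\<lambda>m. \<integral>J. \<bar>indicator C J - (\<Prod>e\<in>A. g m e (J e))\<bar> \<partial>iid_law) \<longlonglongrightarrow> (\<integral>J. 0 \<partial>iid_law)"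
    proof (rule integral_dominated_convergence[where w = "\<lambda>_. 1"])
      show "AE J in iid_law. (\<lambda>m. \<bar>indicator C J - (\<Prod>e\<in>A. g m e (J e))\<bar>)
          \<longlonglongrightarrow> 0"
      proof (rule AE_I2)
        fix J assume "J \<in> space iid_law"
        from tendsto_diff[OF tendsto_const[of "indicator C J"] prod_lim[OF this]]
        show "(\<lambda>m. \<bar>indicator C J - (\<Prod>e\<in>A. g m e (J e))\<bar>)
            \<longlonglongrightarrow> 0"
          by (intro tendsto_rabs_zero) simp
      qed
      show "AE J in iid_law. norm \<bar>indicator C J - (\<Prod>e\<in>A. g m e (J e))\<bar>
          \<le> 1" for m
      proof (rule AE_I2)
        fix J
        show "norm \<bar>indicator C J - (\<Prod>e\<in>A. g m e (J e))\<bar> \<le> 1"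
          using prod_bounds[of m J] by (auto split: split_indicator)
      qed
    qed (use C_sets prod_meas in auto)
    then show "(\<lambda>m. \<integral>J. \<bar>indicator C J - (\<Prod>e\<in>A. g m e (J e))\<bar> \<partial>iid_law) \<longlonglongrightarrow> 0" by simp
    show "(\<lambda>n. \<integral>J. (\<Prod>e\<in>A. g m e (J e)) * w n J \<partial>iid_law)
        \<longlonglongrightarrow> 0" for m
      by (rule lim[OF C(2,3) g_cont g_bounds])
  qed
qed

lemma measurable_reindex:
  "\<pi> ` I \<subseteq> I \<Longrightarrow> (\<lambda>J. \<lambda>e\<in>I. J (\<pi> e)) \<in> iid_law \<rightarrow>\<^sub>M iid_law"
  by (rule measurable_restrict) (auto intro!: measurable_component_singleton)

lemma distr_reindex:
  assumes "inj_on \<pi> I" "\<pi> ` I \<subseteq> I"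
  shows "distr iid_law iid_law (\<lambda>J. \<lambda>e\<in>I. J (\<pi> e)) = iid_law"
  using distr_PiM_reindex[of I "\<lambda>_. N" \<pi> I] assms prob_space_axioms by auto

lemma integral_reindex:
  fixes f :: "_ \<Rightarrow> real"
  assumes "inj_on \<pi> I" "\<pi> ` I \<subseteq> I" "f \<in> borel_measurable iid_law"
  shows "(\<integral>J. f (\<lambda>e\<in>I. J (\<pi> e)) \<partial>iid_law)
      = (\<integral>J. f J \<partial>iid_law)"
  by (subst (2) distr_reindex[OF assms(1,2), symmetric])
    (simp add: integral_distr[OF measurable_reindex[OF assms(2)] assms(3)])

lemma measure_cylinder:
  assumes "finite A" "A \<subseteq> I" "\<And>e. F e \<in> sets borel"
  shows "measure iid_law {J \<in> I \<rightarrow>\<^sub>E UNIV. \<forall>e\<in>A. J e \<in> F e}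
      = (\<Prod>e\<in>A. measure N (F e))"
proof -
  interpret PP: product_prob_space "\<lambda>_. N" I
    by (rule product_prob_spaceI) (rule prob_space_axioms)
  have "{J \<in> I \<rightarrow>\<^sub>E UNIV. \<forall>e\<in>A. J e \<in> F e}
      = prod_emb I (\<lambda>_. N) A (PiE A F)"
    using assms(2) by (auto simp: prod_emb_def space_PiM space_N PiE_iff extensional_def)
  then show ?thesis
    using PP.measure_PiM_emb[OF assms(2,1)] assms(3) by (simp add: sets_N)
qed

text \<open>Ergodicity by mixing: if the index maps \<open>\<pi> n\<close> move every finite set of indices away from every other one,
  then a bounded function that is almost surely invariant under all of them is almost surely constant.
  For a cylinder event \<open>C\<close>, the events \<open>(\<pi> n)\<^sup>-\<^sup>1 C\<close> become independent of any other cylinder event; hence the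
  integral of \<open>\<phi>\<close> over \<open>(\<pi> n)\<^sup>-\<^sup>1 C\<close>, which equals the one over \<open>C\<close> by invariance, converges to
  \<open>P(C) \<integral> \<phi>\<close>.\<close>

lemma mixing_invariant_const:
  fixes \<phi> :: "('i \<Rightarrow> real) \<Rightarrow> real"
    and \<pi> :: "nat \<Rightarrow> 'i \<Rightarrow> 'i"
  assumes \<pi>: "\<And>n. inj_on (\<pi> n) I" "\<And>n. \<pi> n ` I \<subseteq> I"
    and disj: "\<And>A B. finite A \<Longrightarrow> A \<subseteq> I \<Longrightarrow> finite B
        \<Longrightarrow> B \<subseteq> I \<Longrightarrow> \<forall>\<^sub>F n in sequentially. \<pi> n ` A \<inter> B = {}"
    and \<phi>: "\<phi> \<in> borel_measurable iid_law" "\<And>J. J \<in> space iid_law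
        \<Longrightarrow> \<bar>\<phi> J\<bar> \<le> B"
    and inv: "\<And>n. AE J in iid_law. \<phi> (\<lambda>e\<in>I. J (\<pi> n e)) = \<phi> J"
  shows "AE J in iid_law. \<phi> J = (\<integral>J. \<phi> J \<partial>iid_law)"
proof (rule P.AE_eq_of_integral_eq[OF \<phi> _ _ closed_cylinders])
  have int_\<phi>: "integrable iid_law \<phi>"
    using \<phi> by (intro P.integrable_const_bound[where B = B]) auto
  show "\<bar>\<integral>J. \<phi> J \<partial>iid_law\<bar> \<le> B"
  proof -
    have "\<bar>\<integral>J. \<phi> J \<partial>iid_law\<bar>
        \<le> (\<integral>J. \<bar>\<phi> J\<bar> \<partial>iid_law)" by (rule integral_abs_bound)
    also have "\<dots> \<le> (\<integral>J. B \<partial>iid_law)"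
      using int_\<phi> \<phi>(2) by (intro integral_mono) auto
    finally show ?thesis by (simp add: P.prob_space)
  qed
  fix C :: "('i \<Rightarrow> real) set" assume C: "C \<in> closed_cylinders"
  then obtain A F where C_def: "C
      = {J \<in> I \<rightarrow>\<^sub>E UNIV. \<forall>e\<in>A. J e \<in> F e}" "finite A" "A \<subseteq> I" "\<forall>e. closed (F e)"
    unfolding closed_cylinders_def by blast
  have C_sets [measurable]: "C \<in> sets iid_law" using C closed_cylinders(4) by auto
  define T where "T n J = (\<lambda>e\<in>I. J (\<pi> n e))" for n and J :: "'i \<Rightarrow> real"
  have T [measurable]: "T n \<in> iid_law \<rightarrow>\<^sub>M iid_law" for n
    unfolding T_def by (rule measurable_reindex[OF \<pi>(2)])
  define w where "w n J = indicator C (T n J) - measure iid_law C" for n J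
  have "(\<lambda>n. \<integral>J. \<phi> J * w n J \<partial>iid_law) \<longlonglongrightarrow> 0"
  proof (rule P.integral_mult_tendsto_0_of_generator[OF _ _ closed_cylinders _ int_\<phi>])
    show "w n \<in> borel_measurable iid_law" for n
      unfolding w_def by measurable
    show "\<bar>w n J\<bar> \<le> 1" for n J
      unfolding w_def by (auto split: split_indicator)
    fix C' :: "('i \<Rightarrow> real) set" assume C': "C' \<in> closed_cylinders"
    then obtain A' F' where C'_def: "C'
        = {J \<in> I \<rightarrow>\<^sub>E UNIV. \<forall>e\<in>A'. J e \<in> F' e}" "finite A'" "A' \<subseteq> I" "\<forall>e. closed (F' e)"
      unfolding closed_cylinders_def by blast
    have C'_sets [measurable]: "C' \<in> sets iid_law" using C' closed_cylinders(4) by auto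
    have "(\<integral>J. indicator C' J * w n J \<partial>iid_law)
        = 0" if n: "\<pi> n ` A \<inter> A' = {}" for n
    proof -
      \<comment> \<open>The preimage of \<open>C\<close>, a cylinder event over the indices \<open>\<pi> n ` A\<close>, which are disjoint from \<open>A'\<close>.\<close>
      define D where "D = {J \<in> I \<rightarrow>\<^sub>E UNIV. \<forall>e\<in>\<pi> n ` A. J e \<in> F (inv_into I (\<pi> n) e)}"
      have inv_pi: "inv_into I (\<pi> n) (\<pi> n e) = e" if "e \<in> A" for e
        using that C_def(3) \<pi>(1)[of n] by (intro inv_into_f_f) auto
      have piA: "\<pi> n ` A \<subseteq> I" "finite (\<pi> n ` A)" using \<pi>(2) C_def by blast+
      have closedF: "F e \<in> sets borel" "F' e \<in> sets borel" for e
        using C_def(4) C'_def(4) by auto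
      have ind: "indicator C (T n J) = (indicator D J :: real)" if "J \<in> space iid_law" for J
        using that C_def(3) inv_pi by (auto simp: T_def C_def(1) D_def space_iid indicator_def)
      have mD: "measure iid_law D = (\<Prod>e\<in>A. measure N (F e))"
        unfolding D_def measure_cylinder[OF piA(2,1) closedF(1)]
        using \<pi>(1)[of n] C_def(3) inv_pi
        by (subst prod.reindex) (auto intro: inj_on_subset)
      have mC: "measure iid_law C = (\<Prod>e\<in>A. measure N (F e))"
        unfolding C_def(1) by (rule measure_cylinder[OF C_def(2,3) closedF(1)])
      define G where "G e = (if e \<in> A' then F' e else F (inv_into I (\<pi> n) e))" for e
      have "C' \<inter> D = {J \<in> I \<rightarrow>\<^sub>E UNIV. \<forall>e\<in>A' \<union> \<pi> n ` A. J e \<in> G e}"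
        unfolding C'_def(1) D_def using n by (auto simp: G_def split: if_splits)
      then have "measure iid_law (C' \<inter> D)
          = (\<Prod>e\<in>A' \<union> \<pi> n ` A. measure N (G e))"
        using piA C'_def(2,3) closedF by (simp only:) (rule measure_cylinder, auto simp: G_def)
      also have "\<dots> = (\<Prod>e\<in>A'. measure N (G e)) * (\<Prod>e\<in>\<pi> n ` A. measure N (G e))"
        using piA C'_def(2) n by (intro prod.union_disjoint) auto
      also have "(\<Prod>e\<in>A'. measure N (G e)) = measure iid_law C'"
        unfolding C'_def(1) measure_cylinder[OF C'_def(2,3) closedF(2)]
        by (intro prod.cong) (auto simp: G_def)
      also have "(\<Prod>e\<in>\<pi> n ` A. measure N (G e)) = measure iid_law D"
        unfolding D_def measure_cylinder[OF piA(2,1) closedF(1)]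
        using n by (intro prod.cong) (auto simp: G_def)
      finally have mCD: "measure iid_law (C' \<inter> D) = measure iid_law C' * measure iid_law C"
        by (simp add: mC mD)
      have D_sets [measurable]: "D \<in> sets iid_law"
      proof -
        have "D \<in> closed_cylinders" unfolding closed_cylinders_def D_def using piA C_def(4)
          by (intro CollectI exI[of _ "\<pi> n ` A"] exI[of _ "\<lambda>e. F (inv_into I (\<pi> n) e)"]) auto
        then show ?thesis using closed_cylinders(4) by auto
      qed
      have "(\<integral>J. indicator C' J * w n J \<partial>iid_law)
          = (\<integral>J. indicator (C' \<inter> D) J - measure iid_law C * indicator C' J \<partial>iid_law)"
        by (intro Bochner_Integration.integral_cong) (auto simp: w_def ind split: split_indicator)
      also have "\<dots> = 0"
        by (subst Bochner_Integration.integral_diff) (auto simp: P.emeasure_eq_measure mCD)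
      finally show ?thesis .
    qed
    then have "\<forall>\<^sub>F n in sequentially. (\<integral>J. indicator C' J * w n J \<partial>iid_law) = 0"
      using disj[OF C_def(2,3) C'_def(2,3)] by (auto elim: eventually_mono)
    then show "(\<lambda>n. \<integral>J. indicator C' J * w n J \<partial>iid_law)
        \<longlonglongrightarrow> 0" by (rule tendsto_eventually)
  qed
  moreover have "(\<integral>J. \<phi> J * w n J \<partial>iid_law)
      = (\<integral>J. indicator C J * \<phi> J \<partial>iid_law) - (\<integral>J. indicator C J * (\<integral>J. \<phi> J \<partial>iid_law) \<partial>iid_law)" for n
  proof -
    have i1: "integrable iid_law (\<lambda>J. \<phi> J * indicator C (T n J))"
      by (rule P.integrable_mult_bounded[where B = 1, OF int_\<phi>]) (auto split: split_indicator)
    have "(\<integral>J. \<phi> J * w n J \<partial>iid_law)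
        = (\<integral>J. \<phi> J * indicator C (T n J) \<partial>iid_law) - (\<integral>J. \<phi> J * measure iid_law C \<partial>iid_law)"
      unfolding w_def right_diff_distrib
      by (rule Bochner_Integration.integral_diff) (use i1 int_\<phi> in auto)
    also have "(\<integral>J. \<phi> J * indicator C (T n J) \<partial>iid_law)
        = (\<integral>J. \<phi> (T n J) * indicator C (T n J) \<partial>iid_law)"
      using inv[of n] \<phi>(1) by (intro integral_cong_AE) (auto simp: T_def[symmetric])
    also have "\<dots> = (\<integral>J. \<phi> J * indicator C J \<partial>iid_law)"
      using integral_reindex[OF \<pi>, of "\<lambda>J. \<phi> J * indicator C J" n] \<phi>(1)
        by (simp add: T_def)
    finally show ?thesis by (simp add: mult.commute)
  qed
  ultimately show "(\<integral>J. indicator C J * \<phi> J \<partial>iid_law)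
      = (\<integral>J. indicator C J * (\<integral>J. \<phi> J \<partial>iid_law) \<partial>iid_law)"
    by (simp add: LIMSEQ_const_iff)
qed simp_all

lemma measurable_shift_pair:
  assumes "D \<subseteq> I"
  shows "(\<lambda>(J, t). shift D t J) \<in> iid_law \<Otimes>\<^sub>M PiM D (\<lambda>_. N) \<rightarrow>\<^sub>M iid_law"
proof (rule measurable_PiM_single')
  show "(\<lambda>x. (case x of (J, t) \<Rightarrow> shift D t J) e) \<in> iid_law \<Otimes>\<^sub>M PiM D (\<lambda>_. N) \<rightarrow>\<^sub>M N" if [measurable]: "e \<in> I" for e
  proof (cases "e \<in> D")
    case [measurable]: True
    have "(\<lambda>x. fst x e + snd x e) \<in> iid_law \<Otimes>\<^sub>M PiM D (\<lambda>_. N) \<rightarrow>\<^sub>M borel" by measurable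
    then show ?thesis using True
      by (simp add: shift_def split_beta' measurable_cong_sets[OF refl sets_N])
  next
    case False
    have "(\<lambda>x. fst x e) \<in> iid_law \<Otimes>\<^sub>M PiM D (\<lambda>_. N) \<rightarrow>\<^sub>M N" by measurable
    then show ?thesis using False by (simp add: shift_def split_beta')
  qed
  show "(\<lambda>x. case x of (J, t) \<Rightarrow> shift D t J) \<in> space (iid_law \<Otimes>\<^sub>M PiM D (\<lambda>_. N)) \<rightarrow> I \<rightarrow>\<^sub>E space N"
    using assms by (auto simp: space_pair_measure space_PiM space_N shift_def PiE_iff extensional_def)
qed

lemma measurable_shift:
  assumes "D \<subseteq> I"
  shows "shift D t \<in> iid_law \<rightarrow>\<^sub>M iid_law"
proof (rule measurable_PiM_single')
  show "(\<lambda>J. shift D t J e) \<in> iid_law \<rightarrow>\<^sub>M N" if [measurable]: "e \<in> I" for e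
  proof (cases "e \<in> D")
    case True
    have "(\<lambda>J. J e + t e) \<in> iid_law \<rightarrow>\<^sub>M borel" by measurable
    then show ?thesis using True by (simp add: shift_def measurable_cong_sets[OF refl sets_N])
  next
    case False
    then show ?thesis using that by (simp add: shift_def)
  qed
  show "shift D t \<in> space iid_law \<rightarrow> I \<rightarrow>\<^sub>E space N"
    using assms by (auto simp: space_PiM space_N shift_def PiE_iff extensional_def)
qed

end

text \<open>The common law is now quasi-invariant under translations of the real line. This follows from
  the existence of an almost everywhere positive density (\<open>AE_shift_of_positive_density\<close>).\<close>

locale quasi_invariant_iid_field = iid_field +
  assumes AE_shift_N: "\<And>t S. S \<in> sets borel \<Longrightarrow> AE x in N. x \<in> S
      \<Longrightarrow> AE x in N. x + t \<in> S"
begin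

text \<open>By Fubini's theorem, with the coordinate \<open>e\<close> integrated first.\<close>

lemma AE_shift_single:
  assumes e: "e \<in> I" and S: "S \<in> sets iid_law" "AE J in iid_law. J \<in> S"
  shows "AE J in iid_law. shift {e} t J \<in> S"
proof -
  define P' where "P' = PiM (I - {e}) (\<lambda>_. N)"
  interpret P': prob_space P' unfolding P'_def by (intro prob_space_PiM prob_space_axioms)
  interpret NP: pair_sigma_finite N P' by standard
  define upd where "upd = (\<lambda>(x, X :: 'a \<Rightarrow> real). X(e := x))"
  have ins: "insert e (I - {e}) = I" using e by auto
  have eq: "distr (N \<Otimes>\<^sub>M P') iid_law upd = iid_law"
    using distr_pair_PiM_eq_PiM[of "I - {e}" "\<lambda>_. N" e] prob_space_axioms
    unfolding P'_def upd_def ins by simp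
  have upd [measurable]: "upd \<in> N \<Otimes>\<^sub>M P' \<rightarrow>\<^sub>M iid_law"
    using measurable_add_dim[of e "I - {e}" "\<lambda>_. N"] measurable_pair_swap'[of N P']
    unfolding upd_def P'_def
    by (subst ins[symmetric]) (simp add: split_beta' measurable_fun_upd[where J = "I - {e}"])
  have iff: "(AE J in iid_law. J \<in> T)
      \<longleftrightarrow> (AE X in P'. AE x in N. upd (x, X) \<in> T)" if [measurable]: "T \<in> sets iid_law" for T
  proof -
    have "(AE J in iid_law. J \<in> T)
        \<longleftrightarrow> (AE p in N \<Otimes>\<^sub>M P'. upd p \<in> T)"
      by (subst eq[symmetric], rule AE_distr_iff) auto
    also have "\<dots> \<longleftrightarrow> (AE x in N. AE X in P'. upd (x, X) \<in> T)"
      using NP.AE_pair_iff[of "\<lambda>x X. upd (x, X) \<in> T"] by simp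
    also have "\<dots> \<longleftrightarrow> (AE X in P'. AE x in N. upd (x, X) \<in> T)"
      by (rule NP.AE_commute) simp
    finally show ?thesis .
  qed
  have sh [measurable]: "shift {e} t \<in> iid_law \<rightarrow>\<^sub>M iid_law"
    by (rule measurable_shift) (use e in simp)
  define T where "T = shift {e} t -` S \<inter> space iid_law"
  have T: "T \<in> sets iid_law" unfolding T_def using S(1) by measurable
  have "AE X in P'. AE x in N. upd (x, X) \<in> S"
    using S(2) unfolding iff[OF S(1)] .
  then have "AE X in P'. AE x in N. upd (x, X) \<in> T"
  proof (rule AE_mp, goal_cases)
    case 1
    show ?case
    proof (rule AE_I2, rule impI)
    fix X assume X: "X \<in> space P'" and *: "AE x in N. upd (x, X) \<in> S"
    have "(\<lambda>x. upd (x, X)) \<in> N \<rightarrow>\<^sub>M iid_law" using X by measurable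
    then have "{x. upd (x, X) \<in> S} \<in> sets N"
      using measurable_sets[OF _ S(1), of "\<lambda>x. upd (x, X)" N] by (simp add: space_N vimage_def)
    then have "AE x in N. x + t e \<in> {x. upd (x, X) \<in> S}"
      using * by (intro AE_shift_N) (auto simp: sets_N)
    moreover have "upd (x, X) \<in> T" if "x + t e \<in> {x. upd (x, X) \<in> S}" for x
    proof -
      have "upd (x, X) \<in> space iid_law"
        by (rule measurable_space[OF upd]) (use X in \<open>simp add: space_pair_measure space_N\<close>)
      moreover have "shift {e} t (upd (x, X)) = upd (x + t e, X)"
        by (auto simp: shift_def upd_def)
      ultimately show ?thesis using that by (simp add: T_def)
    qed
    ultimately show "AE x in N. upd (x, X) \<in> T" by auto
    qed
  qed
  then have "AE J in iid_law. J \<in> T" unfolding iff[OF T] .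
  then show ?thesis by (auto simp: T_def)
qed

lemma AE_shift:
  assumes D: "finite D" "D \<subseteq> I" and S: "S \<in> sets iid_law" "AE J in iid_law. J \<in> S"
  shows "AE J in iid_law. shift D t J \<in> S"
  using D
proof (induction D)
  case empty
  then show ?case using S by (simp add: shift_def)
next
  case (insert e D)
  have sh [measurable]: "shift D t \<in> iid_law \<rightarrow>\<^sub>M iid_law"
    by (rule measurable_shift) (use insert in simp)
  define T where "T = shift D t -` S \<inter> space iid_law"
  have T: "T \<in> sets iid_law" unfolding T_def using S(1) by measurable
  have "AE J in iid_law. J \<in> T"
    using insert by (auto simp: T_def)
  then have "AE J in iid_law. shift {e} t J \<in> T"
    using insert T by (intro AE_shift_single) auto
  moreover have "shift D t (shift {e} t J) = shift (insert e D) t J" for J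
    using insert(2) by (auto simp: shift_def fun_eq_iff)
  ultimately show ?case by (auto simp: T_def)
qed

lemma AE_AE_shift:
  assumes D: "finite D" "D \<subseteq> I" and P: "AE J in iid_law. P J"
  shows "AE J in iid_law. AE t in PiM D (\<lambda>_. N). P (shift D t J)"
proof -
  interpret D: prob_space "PiM D (\<lambda>_. N)" by (intro prob_space_PiM prob_space_axioms)
  interpret PD: pair_sigma_finite iid_law "PiM D (\<lambda>_. N)" by standard
  obtain Z where Z: "{J \<in> space iid_law. \<not> P J} \<subseteq> Z" "Z \<in> sets iid_law" "emeasure iid_law Z = 0"
    by (rule AE_E[OF P])
  define S where "S = space iid_law - Z"
  have S [measurable]: "S \<in> sets iid_law" using Z by (auto simp: S_def)
  have "AE J in iid_law. J \<in> S"
    using Z by (intro AE_I[of _ _ Z]) (auto simp: S_def)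
  then have "AE t in PiM D (\<lambda>_. N). AE J in iid_law. shift D t J \<in> S"
    using AE_shift[OF D S] by simp
  moreover have "{x \<in> space (iid_law \<Otimes>\<^sub>M PiM D (\<lambda>_. N)). shift D (snd x) (fst x) \<in> S} \<in> sets (iid_law \<Otimes>\<^sub>M PiM D (\<lambda>_. N))"
  proof -
    have "{x \<in> space (iid_law \<Otimes>\<^sub>M PiM D (\<lambda>_. N)). shift D (snd x) (fst x) \<in> S} =
        (\<lambda>(J, t). shift D t J) -` S \<inter> space (iid_law \<Otimes>\<^sub>M PiM D (\<lambda>_. N))"
      by auto
    then show ?thesis using measurable_sets[OF measurable_shift_pair[OF D(2)] S] by simp
  qed
  ultimately have "AE J in iid_law. AE t in PiM D (\<lambda>_. N). shift D t J \<in> S"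
    by (subst PD.AE_commute)
  moreover have "P J" if "J \<in> S" for J using that Z(1) by (auto simp: S_def)
  ultimately show ?thesis by auto
qed

text \<open>The density \<open>\<rho>\<close> of the law of the shifted field is integrable, but in general it is neither bounded
  nor continuous. For this reason limits along the boxes are tested against integrable functions.\<close>

lemma shift_density:
  assumes D: "finite D" "D \<subseteq> I"
  shows "\<exists>\<rho> :: _ \<Rightarrow> real. integrable iid_law \<rho> \<and> (\<forall>g. g \<in> borel_measurable iid_law \<longrightarrow>
    (\<integral>J. g (shift D t J) \<partial>iid_law) = (\<integral>J. \<rho> J * g J \<partial>iid_law))"
proof -
  have sh [measurable]: "shift D t \<in> iid_law \<rightarrow>\<^sub>M iid_law"
    by (rule measurable_shift[OF D(2)])
  define L where "L = distr iid_law iid_law (shift D t)"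
  interpret L: prob_space L unfolding L_def by (rule P.prob_space_distr[OF sh])
  have L: "absolutely_continuous iid_law L" "sets L = sets iid_law"
  proof -
    have "Z \<in> null_sets L" if "Z \<in> null_sets iid_law" for Z
    proof -
      have Z [measurable]: "Z \<in> sets iid_law" "AE J in iid_law. J \<notin> Z"
        using that by (auto intro: AE_not_in)
      have "AE J in iid_law. J \<in> space iid_law - Z"
        using Z(2) by auto
      then have "AE J in iid_law. shift D t J \<in> space iid_law - Z"
        using Z(1) by (intro AE_shift[OF D]) auto
      then have "AE J in iid_law. shift D t J \<notin> Z" by auto
      then have "AE J in L. J \<notin> Z" unfolding L_def using Z(1) by (subst AE_distr_iff) auto
      then show ?thesis
        using Z(1) AE_iff_null_sets[of Z L] by (simp add: L_def)
    qed
    then show "absolutely_continuous iid_law L" by (auto simp: absolutely_continuous_def)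
  qed (simp add: L_def)
  define \<rho> where "\<rho> x = enn2real (RN_deriv iid_law L x)" for x
  have "L.expectation g = (\<integral>x. \<rho> x * g x \<partial>iid_law)"
    if "g \<in> borel_measurable iid_law" for g :: "_ \<Rightarrow> real"
    unfolding \<rho>_def by (rule P.RN_deriv_integral[OF _ L that]) standard
  moreover have "integrable iid_law (\<lambda>x. \<rho> x * 1)"
    unfolding \<rho>_def by (subst P.RN_deriv_integrable[OF _ L, symmetric]) (auto, standard)
  moreover have "L.expectation g = (\<integral>J. g (shift D t J) \<partial>iid_law)"
    if "g \<in> borel_measurable iid_law" for g :: "_ \<Rightarrow> real"
    unfolding L_def by (rule integral_distr[OF sh that])
  ultimately show ?thesis by (intro exI[of _ \<rho>]) auto
qed

end

lemma AE_shift_of_positive_density: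
  assumes f: "f \<in> borel_measurable borel" "AE x in lborel. 0 < f x"
    and N: "N = density lborel (\<lambda>x. ennreal (f x))"
    and S: "S \<in> sets borel" "AE x in N. x \<in> S"
  shows "AE x in N. x + t \<in> S"
proof -
  have "AE x in lborel. x \<in> S"
  proof -
    have "AE x in lborel. 0 < ennreal (f x) \<longrightarrow> x \<in> S"
      using S(2) f(1) unfolding N by (subst (asm) AE_density) auto
    with f(2) show ?thesis by eventually_elim simp
  qed
  then have "AE x in distr lborel borel ((+) t). x \<in> S" by (subst lborel_distr_plus)
  then have "AE x in lborel. t + x \<in> S" using S(1) by (subst (asm) AE_distr_iff) auto
  then show ?thesis using f(1) unfolding N by (subst AE_density) (auto simp: add.commute)
qed


section \<open>Laws of independent replicas\<close>

lemma measurable_iid_replicas: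
  "(\<lambda>\<Gamma>. PiM (UNIV :: nat set) (\<lambda>_. \<Gamma>)) \<in> prob_algebra S \<rightarrow>\<^sub>M prob_algebra (PiM UNIV (\<lambda>_. S))"
proof (rule measurable_prob_algebra_generated[OF sets_PiM Int_stable_prod_algebra prod_algebra_sets_into_space])
  fix \<Gamma> assume \<Gamma>: "\<Gamma> \<in> space (prob_algebra S)"
  then show "prob_space (PiM (UNIV :: nat set) (\<lambda>_. \<Gamma>))"
    by (intro prob_space_PiM) (simp add: space_prob_algebra)
  show "sets (PiM (UNIV :: nat set) (\<lambda>_. \<Gamma>)) = sets (PiM UNIV (\<lambda>_. S))"
    using \<Gamma> by (intro sets_PiM_cong) (auto simp: space_prob_algebra)
next
  fix A assume "A \<in> prod_algebra (UNIV :: nat set) (\<lambda>_. S)"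
  then obtain J E where A: "A = prod_emb UNIV (\<lambda>_. S) J (PiE J E)" "finite J" "\<And>j. j \<in> J \<Longrightarrow> E j \<in> sets S"
    by (auto elim!: prod_algebraE)
  have "emeasure (PiM UNIV (\<lambda>_. \<Gamma>)) A
      = (\<Prod>j\<in>J. emeasure \<Gamma> (E j))" if \<Gamma>: "\<Gamma> \<in> space (prob_algebra S)" for \<Gamma>
  proof -
    have sets: "sets \<Gamma> = sets S" "prob_space \<Gamma>"
      using \<Gamma> by (auto simp: space_prob_algebra)
    interpret product_prob_space "\<lambda>_. \<Gamma>" "UNIV :: nat set"
      by (rule product_prob_spaceI) (rule sets)
    have "A = prod_emb UNIV (\<lambda>_. \<Gamma>) J (PiE J E)"
      unfolding A(1) prod_emb_def space_PiM sets_eq_imp_space_eq[OF sets(1)] ..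
    then show ?thesis using emeasure_PiM_emb[of J E] A sets(1) by simp
  qed
  moreover have "(\<lambda>\<Gamma>. \<Prod>j\<in>J. emeasure \<Gamma> (E j)) \<in> borel_measurable (prob_algebra S)"
    using A(3) by (intro borel_measurable_prod_ennreal)
      (auto simp: prob_algebra_def intro!: measurable_restrict_space1 measurable_emeasure_subprob_algebra)
  ultimately show "(\<lambda>\<Gamma>. emeasure (PiM UNIV (\<lambda>_. \<Gamma>)) A) \<in> borel_measurable (prob_algebra S)"
    by (simp cong: measurable_cong)
qed

lemma integral_prod_replicas:
  fixes f :: "nat \<Rightarrow> 'a \<Rightarrow> real"
  assumes \<Gamma>: "prob_space \<Gamma>"
    and f: "\<And>i. i < k \<Longrightarrow> f i \<in> borel_measurable \<Gamma>" "\<And>i x. i < k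
        \<Longrightarrow> \<bar>f i x\<bar> \<le> B"
  shows "(\<integral>\<sigma>. (\<Prod>i<k. f i (\<sigma> i)) \<partial>PiM UNIV (\<lambda>_. \<Gamma>)) = (\<Prod>i<k. \<integral>x. f i x \<partial>\<Gamma>)"
proof -
  interpret \<Gamma>: prob_space \<Gamma> by fact
  interpret product_prob_space "\<lambda>_. \<Gamma>" "UNIV :: nat set"
    by (rule product_prob_spaceI) (rule \<Gamma>)
  have eq: "distr (PiM UNIV (\<lambda>_. \<Gamma>)) (PiM {..<k} (\<lambda>_. \<Gamma>)) (\<lambda>x. restrict x {..<k}) = PiM {..<k} (\<lambda>_. \<Gamma>)"
    by (rule distr_PiM_restrict_finite) auto
  have meas: "(\<lambda>\<sigma>. \<Prod>i<k. f i (\<sigma> i)) \<in> borel_measurable (PiM {..<k} (\<lambda>_. \<Gamma>))"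
  proof (rule borel_measurable_prod)
    fix i assume "i \<in> {..<k}"
    then show "(\<lambda>\<sigma>. f i (\<sigma> i)) \<in> borel_measurable (PiM {..<k} (\<lambda>_. \<Gamma>))"
      using measurable_compose[OF measurable_component_singleton[of i "{..<k}" "\<lambda>_. \<Gamma>"] f(1)[of i]] by simp
  qed
  have "(\<integral>\<sigma>. (\<Prod>i<k. f i (\<sigma> i)) \<partial>PiM UNIV (\<lambda>_. \<Gamma>)) = (\<integral>\<sigma>. (\<Prod>i<k. f i (\<sigma> i)) \<partial>PiM {..<k} (\<lambda>_. \<Gamma>))"
    by (subst eq[symmetric], subst integral_distr[OF _ meas]) (auto intro!: measurable_restrict_subset)
  also have "\<dots> = (\<Prod>i<k. \<integral>x. f i x \<partial>\<Gamma>)"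
  proof (rule product_integral_prod)
    fix i assume "i \<in> {..<k}"
    then show "integrable \<Gamma> (f i)"
      using f(1)[of i] f(2)[of i] by (intro \<Gamma>.integrable_const_bound[where B = B]) auto
  qed simp
  finally show ?thesis .
qed

text \<open>The measurable spaces of infinite-volume states, of sequences of replicas and of matrices of
  overlaps.\<close>

abbreviation state_space :: "('d::finite) config measure measure" where
  "state_space \<equiv> prob_algebra (spin_space UNIV)"

abbreviation replica_space :: "(nat \<Rightarrow> ('d::finite) config) measure" where
  "replica_space \<equiv> PiM UNIV (\<lambda>_. spin_space UNIV)"

abbreviation overlap_space :: "(nat \<times> nat \<Rightarrow> real) measure" where
  "overlap_space \<equiv> PiM UNIV (\<lambda>_. borel)"

section \<open>The lattice and its edges\<close>

text \<open>The edge from \<open>x\<close> in the positive direction \<open>i\<close>. Every edge is of this form for exactly one pair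
  \<open>(x, i)\<close>.\<close>

definition bond :: "('d::finite) site \<Rightarrow> 'd \<Rightarrow> 'd edge" where
  "bond x i = {x, x + axis i 1}"

lemma axis_sum_ne_0: "axis i 1 + axis j 1 \<noteq> (0 :: int ^ 'd::finite)"
proof
  assume "axis i 1 + axis j 1 = (0 :: int ^ 'd)"
  then have "(axis i 1 + axis j 1) $ i = (0 :: int ^ 'd) $ i" by simp
  then show False by (simp add: axis_def split: if_splits)
qed

lemma bond_inject: "bond x i = bond y j \<longleftrightarrow> x = y \<and> i = j"
proof
  assume "bond x i = bond y j"
  then have "x = y \<and> x + axis i 1 = y + axis j 1 \<or> x = y + axis j 1 \<and> x + axis i 1 = y"
    unfolding bond_def doubleton_eq_iff .
  then show "x = y \<and> i = j"
  proof
    assume "x = y + axis j 1 \<and> x + axis i 1 = y"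
    then have "axis i 1 + axis j 1 = (0 :: int ^ 'a)" by (auto simp: algebra_simps)
    then show ?thesis using axis_sum_ne_0 by blast
  qed (auto simp: axis_eq_axis)
qed simp

lemma inj_bond: "inj (\<lambda>(x, i). bond x i)"
  by (rule injI) (auto simp: bond_inject)

lemma edges_eq_bonds: "edges = range (\<lambda>(x, i). bond (x :: ('d::finite) site) i)"
proof (rule set_eqI, rule iffI)
  fix e :: "'d edge" assume "e \<in> edges"
  then obtain x y where e: "e = {x, y}" and 1: "(\<Sum>i\<in>UNIV. \<bar>x $ i - y $ i\<bar>) = 1"
    unfolding edges_def by auto
  have "(\<Sum>i\<in>UNIV. nat \<bar>x $ i - y $ i\<bar>) = 1"
  proof -
    have "int (\<Sum>i\<in>UNIV. nat \<bar>x $ i - y $ i\<bar>) = int 1" using 1 by simp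
    then show ?thesis by (simp only: of_nat_eq_iff)
  qed
  then obtain i where i: "nat \<bar>x $ i - y $ i\<bar> = 1" "\<And>j. j \<noteq> i
      \<Longrightarrow> nat \<bar>x $ j - y $ j\<bar> = 0"
    by (subst (asm) sum_eq_1_iff) auto
  have "y = x + axis i 1 \<or> x = y + axis i 1"
  proof (cases "y $ i \<ge> x $ i")
    case True
    then have "y = x + axis i 1" using i by (auto simp: vec_eq_iff axis_def)
    then show ?thesis ..
  next
    case False
    then have "x = y + axis i 1" using i by (auto simp: vec_eq_iff axis_def)
    then show ?thesis ..
  qed
  then have "e = bond x i \<or> e = bond y i" by (auto simp: e bond_def)
  then show "e \<in> range (\<lambda>(x, i). bond (x :: 'd site) i)" by auto
next
  fix e :: "'d edge" assume "e \<in> range (\<lambda>(x, i). bond (x :: 'd site) i)"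
  then obtain x i where e: "e = bond x i" by auto
  have "(\<Sum>j\<in>UNIV. \<bar>x $ j - (x + axis i 1) $ j\<bar>) = 1"
    by (simp add: axis_def if_distrib cong: if_cong)
  then show "e \<in> edges" unfolding edges_def e bond_def by blast
qed

lemma bond_in_edges [simp]: "bond x i \<in> edges"
  by (auto simp: edges_eq_bonds)

lemma edgeE:
  assumes "e \<in> edges" obtains x i where "e = bond x i"
  using assms by (auto simp: edges_eq_bonds)

lemma prod_bond: "(\<Prod>y\<in>bond x i. f y) = f x * f (x + axis i 1)"
  by (simp add: bond_def axis_eq_0_iff)

lemma finite_edges_in: "finite W \<Longrightarrow> finite (edges_in W)"
  unfolding edges_in_def by (rule finite_subset[of _ "Pow W"]) auto

lemma bij_betw_PiE_lattice_box: "bij_betw vec_lambda (\<Pi>\<^sub>E i\<in>UNIV. {a $ i..b $ i}) (lattice_box a b)"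
  unfolding bij_betw_def
proof
  show "inj_on vec_lambda (\<Pi>\<^sub>E i\<in>UNIV. {a $ i..b $ i})"
    by (rule inj_onI) (metis vec_lambda_inverse UNIV_I)
  show "vec_lambda ` (\<Pi>\<^sub>E i\<in>UNIV. {a $ i..b $ i}) = lattice_box a b"
  proof (intro equalityI subsetI)
    fix x assume "x \<in> lattice_box a b"
    then show "x \<in> vec_lambda ` (\<Pi>\<^sub>E i\<in>UNIV. {a $ i..b $ i})"
      by (intro image_eqI[of _ _ "vec_nth x"]) (auto simp: lattice_box_def)
  qed (auto simp: lattice_box_def PiE_iff)
qed

lemma finite_lattice_box [simp]: "finite (lattice_box a b)"
  using bij_betw_finite[OF bij_betw_PiE_lattice_box[of a b]] by (simp add: finite_PiE)

lemma card_lattice_box: "card (lattice_box a b) = (\<Prod>i\<in>UNIV. nat (b $ i - a $ i + 1))"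
  using bij_betw_same_card[OF bij_betw_PiE_lattice_box[of a b], symmetric]
    by (simp add: card_PiE add.commute diff_add_eq)

section \<open>Finite-volume Gibbs measures\<close>

abbreviation configs :: "('d::finite) site \<Rightarrow> 'd site \<Rightarrow> 'd config set" where
  "configs a b \<equiv> lattice_box a b \<rightarrow>\<^sub>E {-1, 1}"

lemma finite_configs [simp]: "finite (configs a b)"
  by (simp add: finite_PiE)

lemma configs_nonempty: "configs a b \<noteq> {}"
  by (simp add: PiE_eq_empty_iff)

lemma partition_fun_pos: "partition_fun \<beta> a b J > 0"
  unfolding partition_fun_def by (intro sum_pos configs_nonempty) auto

lemma integral_gibbs:
  "(\<integral>\<sigma>. f \<sigma> \<partial>gibbs \<beta> a b J)
      = (\<Sum>\<sigma>\<in>configs a b. f \<sigma> * exp (- \<beta> * EA_hamiltonian a b J \<sigma>)) / partition_fun \<beta> a b J"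
  for f :: "_ \<Rightarrow> real"
  unfolding gibbs_def using partition_fun_pos[of \<beta> a b J]
  by (subst lebesgue_integral_point_measure_finite) (auto simp: sum_divide_distrib mult.commute)

lemma prob_space_gibbs: "prob_space (gibbs \<beta> a b J)"
  unfolding gibbs_def using partition_fun_pos[of \<beta> a b J]
  by (intro prob_space_point_measure)
    (auto simp: sum_divide_distrib[symmetric] partition_fun_def)

lemma spin_space_finite: "finite \<Lambda> \<Longrightarrow> spin_space \<Lambda>
    = count_space (\<Lambda> \<rightarrow>\<^sub>E {-1, 1})"
  unfolding spin_space_def by (rule count_space_PiM_finite) auto

lemma sets_gibbs: "sets (gibbs \<beta> a b J) = sets (spin_space (lattice_box a b))"
  by (simp add: spin_space_finite gibbs_def sets_point_measure)

lemma borel_measurable_gibbs [simp]: "f \<in> borel_measurable (gibbs \<beta> a b J)"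
  by (simp add: gibbs_def measurable_def space_point_measure sets_point_measure)

lemma measurable_hamiltonian:
  assumes "sets \<nu>\<^sub>0 = sets borel"
  shows "(\<lambda>J. EA_hamiltonian a b J \<sigma>) \<in> borel_measurable (coupling_law \<nu>\<^sub>0)"
proof -
  have [measurable]: "(\<lambda>J. J {x, x + axis i 1}) \<in> borel_measurable (coupling_law \<nu>\<^sub>0)" for x :: "'a site" and i
  proof -
    have "(\<lambda>J. J (bond x i)) \<in> coupling_law \<nu>\<^sub>0 \<rightarrow>\<^sub>M \<nu>\<^sub>0"
      unfolding coupling_law_def by (rule measurable_component_singleton) simp
    then show ?thesis by (simp add: measurable_cong_sets[OF refl assms] bond_def)
  qed
  show ?thesis unfolding EA_hamiltonian_def by measurable
qed

lemma measurable_integral_gibbs: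
  fixes f :: "_ \<Rightarrow> real"
  assumes "sets \<nu>\<^sub>0 = sets borel"
  shows "(\<lambda>J. \<integral>\<sigma>. f \<sigma> \<partial>gibbs \<beta> a b J) \<in> borel_measurable (coupling_law \<nu>\<^sub>0)"
proof -
  note measurable_hamiltonian[OF assms, measurable]
  show ?thesis unfolding integral_gibbs partition_fun_def by measurable
qed

lemma measurable_gibbs:
  assumes "sets \<nu>\<^sub>0 = sets borel"
  shows "gibbs \<beta> a b \<in> coupling_law \<nu>\<^sub>0 \<rightarrow>\<^sub>M prob_algebra (spin_space (lattice_box a b))"
proof (rule measurable_prob_algebra_generated[where G = "sets (spin_space (lattice_box a b))" and \<Omega> = "space (spin_space (lattice_box a b))"])
  fix A assume "A \<in> sets (spin_space (lattice_box a b))"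
  then have A: "A \<in> sets (gibbs \<beta> a b J)" for J by (simp add: sets_gibbs)
  have "emeasure (gibbs \<beta> a b J) A
      = ennreal (\<integral>\<sigma>. indicator A \<sigma> \<partial>gibbs \<beta> a b J)" for J
  proof -
    interpret prob_space "gibbs \<beta> a b J" by (rule prob_space_gibbs)
    show ?thesis
      using sets.sets_into_space[OF A[of J]] by (simp add: emeasure_eq_measure Int_absorb2)
  qed
  then show "(\<lambda>J. emeasure (gibbs \<beta> a b J) A) \<in> borel_measurable (coupling_law \<nu>\<^sub>0)"
    using measurable_compose[OF measurable_integral_gibbs[OF assms, where f = "indicator A" and \<beta> = \<beta> and a = a and b = b] measurable_ennreal] by simp
qed (auto simp: sets_gibbs prob_space_gibbs sets.sigma_sets_eq sets.Int_stable dest: sets.sets_into_space)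

lemma integral_replica_law:
  fixes P :: "('d::finite) couplings \<Rightarrow> (nat \<Rightarrow> 'd config) measure"
    and g :: "'d couplings \<times> (nat \<Rightarrow> 'd config) \<Rightarrow> real"
  assumes \<nu>: "prob_space \<nu>\<^sub>0"
    and P [measurable]: "P \<in> coupling_law \<nu>\<^sub>0 \<rightarrow>\<^sub>M prob_algebra (PiM UNIV (\<lambda>_. spin_space \<Lambda>))"
    and g: "g \<in> borel_measurable (coupling_law \<nu>\<^sub>0 \<Otimes>\<^sub>M PiM UNIV (\<lambda>_. spin_space \<Lambda>))" "\<And>x. \<bar>g x\<bar> \<le> B"
  shows "(\<integral>\<omega>. g \<omega> \<partial>replica_law \<nu>\<^sub>0 \<Lambda> P)
      = (\<integral>J. \<integral>\<sigma>. g (J, \<sigma>) \<partial>P J \<partial>coupling_law \<nu>\<^sub>0)"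
proof -
  have "(\<integral>\<omega>. g \<omega> \<partial>replica_law \<nu>\<^sub>0 \<Lambda> P) =
    (\<integral>J. (\<integral>\<omega>. g \<omega> \<partial>distr (P J) (coupling_law \<nu>\<^sub>0 \<Otimes>\<^sub>M PiM UNIV (\<lambda>_. spin_space \<Lambda>)) (Pair J)) \<partial>coupling_law \<nu>\<^sub>0)"
    unfolding replica_law_def
    by (rule integral_prob_bind[OF g(1) g(2)])
      (use \<nu> in \<open>auto intro!: measurable_distr_prob_space2[OF P] prob_space_PiM simp: coupling_law_def[of \<nu>\<^sub>0, symmetric]\<close>,
        auto intro!: prob_space_PiM simp: coupling_law_def)
  also have "\<dots> = (\<integral>J. \<integral>\<sigma>. g (J, \<sigma>) \<partial>P J \<partial>coupling_law \<nu>\<^sub>0)"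
  proof (rule Bochner_Integration.integral_cong[OF refl])
    fix J :: "'d couplings" assume J: "J \<in> space (coupling_law \<nu>\<^sub>0)"
    then have "sets (P J) = sets (PiM UNIV (\<lambda>_. spin_space \<Lambda>))"
      using measurable_space[OF P] by (auto simp: space_prob_algebra)
    then have "Pair J \<in> P J \<rightarrow>\<^sub>M coupling_law \<nu>\<^sub>0 \<Otimes>\<^sub>M PiM UNIV (\<lambda>_. spin_space \<Lambda>)"
      using J by (simp cong: measurable_cong_sets)
    from integral_distr[OF this g(1)]
    show "(\<integral>\<omega>. g \<omega> \<partial>distr (P J) (coupling_law \<nu>\<^sub>0 \<Otimes>\<^sub>M PiM UNIV (\<lambda>_. spin_space \<Lambda>)) (Pair J)) = (\<integral>\<sigma>. g (J, \<sigma>) \<partial>P J)" .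
  qed
  finally show ?thesis .
qed

section \<open>Perturbing and translating the couplings in finite volume\<close>

lemma wrap_in_box: "lattice_box a b \<noteq> {} \<Longrightarrow> wrap a b x \<in> lattice_box a b"
proof -
  assume "lattice_box a b \<noteq> {}"
  then have "a $ i \<le> b $ i" for i by (auto simp: lattice_box_def intro: order_trans)
  then show ?thesis
    by (auto simp: lattice_box_def wrap_def add_pos_nonneg intro!: pos_mod_sign)
      (smt (verit) pos_mod_bound)
qed

lemma wrap_of_box: "x \<in> lattice_box a b \<Longrightarrow> wrap a b x = x"
  by (auto simp: lattice_box_def wrap_def vec_eq_iff mod_pos_pos_trivial)

lemma wrap_wrap_add: "wrap a b (wrap a b x + y) = wrap a b (x + y)"
proof -
  have "(a $ i + (x $ i - a $ i) mod m + y $ i - a $ i) mod m = (x $ i + y $ i - a $ i) mod m" for i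
    and m :: int
  proof -
    have "(a $ i + (x $ i - a $ i) mod m + y $ i - a $ i) mod m = ((x $ i - a $ i) mod m + y $ i) mod m"
      by (simp add: algebra_simps)
    also have "\<dots> = (x $ i - a $ i + y $ i) mod m" by (rule mod_add_left_eq)
    finally show ?thesis by (simp add: algebra_simps)
  qed
  then show ?thesis by (simp add: wrap_def vec_eq_iff)
qed

text \<open>An edge with both endpoints in \<open>W \<subseteq> \<Lambda>\<close> does not wrap around the box, so changing its coupling changes the
  Hamiltonian exactly by the local energy.\<close>

lemma hamiltonian_shift:
  assumes W: "W \<subseteq> lattice_box a b"
  shows "EA_hamiltonian a b (shift (edges_in W) t J) \<sigma>
      = EA_hamiltonian a b J \<sigma> - local_energy W t \<sigma>"
proof -
  define \<Lambda> where "\<Lambda> = lattice_box a b"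
  define D where "D = {(x, i). x \<in> \<Lambda> \<and> bond x i \<in> edges_in W}"
  have fin: "finite (\<Lambda> \<times> (UNIV :: 'a set))" by (simp add: \<Lambda>_def)
  have "(\<Sum>x\<in>\<Lambda>. \<Sum>i\<in>UNIV. shift (edges_in W) t J (bond x i) * \<sigma> x * \<sigma> (wrap a b (x + axis i 1)))
      = (\<Sum>x\<in>\<Lambda>. \<Sum>i\<in>UNIV. J (bond x i) * \<sigma> x * \<sigma> (wrap a b (x + axis i 1)))
        + (\<Sum>x\<in>\<Lambda>. \<Sum>i\<in>UNIV. if bond x i \<in> edges_in W then t (bond x i) * \<sigma> x * \<sigma> (wrap a b (x + axis i 1)) else 0)"
    unfolding sum.distrib[symmetric] by (intro sum.cong refl) (simp add: shift_def algebra_simps)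
  also have "(\<Sum>x\<in>\<Lambda>. \<Sum>i\<in>UNIV. if bond x i \<in> edges_in W then t (bond x i) * \<sigma> x * \<sigma> (wrap a b (x + axis i 1)) else 0)
      = (\<Sum>(x, i)\<in>D. t (bond x i) * \<sigma> x * \<sigma> (wrap a b (x + axis i 1)))"
  proof -
    have D: "D = {p \<in> \<Lambda> \<times> UNIV. bond (fst p) (snd p) \<in> edges_in W}"
      by (auto simp: D_def)
    show ?thesis
      unfolding sum.cartesian_product D sum.inter_filter[OF fin]
        by (intro sum.cong refl) (simp add: split_beta')
  qed
  also have "\<dots> = (\<Sum>(x, i)\<in>D. t (bond x i) * (\<Prod>y\<in>bond x i. \<sigma> y))"
  proof (intro sum.cong refl, clarify)
    fix x i assume "(x, i) \<in> D"
    then have "x + axis i 1 \<in> \<Lambda>"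
      using W by (auto simp: D_def edges_in_def bond_def \<Lambda>_def)
    then have "wrap a b (x + axis i 1) = x + axis i 1" unfolding \<Lambda>_def by (rule wrap_of_box)
    then show "t (bond x i) * \<sigma> x * \<sigma> (wrap a b (x + axis i 1))
        = t (bond x i) * (\<Prod>y\<in>bond x i. \<sigma> y)"
      by (simp add: prod_bond)
  qed
  also have "\<dots> = (\<Sum>e\<in>edges_in W. t e * (\<Prod>y\<in>e. \<sigma> y))"
  proof -
    have "bij_betw (\<lambda>x. bond (fst x) (snd x)) D (edges_in W)"
      unfolding bij_betw_def
    proof
      show "inj_on (\<lambda>x. bond (fst x) (snd x)) D" by (rule inj_onI) (auto simp: bond_inject)
      show "(\<lambda>x. bond (fst x) (snd x)) ` D = edges_in W"
      proof (intro equalityI subsetI)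
        fix e assume e: "e \<in> edges_in W"
        then obtain x i where xi: "e = bond x i" by (auto simp: edges_in_def elim: edgeE)
        then have "x \<in> \<Lambda>" using e W by (auto simp: edges_in_def bond_def \<Lambda>_def)
        then show "e \<in> (\<lambda>x. bond (fst x) (snd x)) ` D"
          using e xi by (intro image_eqI[of _ _ "(x, i)"]) (auto simp: D_def)
      qed (auto simp: D_def)
    qed
    from sum.reindex_bij_betw[OF this, where g = "\<lambda>e. t e * (\<Prod>y\<in>e. \<sigma> y)"]
    show ?thesis by (simp only: split_beta')
  qed
  finally show ?thesis
    unfolding EA_hamiltonian_def local_energy_def \<Lambda>_def bond_def by simp
qed

lemma integral_gibbs_shift:
  fixes f :: "_ \<Rightarrow> real"
  assumes W: "W \<subseteq> lattice_box a b"
  shows "(\<integral>\<sigma>. f \<sigma> \<partial>gibbs \<beta> a b (shift (edges_in W) t J)) =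
    (\<integral>\<sigma>. exp (\<beta> * local_energy W t \<sigma>) * f \<sigma> \<partial>gibbs \<beta> a b J) / (\<integral>\<sigma>. exp (\<beta> * local_energy W t \<sigma>) \<partial>gibbs \<beta> a b J)"
proof -
  have e: "exp (- \<beta> * EA_hamiltonian a b (shift (edges_in W) t J) \<sigma>)
      = exp (\<beta> * local_energy W t \<sigma>) * exp (- \<beta> * EA_hamiltonian a b J \<sigma>)" for \<sigma>
    unfolding hamiltonian_shift[OF W] by (simp add: exp_add[symmetric] algebra_simps)
  show ?thesis
    using partition_fun_pos[of \<beta> a b J]
    unfolding integral_gibbs partition_fun_def[of \<beta> a b "shift (edges_in W) t J"] e
    by (simp add: mult_ac)
qed

text \<open>The translation by \<open>z\<close> on the torus, acting on the edges whose base point lies in the box; all other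
  edges are left fixed. It differs from the translation of the lattice for edges near the boundary
  of the box: the wrap-around edges carry couplings indexed by edges that leave the box, and they have
  to be permuted among themselves. As a permutation of the edges it preserves the law of the couplings.\<close>

definition torus_edge :: "('d::finite) site \<Rightarrow> 'd site \<Rightarrow> 'd site \<Rightarrow> 'd edge \<Rightarrow> 'd edge" where
  "torus_edge a b z e = (case inv (\<lambda>(x, i). bond x i) e of
     (x, i) \<Rightarrow> if x \<in> lattice_box a b then bond (wrap a b (x + z)) i else e)"

lemma torus_edge_bond:
  "torus_edge a b z (bond x i) = (if x \<in> lattice_box a b then bond (wrap a b (x + z)) i else bond x i)"
  using inv_f_f[OF inj_bond, of "(x, i)"] by (simp add: torus_edge_def)

lemma wrap_add_inj:
  assumes "x \<in> lattice_box a b" "y \<in> lattice_box a b" "wrap a b (x + z) = wrap a b (y + z)"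
  shows "x = y"
proof -
  have "wrap a b (wrap a b (x + z) + (- z)) = wrap a b (wrap a b (y + z) + (- z))"
    using assms(3) by simp
  then show ?thesis using assms(1,2)
    by (simp only: wrap_wrap_add) (simp add: wrap_of_box)
qed

lemma torus_edge_image: "torus_edge a b z ` edges \<subseteq> edges"
  by (auto simp: torus_edge_bond elim!: edgeE)

lemma torus_edge_inj: "inj_on (torus_edge a b z) edges"
proof (rule inj_onI)
  fix e e' :: "'a edge" assume "e \<in> edges" "e' \<in> edges"
    and eq: "torus_edge a b z e = torus_edge a b z e'"
  then obtain x i y j where e: "e = bond x i" "e' = bond y j" by (auto elim!: edgeE)
  have "wrap a b (x + z) \<in> lattice_box a b" if "x \<in> lattice_box a b" for x
    using that by (intro wrap_in_box) auto
  then show "e = e'"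
    using eq unfolding e torus_edge_bond
    by (auto simp: bond_inject split: if_splits dest: wrap_add_inj)
qed

lemma bij_wrap_add: "bij_betw (\<lambda>x. wrap a b (x + z)) (lattice_box a b) (lattice_box a b)"
  unfolding bij_betw_def
proof
  show "inj_on (\<lambda>x. wrap a b (x + z)) (lattice_box a b)"
    by (rule inj_onI) (rule wrap_add_inj)
  then show "(\<lambda>x. wrap a b (x + z)) ` lattice_box a b = lattice_box a b"
    by (intro endo_inj_surj) (auto intro!: wrap_in_box)
qed

lemma integral_gibbs_torus:
  fixes f :: "('d::finite) config \<Rightarrow> real"
  shows "(\<integral>\<sigma>. f \<sigma> \<partial>gibbs \<beta> a b (\<lambda>e\<in>edges. J (torus_edge a b z e))) =
    (\<integral>\<sigma>. f (\<lambda>x\<in>lattice_box a b. \<sigma> (wrap a b (x + z))) \<partial>gibbs \<beta> a b J)"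
proof -
  define \<Lambda> where "\<Lambda> = lattice_box a b"
  define \<theta> where "\<theta> z \<sigma>
      = (\<lambda>x\<in>\<Lambda>. \<sigma> (wrap a b (x + z)))" for z and \<sigma> :: "'d config"
  define J' where "J' = (\<lambda>e\<in>edges. J (torus_edge a b z e))"
  have wrap: "wrap a b (x + z) \<in> \<Lambda>" if "x \<in> \<Lambda>" for x z
    using that unfolding \<Lambda>_def by (intro wrap_in_box) auto
  have \<theta>_in: "\<theta> z \<sigma> \<in> \<Lambda> \<rightarrow>\<^sub>E {-1, 1}"
    if "\<sigma> \<in> \<Lambda> \<rightarrow>\<^sub>E {-1, 1}" for z \<sigma>
    using that wrap unfolding \<theta>_def by (auto simp: PiE_iff)
  have \<theta>_inv: "\<theta> (- z) (\<theta> z \<sigma>) = \<sigma>"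
    if "\<sigma> \<in> \<Lambda> \<rightarrow>\<^sub>E {-1, 1}" for z \<sigma>
  proof
    fix x
    show "\<theta> (- z) (\<theta> z \<sigma>) x = \<sigma> x"
    proof (cases "x \<in> \<Lambda>")
      case True
      then have "\<theta> (- z) (\<theta> z \<sigma>) x
          = \<sigma> (wrap a b (wrap a b (x + (- z)) + z))"
        using wrap[OF True, of "- z"] by (simp add: \<theta>_def)
      also have "\<dots> = \<sigma> x"
        using True by (simp only: wrap_wrap_add) (simp add: \<Lambda>_def wrap_of_box)
      finally show ?thesis .
    next
      case False
      then show ?thesis using that by (auto simp: \<theta>_def PiE_iff extensional_def)
    qed
  qed
  have bij: "bij_betw (\<theta> z) (\<Lambda> \<rightarrow>\<^sub>E {-1, 1}) (\<Lambda> \<rightarrow>\<^sub>E {-1, 1})"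
    by (rule bij_betw_byWitness[where f' = "\<theta> (- z)"])
      (use \<theta>_in \<theta>_inv \<theta>_inv[of _ "- z"] in auto)
  have H: "EA_hamiltonian a b J' (\<theta> z \<sigma>) = EA_hamiltonian a b J \<sigma>" for \<sigma>
  proof -
    have "EA_hamiltonian a b J' (\<theta> z \<sigma>)
        = - (\<Sum>x\<in>\<Lambda>. \<Sum>i\<in>UNIV. J (bond (wrap a b (x + z)) i) * \<sigma> (wrap a b (x + z))
        * \<sigma> (wrap a b (wrap a b (x + z) + axis i 1)))"
      unfolding EA_hamiltonian_def \<Lambda>_def[symmetric] bond_def[symmetric] neg_equal_iff_equal
    proof (intro sum.cong refl)
      fix x :: "'d site" and i assume x: "x \<in> \<Lambda>"
      have "\<theta> z \<sigma> (wrap a b (x + axis i 1))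
          = \<sigma> (wrap a b (wrap a b (x + axis i 1) + z))"
        using wrap[OF x] by (simp add: \<theta>_def)
      also have "wrap a b (wrap a b (x + axis i 1) + z) = wrap a b (wrap a b (x + z) + axis i 1)"
        unfolding wrap_wrap_add by (simp add: ac_simps)
      finally show "J' (bond x i) * \<theta> z \<sigma> x * \<theta> z \<sigma> (wrap a b (x + axis i 1)) =
          J (bond (wrap a b (x + z)) i) * \<sigma> (wrap a b (x + z)) * \<sigma> (wrap a b (wrap a b (x + z) + axis i 1))"
        using x by (simp add: J'_def torus_edge_bond \<Lambda>_def \<theta>_def)
    qed
    also have "\<dots> = - (\<Sum>y\<in>\<Lambda>. \<Sum>i\<in>UNIV. J (bond y i) * \<sigma> y * \<sigma> (wrap a b (y + axis i 1)))"
      using sum.reindex_bij_betw[OF bij_wrap_add[of a b z],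
          where g = "\<lambda>y. \<Sum>i\<in>UNIV. J (bond y i) * \<sigma> y * \<sigma> (wrap a b (y + axis i 1))"]
      by (simp add: \<Lambda>_def)
    finally show ?thesis by (simp add: EA_hamiltonian_def \<Lambda>_def bond_def)
  qed
  have sum_eq: "(\<Sum>\<sigma>\<in>configs a b. g \<sigma> * exp (- \<beta> * EA_hamiltonian a b J' \<sigma>))
      = (\<Sum>\<sigma>\<in>configs a b. g (\<theta> z \<sigma>) * exp (- \<beta> * EA_hamiltonian a b J \<sigma>))" for g :: "_ \<Rightarrow> real"
    using sum.reindex_bij_betw[OF bij, where g = "\<lambda>\<sigma>. g \<sigma> * exp (- \<beta> * EA_hamiltonian a b J' \<sigma>)"]
    by (simp add: H \<Lambda>_def)
  have "partition_fun \<beta> a b J' = partition_fun \<beta> a b J"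
    using sum_eq[of "\<lambda>_. 1"] by (simp add: partition_fun_def)
  then show ?thesis
    unfolding integral_gibbs J'_def[symmetric] sum_eq by (simp add: \<theta>_def \<Lambda>_def)
qed


section \<open>Local observables and limits of their correlations\<close>

text \<open>Continuous functions of the spins in \<open>V\<close>. They are defined for arbitrary real values of the spins
  and do not depend on the spins outside of \<open>V\<close>, so that one and the same function is an observable of the
  finite-volume and of the infinite-volume states.\<close>

definition local_obs :: "('d::finite) site set \<Rightarrow> ('d config \<Rightarrow> real) set" where
  "local_obs V = {f. continuous_on UNIV f \<and> (\<forall>\<sigma> \<tau>. (\<forall>x\<in>V. \<sigma> x = \<tau> x) \<longrightarrow> f \<sigma> = f \<tau>)}"

text \<open>The expectation of \<open>f 0 (\<sigma> 0) \<cdots> f (k - 1) (\<sigma> (k - 1))\<close> for independent replicas with law \<open>\<Gamma>\<close>.\<close>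

definition replica_prod :: "nat \<Rightarrow> (nat \<Rightarrow> ('d::finite) config \<Rightarrow> real) \<Rightarrow> 'd config measure \<Rightarrow> real" where
  "replica_prod k f \<Gamma> = (\<Prod>i<k. \<integral>\<sigma>. f i \<sigma> \<partial>\<Gamma>)"

lemma measurable_spin_space_finite: "finite \<Lambda>
    \<Longrightarrow> f \<in> borel_measurable (spin_space \<Lambda>)"
  by (simp add: spin_space_finite)

lemma measurable_local_obs:
  assumes "finite V" "f \<in> local_obs V"
  shows "f \<in> borel_measurable (spin_space UNIV)"
proof -
  have "restrict \<sigma> V \<in> V \<rightarrow>\<^sub>E {-1, 1}"
    if "\<sigma> \<in> space (spin_space UNIV)" for \<sigma> :: "'a config"
    using that by (auto simp: spin_space_def space_PiM)
  have "(\<lambda>\<sigma>. restrict \<sigma> V) \<in> spin_space UNIV \<rightarrow>\<^sub>M spin_space V"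
    unfolding spin_space_def by (rule measurable_restrict_subset) simp
  from measurable_compose[OF this measurable_spin_space_finite[OF assms(1), of f]]
  have "(\<lambda>\<sigma>. f (restrict \<sigma> V)) \<in> borel_measurable (spin_space UNIV)" .
  moreover have "f (restrict \<sigma> V) = f \<sigma>" for \<sigma>
    using assms(2) unfolding local_obs_def by (auto simp: restrict_def)
  ultimately show ?thesis by simp
qed

lemma abs_integral_le_bound:
  fixes f :: "'a \<Rightarrow> real"
  assumes "prob_space M" "\<And>x. \<bar>f x\<bar> \<le> B"
  shows "\<bar>\<integral>x. f x \<partial>M\<bar> \<le> B"
proof (cases "integrable M f")
  case True
  interpret prob_space M by fact
  have "\<bar>\<integral>x. f x \<partial>M\<bar> \<le> (\<integral>x. \<bar>f x\<bar> \<partial>M)"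
    by (rule integral_abs_bound)
  also have "\<dots> \<le> (\<integral>x. B \<partial>M)"
    using True assms(2) by (intro integral_mono) auto
  finally show ?thesis by (simp add: prob_space)
next
  case False
  then show ?thesis using assms(2)[of undefined] by (simp add: not_integrable_integral_eq)
qed

lemma abs_replica_prod_le:
  assumes "prob_space \<Gamma>" "\<And>i \<sigma>. \<bar>f i \<sigma>\<bar> \<le> B"
  shows "\<bar>replica_prod k f \<Gamma>\<bar> \<le> B ^ k"
proof -
  have "\<bar>replica_prod k f \<Gamma>\<bar>
      = (\<Prod>i<k. \<bar>\<integral>\<sigma>. f i \<sigma> \<partial>\<Gamma>\<bar>)" by (simp add: replica_prod_def abs_prod)
  also have "\<dots> \<le> (\<Prod>i<k. B)"
    by (intro prod_mono) (auto intro: abs_integral_le_bound assms)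
  finally show ?thesis by simp
qed

text \<open>A power of the expectation of \<open>h\<close> is absorbed by additional replicas.\<close>

lemma replica_prod_append:
  "replica_prod (k + j) (\<lambda>i. if i < k then f i else h) \<Gamma>
      = replica_prod k f \<Gamma> * (\<integral>\<sigma>. h \<sigma> \<partial>\<Gamma>) ^ j"
proof (induction j)
  case 0
  then show ?case by (simp add: replica_prod_def)
next
  case (Suc j)
  then show ?case by (simp add: replica_prod_def mult_ac)
qed

lemma measurable_replica_prod:
  assumes "\<And>i. i < k \<Longrightarrow> f i \<in> borel_measurable (spin_space UNIV)"
  shows "replica_prod k f \<in> borel_measurable state_space"
  unfolding replica_prod_def prob_algebra_def
  by (intro borel_measurable_prod measurable_restrict_space1 integral_measurable_subprob_algebra assms) simp

lemma measurable_mixture: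
  "mixture \<in> prob_algebra state_space \<rightarrow>\<^sub>M prob_algebra replica_space"
  unfolding mixture_def
  by (rule measurable_bind_prob_space[OF measurable_ident_sets[OF refl] measurable_iid_replicas])

lemma integral_mixture:
  fixes f :: "_ \<Rightarrow> real"
  assumes K: "K \<in> space (prob_algebra state_space)"
    and f: "f \<in> borel_measurable replica_space" "\<And>\<sigma>. \<sigma> \<in> space replica_space \<Longrightarrow> \<bar>f \<sigma>\<bar> \<le> B"
  shows "(\<integral>\<sigma>. f \<sigma> \<partial>mixture K)
      = (\<integral>\<Gamma>. \<integral>\<sigma>. f \<sigma> \<partial>PiM UNIV (\<lambda>_. \<Gamma>) \<partial>K)"
proof -
  have K': "prob_space K" "sets K = sets state_space" using K by (auto simp: space_prob_algebra)
  show ?thesis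
    unfolding mixture_def
    by (rule integral_prob_bind[OF f]) (auto simp: K' measurable_iid_replicas cong: measurable_cong_sets)
qed

text \<open>A metastate of the Edwards--Anderson model, in the form of a measurable kernel \<open>\<kappa>\<close>, together with the
  boxes along which it is obtained.\<close>

locale EA_metastate =
  quasi_invariant_iid_field \<nu>\<^sub>0 "edges :: ('d::finite) edge set" for \<nu>\<^sub>0 +
  fixes \<beta> :: real and a b :: "nat \<Rightarrow> ('d::finite) site"
    and \<kappa> :: "('d::finite) couplings \<Rightarrow> ('d::finite) config measure measure"
  assumes \<kappa> [measurable]: "\<kappa> \<in> iid_law \<rightarrow>\<^sub>M prob_algebra state_space"
    and boxes: "boxes_to_lattice a b"
    and fdd: "fdd_converges
      (\<lambda>n. replica_law \<nu>\<^sub>0 (lattice_box (a n) (b n)) (\<lambda>J. PiM UNIV (\<lambda>_. gibbs \<beta> (a n) (b n) J)))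
      (replica_law \<nu>\<^sub>0 UNIV (\<lambda>J. mixture (\<kappa> J)))"
begin

abbreviation "G n J \<equiv> gibbs \<beta> (a n) (b n) J"

lemma coupling_law_eq: "coupling_law \<nu>\<^sub>0 = iid_law"
  by (simp add: coupling_law_def)

lemma measurable_integral_G [measurable]: "(\<lambda>J. \<integral>\<sigma>. f \<sigma> \<partial>G n J) \<in> borel_measurable iid_law" for f :: "_ \<Rightarrow> real"
  using measurable_integral_gibbs[OF sets_N, where f = f] by (simp add: coupling_law_eq)

lemma \<kappa>_space: "J \<in> space iid_law
    \<Longrightarrow> \<kappa> J \<in> space (prob_algebra state_space)"
  by (rule measurable_space[OF \<kappa>])

lemma \<kappa>_prob: "J \<in> space iid_law \<Longrightarrow> prob_space (\<kappa> J)"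
  and \<kappa>_sets: "J \<in> space iid_law \<Longrightarrow> sets (\<kappa> J) = sets state_space"
  using \<kappa>_space by (auto simp: space_prob_algebra)

lemma measurable_integral_\<kappa>:
  fixes \<psi> :: "_ \<Rightarrow> real"
  assumes "\<psi> \<in> borel_measurable state_space"
  shows "(\<lambda>J. \<integral>\<Gamma>. \<psi> \<Gamma> \<partial>\<kappa> J) \<in> borel_measurable iid_law"
  by (rule measurable_compose[OF measurable_prob_algebraD[OF \<kappa>] integral_measurable_subprob_algebra[OF assms]])

lemma fdd_product_observables:
  assumes A: "finite A" "A \<subseteq> edges" and V: "finite V"
    and f: "\<And>i. f i \<in> local_obs V" "\<And>i \<sigma>. \<bar>f i \<sigma>\<bar> \<le> B"
    and g: "\<And>e. continuous_on UNIV (g e)" "\<And>e t. 0 \<le> g e t \<and> g e t \<le> (1::real)"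
  shows "(\<lambda>n. \<integral>J. (\<Prod>e\<in>A. g e (J e)) * replica_prod k f (G n J) \<partial>iid_law)
    \<longlonglongrightarrow> (\<integral>J. (\<Prod>e\<in>A. g e (J e)) * (\<integral>\<Gamma>. replica_prod k f \<Gamma> \<partial>\<kappa> J) \<partial>iid_law)"
proof -
  define F :: "'d couplings \<times> (nat \<Rightarrow> 'd config) \<Rightarrow> real"
    where "F = (\<lambda>(J, \<sigma>). (\<Prod>e\<in>A. g e (J e)) * (\<Prod>i<k. f i (\<sigma> i)))"
  have F_cont: "continuous_on UNIV F"
  proof -
    have 1: "continuous_on UNIV (\<lambda>p :: 'd couplings \<times> (nat \<Rightarrow> 'd config). g e (fst p e))" for e
    proof (rule continuous_on_compose2[where s = UNIV and t = UNIV and g = "g e" and f = "\<lambda>p. fst p e"])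
      show "continuous_on UNIV (g e)" by (rule g(1))
      show "continuous_on UNIV (\<lambda>p :: 'd couplings \<times> (nat \<Rightarrow> 'd config). fst p e)"
        by (rule continuous_on_compose2[where s = UNIV and t = UNIV and f = fst and g = "\<lambda>J. J e"])
          (auto intro: continuous_on_product_coordinates continuous_on_fst continuous_on_id)
    qed simp
    have 2: "continuous_on UNIV (\<lambda>p :: 'd couplings \<times> (nat \<Rightarrow> 'd config). f i (snd p i))" for i
    proof (rule continuous_on_compose2[where s = UNIV and t = UNIV and g = "f i" and f = "\<lambda>p. snd p i"])
      show "continuous_on UNIV (f i)" using f(1) by (auto simp: local_obs_def)
      show "continuous_on UNIV (\<lambda>p :: 'd couplings \<times> (nat \<Rightarrow> 'd config). snd p i)"
        by (rule continuous_on_compose2[where s = UNIV and t = UNIV and f = snd and g = "\<lambda>\<sigma>. \<sigma> i"])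
          (auto intro: continuous_on_product_coordinates continuous_on_snd continuous_on_id)
    qed simp
    show ?thesis unfolding F_def split_beta' by (intro continuous_intros 1 2)
  qed
  have F_bound: "\<bar>F \<omega>\<bar> \<le> B ^ k" for \<omega>
  proof -
    obtain J \<sigma> where \<omega>: "\<omega> = (J, \<sigma>)" by (cases \<omega>)
    have "\<bar>\<Prod>e\<in>A. g e (J e)\<bar> \<le> 1"
      unfolding abs_prod using g(2) by (intro prod_le_1) auto
    moreover have "\<bar>\<Prod>i<k. f i (\<sigma> i)\<bar> \<le> (\<Prod>i<k. B)"
      unfolding abs_prod using f(2) by (intro prod_mono) auto
    ultimately have "\<bar>\<Prod>e\<in>A. g e (J e)\<bar> * \<bar>\<Prod>i<k. f i (\<sigma> i)\<bar> \<le> 1 * B ^ k"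
      by (intro mult_mono) auto
    then show ?thesis by (simp add: F_def \<omega> abs_mult)
  qed
  have F_proj: "F (fin_proj A k V \<omega>) = F \<omega>" for \<omega>
  proof -
    have "f i (restrict \<tau> V) = f i \<tau>" for i \<tau>
      using f(1)[of i] unfolding local_obs_def by (auto simp: restrict_def)
    then show ?thesis
      by (cases \<omega>) (auto simp: F_def fin_proj_def intro!: arg_cong2[where f = "(*)"] prod.cong)
  qed
  have g_meas: "(\<lambda>J. \<Prod>e\<in>A. g e (J e)) \<in> borel_measurable iid_law"
  proof (rule borel_measurable_prod)
    fix e assume "e \<in> A"
    then have "(\<lambda>J. J e) \<in> iid_law \<rightarrow>\<^sub>M borel"
      using A(2) measurable_component_singleton[of e edges "\<lambda>_. \<nu>\<^sub>0"]
        by (auto simp: measurable_cong_sets[OF refl sets_N])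
    from measurable_compose[OF this borel_measurable_continuous_onI[OF g(1)]]
    show "(\<lambda>J. g e (J e)) \<in> borel_measurable iid_law" .
  qed
  have f_prod_meas: "(\<lambda>\<sigma>. \<Prod>i<k. f i (\<sigma> i)) \<in> borel_measurable (PiM UNIV (\<lambda>_. spin_space \<Lambda>))"
    if "\<And>i. f i \<in> borel_measurable (spin_space \<Lambda>)" for \<Lambda>
  proof (rule borel_measurable_prod)
    fix i
    show "(\<lambda>\<sigma>. f i (\<sigma> i)) \<in> borel_measurable (PiM UNIV (\<lambda>_. spin_space \<Lambda>))"
      using measurable_compose[OF measurable_component_singleton[of i UNIV "\<lambda>_. spin_space \<Lambda>"] that[of i]] by simp
  qed
  have F_meas: "F \<in> borel_measurable (iid_law \<Otimes>\<^sub>M PiM UNIV (\<lambda>_. spin_space \<Lambda>))"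
    if f_meas: "\<And>i. f i \<in> borel_measurable (spin_space \<Lambda>)" for \<Lambda>
  proof -
    note g_meas[measurable] f_prod_meas[OF f_meas, measurable]
    show ?thesis unfolding F_def by measurable
  qed
  have G_meas: "(\<lambda>J. PiM (UNIV :: nat set) (\<lambda>_. G n J)) \<in> coupling_law \<nu>\<^sub>0 \<rightarrow>\<^sub>M prob_algebra (PiM UNIV (\<lambda>_. spin_space (lattice_box (a n) (b n))))" for n
    by (rule measurable_compose[OF measurable_gibbs[OF sets_N] measurable_iid_replicas])
  have f_meas: "f i \<in> borel_measurable (spin_space UNIV)" for i
    by (rule measurable_local_obs[OF V f(1)])
  have lhs: "(\<integral>\<omega>. F \<omega> \<partial>replica_law \<nu>\<^sub>0 (lattice_box (a n) (b n)) (\<lambda>J. PiM UNIV (\<lambda>_. G n J)))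
      = (\<integral>J. (\<Prod>e\<in>A. g e (J e)) * replica_prod k f (G n J) \<partial>iid_law)" for n
  proof -
    have "(\<integral>\<sigma>. F (J, \<sigma>) \<partial>PiM UNIV (\<lambda>_. G n J))
        = (\<Prod>e\<in>A. g e (J e)) * replica_prod k f (G n J)" for J
      unfolding F_def replica_prod_def split_conv integral_mult_right_zero
      by (subst integral_prod_replicas[where B = B]) (auto simp: prob_space_gibbs f(2))
    then show ?thesis
      by (subst integral_replica_law[OF prob_space_axioms G_meas, where B = "B ^ k"])
        (auto simp: coupling_law_eq F_bound intro!: F_meas measurable_spin_space_finite)
  qed
  have mix: "(\<lambda>J. mixture (\<kappa> J)) \<in> coupling_law \<nu>\<^sub>0 \<rightarrow>\<^sub>M prob_algebra replica_space"
    unfolding coupling_law_eq by (rule measurable_compose[OF \<kappa> measurable_mixture])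
  have rhs: "(\<integral>\<omega>. F \<omega> \<partial>replica_law \<nu>\<^sub>0 UNIV (\<lambda>J. mixture (\<kappa> J)))
      = (\<integral>J. (\<Prod>e\<in>A. g e (J e)) * (\<integral>\<Gamma>. replica_prod k f \<Gamma> \<partial>\<kappa> J) \<partial>iid_law)"
  proof -
    have "(\<integral>\<sigma>. F (J, \<sigma>) \<partial>mixture (\<kappa> J))
        = (\<Prod>e\<in>A. g e (J e)) * (\<integral>\<Gamma>. replica_prod k f \<Gamma> \<partial>\<kappa> J)"
      if J: "J \<in> space iid_law" for J
    proof -
      have "(\<integral>\<sigma>. (\<Prod>i<k. f i (\<sigma> i)) \<partial>mixture (\<kappa> J))
          = (\<integral>\<Gamma>. \<integral>\<sigma>. (\<Prod>i<k. f i (\<sigma> i)) \<partial>PiM UNIV (\<lambda>_. \<Gamma>) \<partial>\<kappa> J)"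
      proof (rule integral_mixture[OF \<kappa>_space[OF J] f_prod_meas[OF f_meas]])
        show "\<bar>\<Prod>i<k. f i (\<sigma> i)\<bar> \<le> (\<Prod>i<k. B)" for \<sigma>
          unfolding abs_prod using f(2) by (intro prod_mono) auto
      qed
      also have "\<dots> = (\<integral>\<Gamma>. replica_prod k f \<Gamma> \<partial>\<kappa> J)"
      proof (rule Bochner_Integration.integral_cong[OF refl])
        fix \<Gamma> assume "\<Gamma> \<in> space (\<kappa> J)"
        then have \<Gamma>: "prob_space \<Gamma>" "sets \<Gamma> = sets (spin_space UNIV)"
          using sets_eq_imp_space_eq[OF \<kappa>_sets[OF J]] by (auto simp: space_prob_algebra)
        show "(\<integral>\<sigma>. (\<Prod>i<k. f i (\<sigma> i)) \<partial>PiM UNIV (\<lambda>_. \<Gamma>)) = replica_prod k f \<Gamma>"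
          unfolding replica_prod_def
          by (rule integral_prod_replicas[where B = B])
            (use \<Gamma> f_meas f(2) in \<open>auto cong: measurable_cong_sets\<close>)
      qed
      finally show ?thesis by (simp add: F_def)
    qed
    then show ?thesis
      by (subst integral_replica_law[OF prob_space_axioms mix, where B = "B ^ k"])
        (auto simp: coupling_law_eq F_bound intro!: F_meas f_meas Bochner_Integration.integral_cong)
  qed
  have "bounded (range F)" using F_bound by (auto simp: bounded_iff)
  with fdd A V F_cont
  have "(\<lambda>n. \<integral>\<omega>. F (fin_proj A k V \<omega>) \<partial>replica_law \<nu>\<^sub>0 (lattice_box (a n) (b n)) (\<lambda>J. PiM UNIV (\<lambda>_. G n J)))
    \<longlonglongrightarrow> (\<integral>\<omega>. F (fin_proj A k V \<omega>) \<partial>replica_law \<nu>\<^sub>0 UNIV (\<lambda>J. mixture (\<kappa> J)))"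
    unfolding fdd_converges_def by blast
  then show ?thesis unfolding F_proj lhs rhs .
qed

text \<open>The states on which the functionals below are evaluated: the infinite-volume states and the
  finite-volume Gibbs measures, which live on different measurable spaces.\<close>

definition admissible :: "'d config measure \<Rightarrow> bool" where
  "admissible \<Gamma> \<longleftrightarrow> \<Gamma> \<in> space state_space \<or> (\<exists>n J. \<Gamma> = G n J)"

text \<open>A function of the state that is measurable and bounded by \<open>B\<close> both in finite and in infinite volume.\<close>

definition functional :: "('d config measure \<Rightarrow> real) \<Rightarrow> real \<Rightarrow> bool" where
  "functional \<psi> B \<longleftrightarrow> \<psi> \<in> borel_measurable state_space
    \<and> (\<forall>n. (\<lambda>J. \<psi> (G n J)) \<in> borel_measurable iid_law) \<and> (\<forall>\<Gamma>. admissible \<Gamma> \<longrightarrow> \<bar>\<psi> \<Gamma>\<bar> \<le> B)"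

text \<open>The value of \<open>\<psi>\<close> at the finite-volume Gibbs measure converges, weakly in \<open>L\<^sup>1\<close> of the couplings, to the
  average of \<open>\<psi>\<close> over the metastate.\<close>

definition stable_limit :: "('d config measure \<Rightarrow> real) \<Rightarrow> bool" where
  "stable_limit \<psi> \<longleftrightarrow> (\<forall>h. integrable iid_law h \<longrightarrow>
    (\<lambda>n. \<integral>J. h J * \<psi> (G n J) \<partial>iid_law) \<longlonglongrightarrow> (\<integral>J. h J * (\<integral>\<Gamma>. \<psi> \<Gamma> \<partial>\<kappa> J) \<partial>iid_law))"

lemma admissible_prob: "admissible \<Gamma> \<Longrightarrow> prob_space \<Gamma>"
  by (auto simp: admissible_def space_prob_algebra prob_space_gibbs)

lemma admissible_G: "admissible (G n J)"
  by (auto simp: admissible_def)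

lemma admissible_\<kappa>: "J \<in> space iid_law
    \<Longrightarrow> \<Gamma> \<in> space (\<kappa> J) \<Longrightarrow> admissible \<Gamma>"
  using sets_eq_imp_space_eq[OF \<kappa>_sets] by (auto simp: admissible_def)

lemma functional_\<kappa>:
  assumes "functional \<psi> B"
  shows "(\<lambda>J. \<integral>\<Gamma>. \<psi> \<Gamma> \<partial>\<kappa> J) \<in> borel_measurable iid_law"
    and "J \<in> space iid_law \<Longrightarrow> integrable (\<kappa> J) \<psi>"
    and "J \<in> space iid_law \<Longrightarrow> \<bar>\<integral>\<Gamma>. \<psi> \<Gamma> \<partial>\<kappa> J\<bar> \<le> B"
proof -
  show "(\<lambda>J. \<integral>\<Gamma>. \<psi> \<Gamma> \<partial>\<kappa> J) \<in> borel_measurable iid_law"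
    using assms by (intro measurable_integral_\<kappa>) (auto simp: functional_def)
  assume J: "J \<in> space iid_law"
  interpret K: prob_space "\<kappa> J" by (rule \<kappa>_prob[OF J])
  show int: "integrable (\<kappa> J) \<psi>"
    using assms admissible_\<kappa>[OF J] \<kappa>_sets[OF J]
    by (intro K.integrable_const_bound[where B = B]) (auto simp: functional_def cong: measurable_cong_sets)
  have "\<bar>\<integral>\<Gamma>. \<psi> \<Gamma> \<partial>\<kappa> J\<bar>
      \<le> (\<integral>\<Gamma>. \<bar>\<psi> \<Gamma>\<bar> \<partial>\<kappa> J)" by (rule integral_abs_bound)
  also have "\<dots> \<le> (\<integral>\<Gamma>. B \<partial>\<kappa> J)"
    using int assms admissible_\<kappa>[OF J] by (intro integral_mono) (auto simp: functional_def)
  finally show "\<bar>\<integral>\<Gamma>. \<psi> \<Gamma> \<partial>\<kappa> J\<bar> \<le> B"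
    by (simp add: K.prob_space)
qed

lemma functional_replica_prod:
  assumes V: "finite V" and f: "\<And>i. f i \<in> local_obs V" "\<And>i \<sigma>. \<bar>f i \<sigma>\<bar> \<le> B"
  shows "functional (replica_prod k f) (B ^ k)"
  unfolding functional_def
proof (intro conjI allI impI)
  show "replica_prod k f \<in> borel_measurable state_space"
    by (intro measurable_replica_prod measurable_local_obs[OF V f(1)])
  show "(\<lambda>J. replica_prod k f (G n J)) \<in> borel_measurable iid_law" for n
    unfolding replica_prod_def by measurable
  show "\<bar>replica_prod k f \<Gamma>\<bar> \<le> B ^ k" if "admissible \<Gamma>" for \<Gamma>
    by (rule abs_replica_prod_le[OF admissible_prob[OF that] f(2)])
qed

lemma stable_limit_replica_prod:
  assumes V: "finite V" and f: "\<And>i. f i \<in> local_obs V" "\<And>i \<sigma>. \<bar>f i \<sigma>\<bar> \<le> B"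
  shows "stable_limit (replica_prod k f)"
  unfolding stable_limit_def
proof (intro allI impI)
  fix h :: "'d couplings \<Rightarrow> real" assume h: "integrable iid_law h"
  define w where "w n J = replica_prod k f (G n J) - (\<integral>\<Gamma>. replica_prod k f \<Gamma> \<partial>\<kappa> J)" for n J
  have fn: "functional (replica_prod k f) (B ^ k)" by (rule functional_replica_prod[OF V f])
  have m1: "(\<lambda>J. replica_prod k f (G n J)) \<in> borel_measurable iid_law" for n
    using fn by (auto simp: functional_def)
  note m2 = functional_\<kappa>(1)[OF fn]
  have b1: "\<bar>replica_prod k f (G n J)\<bar> \<le> B ^ k" for n J
    using fn by (auto simp: functional_def admissible_def)
  note b2 = functional_\<kappa>(3)[OF fn]
  have eq: "(\<integral>J. h J * w n J \<partial>iid_law)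
      = (\<integral>J. h J * replica_prod k f (G n J) \<partial>iid_law)
      - (\<integral>J. h J * (\<integral>\<Gamma>. replica_prod k f \<Gamma> \<partial>\<kappa> J) \<partial>iid_law)" if "integrable iid_law h" for n h
    unfolding w_def right_diff_distrib
    by (rule Bochner_Integration.integral_diff)
      (rule P.integrable_mult_bounded[OF that m1 b1], rule P.integrable_mult_bounded[OF that m2 b2])
  have "(\<lambda>n. \<integral>J. h J * w n J \<partial>iid_law) \<longlonglongrightarrow> 0"
  proof (rule integral_mult_tendsto_0_of_continuous_cylinders[OF _ _ _ h])
    show "w n \<in> borel_measurable iid_law" for n unfolding w_def using m1 m2 by measurable
    show "\<bar>w n J\<bar> \<le> 2 * B ^ k" if "J \<in> space iid_law" for n J
      using b1[of n J] b2[OF that] unfolding w_def by linarith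
    fix A :: "'d edge set" and g :: "'d edge \<Rightarrow> real \<Rightarrow> real"
    assume A: "finite A" "A \<subseteq> edges"
      and g: "\<And>e. continuous_on UNIV (g e)" "\<And>e t. 0 \<le> g e t \<and> g e t \<le> 1"
    have "integrable iid_law (\<lambda>J. \<Prod>e\<in>A. g e (J e))"
    proof (rule P.integrable_const_bound[where B = 1])
      show "(\<lambda>J. \<Prod>e\<in>A. g e (J e)) \<in> borel_measurable iid_law"
      proof (rule borel_measurable_prod)
        fix e assume "e \<in> A"
        then have "(\<lambda>J. J e) \<in> iid_law \<rightarrow>\<^sub>M borel"
          using A(2) measurable_component_singleton[of e edges "\<lambda>_. \<nu>\<^sub>0"]
            by (auto simp: measurable_cong_sets[OF refl sets_N])
        from measurable_compose[OF this borel_measurable_continuous_onI[OF g(1)]]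
        show "(\<lambda>J. g e (J e)) \<in> borel_measurable iid_law" .
      qed
      show "AE J in iid_law. norm (\<Prod>e\<in>A. g e (J e)) \<le> 1"
        unfolding real_norm_def abs_prod using g(2) by (intro AE_I2 prod_le_1) auto
    qed
    from eq[OF this] fdd_product_observables[OF A V f g, where k = k]
    show "(\<lambda>n. \<integral>J. (\<Prod>e\<in>A. g e (J e)) * w n J \<partial>iid_law)
        \<longlonglongrightarrow> 0"
      by (simp add: LIM_zero)
  qed
  then show "(\<lambda>n. \<integral>J. h J * replica_prod k f (G n J) \<partial>iid_law)
      \<longlonglongrightarrow> (\<integral>J. h J * (\<integral>\<Gamma>. replica_prod k f \<Gamma> \<partial>\<kappa> J) \<partial>iid_law)"
    unfolding eq[OF h] by (rule LIM_zero_cancel)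
qed

lemma stable_limit_sum:
  assumes "finite A" "\<And>j. j \<in> A
      \<Longrightarrow> functional (\<psi> j) (B j)" "\<And>j. j \<in> A \<Longrightarrow> stable_limit (\<psi> j)"
  shows "stable_limit (\<lambda>\<Gamma>. \<Sum>j\<in>A. c j * \<psi> j \<Gamma>)"
  unfolding stable_limit_def
proof (intro allI impI)
  fix h :: "'d couplings \<Rightarrow> real" assume h: "integrable iid_law h"
  have 1: "(\<integral>J. h J * (\<Sum>j\<in>A. c j * \<psi> j (G n J)) \<partial>iid_law)
      = (\<Sum>j\<in>A. c j * (\<integral>J. h J * \<psi> j (G n J) \<partial>iid_law))" for n
  proof -
    have i: "integrable iid_law (\<lambda>J. h J * \<psi> j (G n J))" if "j \<in> A" for j
      using assms(2)[OF that] by (intro P.integrable_mult_bounded[OF h, where B = "B j"]) (auto simp: functional_def admissible_def)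
    have "(\<integral>J. h J * (\<Sum>j\<in>A. c j * \<psi> j (G n J)) \<partial>iid_law)
        = (\<integral>J. (\<Sum>j\<in>A. c j * (h J * \<psi> j (G n J))) \<partial>iid_law)"
      by (simp add: sum_distrib_left mult_ac)
    also have "\<dots> = (\<Sum>j\<in>A. \<integral>J. c j * (h J * \<psi> j (G n J)) \<partial>iid_law)"
      by (rule Bochner_Integration.integral_sum) (use i in auto)
    finally show ?thesis by simp
  qed
  have 2: "(\<integral>J. h J * (\<integral>\<Gamma>. (\<Sum>j\<in>A. c j * \<psi> j \<Gamma>) \<partial>\<kappa> J) \<partial>iid_law)
      = (\<Sum>j\<in>A. c j * (\<integral>J. h J * (\<integral>\<Gamma>. \<psi> j \<Gamma> \<partial>\<kappa> J) \<partial>iid_law))"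
  proof -
    have i: "integrable iid_law (\<lambda>J. h J * (\<integral>\<Gamma>. \<psi> j \<Gamma> \<partial>\<kappa> J))" if "j \<in> A" for j
      using functional_\<kappa>[OF assms(2)[OF that]]
        by (intro P.integrable_mult_bounded[OF h, where B = "B j"]) auto
    have "(\<integral>J. h J * (\<integral>\<Gamma>. (\<Sum>j\<in>A. c j * \<psi> j \<Gamma>) \<partial>\<kappa> J) \<partial>iid_law)
        = (\<integral>J. (\<Sum>j\<in>A. c j * (h J * (\<integral>\<Gamma>. \<psi> j \<Gamma> \<partial>\<kappa> J))) \<partial>iid_law)"
    proof (rule Bochner_Integration.integral_cong[OF refl])
      fix J :: "'d couplings" assume J: "J \<in> space iid_law"
      have "(\<integral>\<Gamma>. (\<Sum>j\<in>A. c j * \<psi> j \<Gamma>) \<partial>\<kappa> J)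
          = (\<Sum>j\<in>A. \<integral>\<Gamma>. c j * \<psi> j \<Gamma> \<partial>\<kappa> J)"
        by (rule Bochner_Integration.integral_sum) (use functional_\<kappa>(2)[OF assms(2) J] in auto)
      then show "h J * (\<integral>\<Gamma>. (\<Sum>j\<in>A. c j * \<psi> j \<Gamma>) \<partial>\<kappa> J) = (\<Sum>j\<in>A. c j * (h J * (\<integral>\<Gamma>. \<psi> j \<Gamma> \<partial>\<kappa> J)))"
        by (simp add: sum_distrib_left mult_ac)
    qed
    also have "\<dots> = (\<Sum>j\<in>A. \<integral>J. c j * (h J * (\<integral>\<Gamma>. \<psi> j \<Gamma> \<partial>\<kappa> J)) \<partial>iid_law)"
      by (rule Bochner_Integration.integral_sum) (use i in auto)
    finally show ?thesis by simp
  qed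
  show "(\<lambda>n. \<integral>J. h J * (\<Sum>j\<in>A. c j * \<psi> j (G n J)) \<partial>iid_law)
      \<longlonglongrightarrow> (\<integral>J. h J * (\<integral>\<Gamma>. (\<Sum>j\<in>A. c j * \<psi> j \<Gamma>) \<partial>\<kappa> J) \<partial>iid_law)"
    unfolding 1 2 using assms(3) h
      by (intro tendsto_sum tendsto_mult_left) (auto simp: stable_limit_def)
qed

text \<open>The class of functionals with a limit is closed under uniform limits. This gives access to expectations
  under tilted states, which are quotients of expectations.\<close>

lemma stable_limit_uniform:
  assumes \<psi>: "functional \<psi> B"
    and approx: "\<And>\<epsilon>. \<epsilon> > 0
        \<Longrightarrow> \<exists>\<psi>' B'. functional \<psi>' B' \<and> stable_limit \<psi>' \<and> (\<forall>\<Gamma>. admissible \<Gamma> \<longrightarrow> \<bar>\<psi> \<Gamma> - \<psi>' \<Gamma>\<bar> \<le> \<epsilon>)"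
  shows "stable_limit \<psi>"
  unfolding stable_limit_def
proof (intro allI impI)
  fix h :: "'d couplings \<Rightarrow> real" assume h: "integrable iid_law h"
  define H where "H = (\<integral>J. \<bar>h J\<bar> \<partial>iid_law)"
  have H: "H \<ge> 0" unfolding H_def by simp
  have est: "\<bar>(\<integral>J. h J * u J \<partial>iid_law) - (\<integral>J. h J * v J \<partial>iid_law)\<bar> \<le> \<epsilon> * H"
    if "u \<in> borel_measurable iid_law" "\<And>J. J \<in> space iid_law
        \<Longrightarrow> \<bar>u J\<bar> \<le> C"
      "v \<in> borel_measurable iid_law" "\<And>J. J \<in> space iid_law
          \<Longrightarrow> \<bar>v J\<bar> \<le> C'"
      "\<And>J. J \<in> space iid_law \<Longrightarrow> \<bar>u J - v J\<bar>
          \<le> \<epsilon>" for u v C C' \<epsilon>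
  proof -
    have i: "integrable iid_law (\<lambda>J. h J * u J)" "integrable iid_law (\<lambda>J. h J * v J)"
      using that by (auto intro!: P.integrable_mult_bounded[OF h])
    have "\<bar>(\<integral>J. h J * u J \<partial>iid_law) - (\<integral>J. h J * v J \<partial>iid_law)\<bar> = \<bar>\<integral>J. h J * (u J - v J) \<partial>iid_law\<bar>"
      unfolding right_diff_distrib by (simp add: Bochner_Integration.integral_diff[OF i])
    also have "\<dots> \<le> (\<integral>J. \<bar>h J * (u J - v J)\<bar> \<partial>iid_law)"
      by (rule integral_abs_bound)
    also have "\<dots> \<le> (\<integral>J. \<epsilon> * \<bar>h J\<bar> \<partial>iid_law)"
    proof (rule integral_mono)
      show "integrable iid_law (\<lambda>J. \<bar>h J * (u J - v J)\<bar>)"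
        unfolding right_diff_distrib using i by auto
      show "\<bar>h J * (u J - v J)\<bar> \<le> \<epsilon> * \<bar>h J\<bar>"
        if "J \<in> space iid_law" for J
        unfolding abs_mult using mult_right_mono[OF \<open>\<And>J. J \<in> space iid_law \<Longrightarrow> \<bar>u J - v J\<bar> \<le> \<epsilon>\<close>[OF that], of "\<bar>h J\<bar>"]
        by (simp add: mult.commute)
    qed (use h in auto)
    finally show ?thesis by (simp add: H_def)
  qed
  show "(\<lambda>n. \<integral>J. h J * \<psi> (G n J) \<partial>iid_law)
      \<longlonglongrightarrow> (\<integral>J. h J * (\<integral>\<Gamma>. \<psi> \<Gamma> \<partial>\<kappa> J) \<partial>iid_law)"
  proof (rule LIMSEQ_I)
    fix r :: real assume r: "0 < r"
    define \<epsilon> where "\<epsilon> = r / (3 * (H + 1))"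
    have \<epsilon>: "\<epsilon> > 0" "\<epsilon> * H < r / 3"
      using r H by (auto simp: \<epsilon>_def field_simps)
    obtain \<psi>' B' where \<psi>': "functional \<psi>' B'" "stable_limit \<psi>'" "\<And>\<Gamma>. admissible \<Gamma> \<Longrightarrow> \<bar>\<psi> \<Gamma> - \<psi>' \<Gamma>\<bar> \<le> \<epsilon>"
      using approx[OF \<epsilon>(1)] by blast
    have e1: "\<bar>(\<integral>J. h J * \<psi> (G n J) \<partial>iid_law) - (\<integral>J. h J * \<psi>' (G n J) \<partial>iid_law)\<bar> \<le> \<epsilon> * H" for n
    proof (rule est)
      show "\<bar>\<psi> (G n J)\<bar> \<le> B" "\<bar>\<psi>' (G n J)\<bar>
          \<le> B'" "\<bar>\<psi> (G n J) - \<psi>' (G n J)\<bar> \<le> \<epsilon>" for J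
        using \<psi> \<psi>' admissible_G by (auto simp: functional_def)
    qed (use \<psi> \<psi>' in \<open>auto simp: functional_def\<close>)
    have e2: "\<bar>(\<integral>J. h J * (\<integral>\<Gamma>. \<psi> \<Gamma> \<partial>\<kappa> J) \<partial>iid_law) - (\<integral>J. h J * (\<integral>\<Gamma>. \<psi>' \<Gamma> \<partial>\<kappa> J) \<partial>iid_law)\<bar> \<le> \<epsilon> * H"
    proof (rule est)
      fix J :: "'d couplings" assume J: "J \<in> space iid_law"
      interpret K: prob_space "\<kappa> J" by (rule \<kappa>_prob[OF J])
      have i: "integrable (\<kappa> J) \<psi>" "integrable (\<kappa> J) \<psi>'"
        using functional_\<kappa>(2)[OF \<psi> J] functional_\<kappa>(2)[OF \<psi>'(1) J] by auto
      have "\<bar>(\<integral>\<Gamma>. \<psi> \<Gamma> \<partial>\<kappa> J) - (\<integral>\<Gamma>. \<psi>' \<Gamma> \<partial>\<kappa> J)\<bar> \<le> (\<integral>\<Gamma>. \<bar>\<psi> \<Gamma> - \<psi>' \<Gamma>\<bar> \<partial>\<kappa> J)"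
        unfolding Bochner_Integration.integral_diff[OF i, symmetric] by (rule integral_abs_bound)
      also have "\<dots> \<le> (\<integral>\<Gamma>. \<epsilon> \<partial>\<kappa> J)"
        using i \<psi>'(3) admissible_\<kappa>[OF J] by (intro integral_mono) auto
      finally show "\<bar>(\<integral>\<Gamma>. \<psi> \<Gamma> \<partial>\<kappa> J) - (\<integral>\<Gamma>. \<psi>' \<Gamma> \<partial>\<kappa> J)\<bar> \<le> \<epsilon>" by (simp add: K.prob_space)
    qed (use functional_\<kappa>(1,3)[OF \<psi>] functional_\<kappa>(1,3)[OF \<psi>'(1)] in auto)
    have conv: "(\<lambda>n. \<integral>J. h J * \<psi>' (G n J) \<partial>iid_law)
        \<longlonglongrightarrow> (\<integral>J. h J * (\<integral>\<Gamma>. \<psi>' \<Gamma> \<partial>\<kappa> J) \<partial>iid_law)"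
      using \<psi>'(2) h by (auto simp: stable_limit_def)
    obtain N where N: "\<And>n. n \<ge> N \<Longrightarrow>
        norm ((\<integral>J. h J * \<psi>' (G n J) \<partial>iid_law) - (\<integral>J. h J * (\<integral>\<Gamma>. \<psi>' \<Gamma> \<partial>\<kappa> J) \<partial>iid_law)) < r / 3"
      using LIMSEQ_D[OF conv, of "r / 3"] r by auto
    have "norm ((\<integral>J. h J * \<psi> (G n J) \<partial>iid_law) - (\<integral>J. h J * (\<integral>\<Gamma>. \<psi> \<Gamma> \<partial>\<kappa> J) \<partial>iid_law)) < r" if "n \<ge> N" for n
      using N[OF that] e1[of n] e2 \<epsilon>(2) unfolding real_norm_def by linarith
    then show "\<exists>N. \<forall>n\<ge>N. norm ((\<integral>J. h J * \<psi> (G n J) \<partial>iid_law) - (\<integral>J. h J * (\<integral>\<Gamma>. \<psi> \<Gamma> \<partial>\<kappa> J) \<partial>iid_law)) < r"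
      by blast
  qed
qed

end


section \<open>Covariance of the metastate\<close>

text \<open>Truncation to \<open>[-1, 1]\<close> makes functions of the spins bounded for arbitrary real arguments and does not
  change them on \<open>{-1, 1}\<close>.\<close>

definition clip :: "real \<Rightarrow> real" where
  "clip s = max (- 1) (min 1 s)"

text \<open>On configurations of spins with values in \<open>{-1, 1}\<close> this is the indicator of the event that all spins
  in \<open>S\<close> are equal to \<open>1\<close>. These events determine the law of the configuration.\<close>

definition all_up :: "('d::finite) site set \<Rightarrow> 'd config \<Rightarrow> real" where
  "all_up S \<sigma> = (\<Prod>x\<in>S. max 0 (min 1 (\<sigma> x)))"

text \<open>The Boltzmann factor of the local perturbation with couplings \<open>t\<close>, as a bounded local observable.\<close>

definition tilt_weight :: "real \<Rightarrow> ('d::finite) site set \<Rightarrow> 'd couplings \<Rightarrow> 'd config \<Rightarrow> real" where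
  "tilt_weight \<beta> W t \<sigma> = exp (\<beta> * local_energy W t (\<lambda>x. clip (\<sigma> x)))"

lemma all_up_local_obs: "S \<subseteq> V \<Longrightarrow> all_up S \<in> local_obs V"
  unfolding local_obs_def all_up_def
  by (auto intro!: continuous_intros continuous_on_product_coordinates prod.cong simp: subset_iff)

lemma all_up_bounds: "0 \<le> all_up S \<sigma>" "all_up S \<sigma>
    \<le> 1" "\<bar>all_up S \<sigma>\<bar> \<le> 1"
proof -
  show *: "0 \<le> all_up S \<sigma>" "all_up S \<sigma> \<le> 1"
    unfolding all_up_def by (auto intro!: prod_nonneg prod_le_1)
  then show "\<bar>all_up S \<sigma>\<bar> \<le> 1" by simp
qed

lemma tilt_weight_local_obs: "tilt_weight \<beta> W t \<in> local_obs W"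
proof -
  have "continuous_on UNIV (tilt_weight \<beta> W t)"
    unfolding tilt_weight_def local_energy_def clip_def
    by (intro continuous_intros continuous_on_product_coordinates)
  moreover have "tilt_weight \<beta> W t \<sigma> = tilt_weight \<beta> W t \<tau>"
    if "\<forall>x\<in>W. \<sigma> x = \<tau> x" for \<sigma> \<tau>
    unfolding tilt_weight_def local_energy_def using that
    by (intro arg_cong[where f = exp] arg_cong[where f = "(*) \<beta>"] sum.cong refl arg_cong2[where f = "(*)"] prod.cong)
      (auto simp: edges_in_def)
  ultimately show ?thesis by (auto simp: local_obs_def)
qed

text \<open>The Boltzmann factor lies between the inverse of this bound and the bound.\<close>

definition tilt_bound :: "real \<Rightarrow> ('d::finite) site set \<Rightarrow> 'd couplings \<Rightarrow> real" where
  "tilt_bound \<beta> W t = exp (\<bar>\<beta>\<bar> * (\<Sum>e\<in>edges_in W. \<bar>t e\<bar>))"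

lemma tilt_bound_ge_1: "1 \<le> tilt_bound \<beta> W t"
  unfolding tilt_bound_def by (simp add: sum_nonneg)

lemma tilt_weight_bounds: "1 / tilt_bound \<beta> W t
    \<le> tilt_weight \<beta> W t \<sigma>" "tilt_weight \<beta> W t \<sigma> \<le> tilt_bound \<beta> W t"
proof -
  have "\<bar>local_energy W t (\<lambda>x. clip (\<sigma> x))\<bar>
      \<le> (\<Sum>e\<in>edges_in W. \<bar>t e\<bar>)"
    unfolding local_energy_def
  proof (rule order_trans[OF sum_abs], rule sum_mono)
    fix e :: "'a edge"
    have "\<bar>\<Prod>x\<in>e. clip (\<sigma> x)\<bar> \<le> 1"
      unfolding abs_prod by (intro prod_le_1) (auto simp: clip_def)
    then show "\<bar>t e * (\<Prod>x\<in>e. clip (\<sigma> x))\<bar> \<le> \<bar>t e\<bar>"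
      unfolding abs_mult by (simp add: mult_left_le)
  qed
  then have "\<bar>\<beta> * local_energy W t (\<lambda>x. clip (\<sigma> x))\<bar>
      \<le> \<bar>\<beta>\<bar> * (\<Sum>e\<in>edges_in W. \<bar>t e\<bar>)"
    unfolding abs_mult by (rule mult_left_mono) simp
  then have "\<beta> * local_energy W t (\<lambda>x. clip (\<sigma> x))
      \<le> \<bar>\<beta>\<bar> * (\<Sum>e\<in>edges_in W. \<bar>t e\<bar>)"
    "- (\<bar>\<beta>\<bar> * (\<Sum>e\<in>edges_in W. \<bar>t e\<bar>))
        \<le> \<beta> * local_energy W t (\<lambda>x. clip (\<sigma> x))"
    by (simp_all add: abs_le_iff)
  then show "1 / tilt_bound \<beta> W t
      \<le> tilt_weight \<beta> W t \<sigma>" "tilt_weight \<beta> W t \<sigma> \<le> tilt_bound \<beta> W t"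
    unfolding tilt_bound_def tilt_weight_def
      by (simp_all add: exp_minus[symmetric] inverse_eq_divide[symmetric])
qed

lemma tilt_weight_abs: "\<bar>tilt_weight \<beta> W t \<sigma>\<bar> \<le> tilt_bound \<beta> W t"
  using tilt_weight_bounds(2)[of \<beta> W t \<sigma>] by (simp add: tilt_weight_def)

lemma tilt_weight_spins:
  assumes "\<And>x. x \<in> W \<Longrightarrow> \<sigma> x \<in> {-1, 1}"
  shows "tilt_weight \<beta> W t \<sigma> = exp (\<beta> * local_energy W t \<sigma>)"
proof -
  have "clip (\<sigma> x) = \<sigma> x"
    if "x \<in> W" for x using assms[OF that] by (auto simp: clip_def)
  then show ?thesis
    unfolding tilt_weight_def local_energy_def
    by (intro arg_cong[where f = exp] arg_cong[where f = "(*) \<beta>"] sum.cong refl arg_cong2[where f = "(*)"] prod.cong)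
      (auto simp: edges_in_def)
qed

lemma local_obs_mult:
  "f \<in> local_obs V \<Longrightarrow> g \<in> local_obs V'
      \<Longrightarrow> (\<lambda>\<sigma>. f \<sigma> * g \<sigma>) \<in> local_obs (V \<union> V')"
  unfolding local_obs_def
  by (clarsimp simp: continuous_on_mult) (metis UnCI)

lemma local_obs_mono: "f \<in> local_obs V \<Longrightarrow> V \<subseteq> V'
    \<Longrightarrow> f \<in> local_obs V'"
  unfolding local_obs_def by (auto simp: subset_iff) 

context EA_metastate begin

text \<open>The value of \<open>replica_prod k f\<close> at the state tilted by the local perturbation with couplings \<open>t\<close>.\<close>

definition tilted_prod :: "nat \<Rightarrow> 'd site set \<Rightarrow> 'd couplings \<Rightarrow> (nat \<Rightarrow> 'd config \<Rightarrow> real) \<Rightarrow> 'd config measure \<Rightarrow> real" where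
  "tilted_prod k W t f \<Gamma> = replica_prod k (\<lambda>i \<sigma>. tilt_weight \<beta> W t \<sigma> * f i \<sigma>) \<Gamma> / (\<integral>\<sigma>. tilt_weight \<beta> W t \<sigma> \<partial>\<Gamma>) ^ k"

lemma admissible_measurable:
  assumes "admissible \<Gamma>" "finite V" "f \<in> local_obs V"
  shows "f \<in> borel_measurable \<Gamma>"
  using assms measurable_local_obs[OF assms(2,3)]
  by (auto simp: admissible_def space_prob_algebra cong: measurable_cong_sets)

lemma tilt_normalisation:
  assumes "admissible \<Gamma>" "finite W"
  shows "1 / tilt_bound \<beta> W t
      \<le> (\<integral>\<sigma>. tilt_weight \<beta> W t \<sigma> \<partial>\<Gamma>)" "(\<integral>\<sigma>. tilt_weight \<beta> W t \<sigma> \<partial>\<Gamma>) \<le> tilt_bound \<beta> W t"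
proof -
  interpret \<Gamma>: prob_space \<Gamma> by (rule admissible_prob[OF assms(1)])
  have m: "tilt_weight \<beta> W t \<in> borel_measurable \<Gamma>"
    by (rule admissible_measurable[OF assms tilt_weight_local_obs])
  have i: "integrable \<Gamma> (tilt_weight \<beta> W t)"
    by (rule \<Gamma>.integrable_const_bound[where B = "tilt_bound \<beta> W t"]) (use m tilt_weight_abs in \<open>auto intro!: AE_I2\<close>)
  have "(\<integral>\<sigma>. 1 / tilt_bound \<beta> W t \<partial>\<Gamma>)
      \<le> (\<integral>\<sigma>. tilt_weight \<beta> W t \<sigma> \<partial>\<Gamma>)"
    by (rule integral_mono[OF _ i tilt_weight_bounds(1)]) simp
  then show "1 / tilt_bound \<beta> W t
      \<le> (\<integral>\<sigma>. tilt_weight \<beta> W t \<sigma> \<partial>\<Gamma>)" by (simp add: \<Gamma>.prob_space)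
  have "(\<integral>\<sigma>. tilt_weight \<beta> W t \<sigma> \<partial>\<Gamma>)
      \<le> (\<integral>\<sigma>. tilt_bound \<beta> W t \<partial>\<Gamma>)"
    by (rule integral_mono[OF i _ tilt_weight_bounds(2)]) simp
  then show "(\<integral>\<sigma>. tilt_weight \<beta> W t \<sigma> \<partial>\<Gamma>)
      \<le> tilt_bound \<beta> W t" by (simp add: \<Gamma>.prob_space)
qed

lemma tilted_factor:
  assumes V: "finite V" "finite W"
    and f: "\<And>i. f i \<in> local_obs V" "\<And>i \<sigma>. \<bar>f i \<sigma>\<bar> \<le> 1"
  shows "(\<lambda>\<sigma>. tilt_weight \<beta> W t \<sigma> * f i \<sigma>) \<in> local_obs (W \<union> V)"
    "\<bar>tilt_weight \<beta> W t \<sigma> * f i \<sigma>\<bar> \<le> tilt_bound \<beta> W t"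
proof -
  show "(\<lambda>\<sigma>. tilt_weight \<beta> W t \<sigma> * f i \<sigma>) \<in> local_obs (W \<union> V)"
    by (rule local_obs_mult[OF tilt_weight_local_obs f(1)])
  have "\<bar>tilt_weight \<beta> W t \<sigma>\<bar> * \<bar>f i \<sigma>\<bar>
      \<le> tilt_bound \<beta> W t * 1"
    by (rule mult_mono[OF tilt_weight_abs f(2)]) (use tilt_bound_ge_1[of \<beta> W t] in auto)
  then show "\<bar>tilt_weight \<beta> W t \<sigma> * f i \<sigma>\<bar>
      \<le> tilt_bound \<beta> W t" by (simp add: abs_mult)
qed

lemma functional_tilted_prod:
  assumes V: "finite V" "finite W"
    and f: "\<And>i. f i \<in> local_obs V" "\<And>i \<sigma>. \<bar>f i \<sigma>\<bar> \<le> 1"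
  shows "functional (tilted_prod k W t f) (tilt_bound \<beta> W t ^ k * tilt_bound \<beta> W t ^ k)"
proof -
  have fin: "finite (W \<union> V)" using V by simp
  have fn: "functional (replica_prod k (\<lambda>i \<sigma>. tilt_weight \<beta> W t \<sigma> * f i \<sigma>)) (tilt_bound \<beta> W t ^ k)"
    by (rule functional_replica_prod[OF fin]) (rule tilted_factor[OF V f])+
  have int_meas: "(\<lambda>\<Gamma>. \<integral>\<sigma>. tilt_weight \<beta> W t \<sigma> \<partial>\<Gamma>) \<in> borel_measurable state_space"
    unfolding prob_algebra_def
    by (intro measurable_restrict_space1 integral_measurable_subprob_algebra measurable_local_obs[OF V(2) tilt_weight_local_obs])
  show ?thesis
    unfolding functional_def tilted_prod_def
  proof (intro conjI allI impI)
    show "(\<lambda>\<Gamma>. replica_prod k (\<lambda>i \<sigma>. tilt_weight \<beta> W t \<sigma> * f i \<sigma>) \<Gamma> / (\<integral>\<sigma>. tilt_weight \<beta> W t \<sigma> \<partial>\<Gamma>) ^ k)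
        \<in> borel_measurable state_space"
      using fn int_meas unfolding functional_def
      by (intro borel_measurable_divide borel_measurable_power) simp_all
    show "(\<lambda>J. replica_prod k (\<lambda>i \<sigma>. tilt_weight \<beta> W t \<sigma> * f i \<sigma>) (G n J) / (\<integral>\<sigma>. tilt_weight \<beta> W t \<sigma> \<partial>G n J) ^ k)
        \<in> borel_measurable iid_law" for n
      unfolding replica_prod_def by measurable
    fix \<Gamma> assume adm: "admissible \<Gamma>"
    define y where "y = (\<integral>\<sigma>. tilt_weight \<beta> W t \<sigma> \<partial>\<Gamma>)"
    have y: "1 / tilt_bound \<beta> W t \<le> y" "y > 0"
      using tilt_normalisation(1)[OF adm V(2), of t] tilt_bound_ge_1[of \<beta> W t]
      by (auto simp: y_def intro: less_le_trans[rotated])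
    have "\<bar>1 / y ^ k\<bar> = (1 / y) ^ k" using y by (simp add: power_divide power_one_over)
    also have "\<dots> \<le> tilt_bound \<beta> W t ^ k"
      using y tilt_bound_ge_1[of \<beta> W t] by (intro power_mono) (auto simp: field_simps)
    finally have "\<bar>replica_prod k (\<lambda>i \<sigma>. tilt_weight \<beta> W t \<sigma> * f i \<sigma>) \<Gamma>\<bar> * \<bar>1 / y ^ k\<bar>
        \<le> tilt_bound \<beta> W t ^ k * tilt_bound \<beta> W t ^ k"
      using fn adm tilt_bound_ge_1[of \<beta> W t] by (intro mult_mono) (auto simp: functional_def)
    then show "\<bar>replica_prod k (\<lambda>i \<sigma>. tilt_weight \<beta> W t \<sigma> * f i \<sigma>) \<Gamma> / (\<integral>\<sigma>. tilt_weight \<beta> W t \<sigma> \<partial>\<Gamma>) ^ k\<bar>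
        \<le> tilt_bound \<beta> W t ^ k * tilt_bound \<beta> W t ^ k"
      unfolding y_def[symmetric] by (simp add: abs_divide)
  qed
qed

text \<open>The normalisation \<open>y = \<Gamma>(e\<^bsup>\<beta>H'\<^esup>)\<close> lies in the compact interval \<open>[1/C, C]\<close>. Approximating \<open>y\<^sup>-\<^sup>k\<close> there uniformly
  by a polynomial in \<open>y\<close> reduces the quotient to products of expectations with more replicas.\<close>

lemma stable_limit_tilted_prod:
  assumes V: "finite V" "finite W"
    and f: "\<And>i. f i \<in> local_obs V" "\<And>i \<sigma>. \<bar>f i \<sigma>\<bar> \<le> 1"
  shows "stable_limit (tilted_prod k W t f)"
proof (rule stable_limit_uniform[OF functional_tilted_prod[OF V f]])
  fix \<epsilon> :: real assume \<epsilon>: "\<epsilon> > 0"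
  define C where "C = tilt_bound \<beta> W t"
  have C: "C \<ge> 1" unfolding C_def by (rule tilt_bound_ge_1)
  have "continuous_on {1 / C..C} (\<lambda>y :: real. 1 / y ^ k)"
    using C by (intro continuous_intros) (auto simp: field_simps)
  then obtain p where p: "real_polynomial_function p" "\<And>y. y \<in> {1 / C..C}
      \<Longrightarrow> \<bar>1 / y ^ k - p y\<bar> < \<epsilon> / C ^ k"
    using Stone_Weierstrass_real_polynomial_function[of "{1 / C..C}" "\<lambda>y. 1 / y ^ k" "\<epsilon> / C ^ k"] \<epsilon> C by auto
  then obtain m c where c: "p = (\<lambda>y. \<Sum>j\<le>m. c j * y ^ j)"
    unfolding real_polynomial_function_iff_sum by auto
  \<comment> \<open>The first \<open>k\<close> replicas carry the tilted observables, the remaining \<open>j\<close> carry the factors \<open>y\<close>.\<close>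
  define f' where "f' j i = (if i < k then (\<lambda>\<sigma>. tilt_weight \<beta> W t \<sigma> * f i \<sigma>) else tilt_weight \<beta> W t)" for j i :: nat
  have fin: "finite (W \<union> V)" using V by simp
  have f': "f' j i \<in> local_obs (W \<union> V)" "\<bar>f' j i \<sigma>\<bar>
      \<le> C" for j i \<sigma>
    unfolding f'_def C_def
    using tilted_factor[OF V f] tilt_weight_abs local_obs_mono[OF tilt_weight_local_obs, of W "W \<union> V"] by auto
  define \<psi> where "\<psi> j = replica_prod (k + j) (f' j)" for j
  have \<psi>: "functional (\<psi> j) (C ^ (k + j))" "stable_limit (\<psi> j)" for j
    unfolding \<psi>_def using functional_replica_prod[OF fin f'] stable_limit_replica_prod[OF fin f'] by auto
  have \<psi>_eq: "\<psi> j \<Gamma>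
      = replica_prod k (\<lambda>i \<sigma>. tilt_weight \<beta> W t \<sigma> * f i \<sigma>) \<Gamma> * (\<integral>\<sigma>. tilt_weight \<beta> W t \<sigma> \<partial>\<Gamma>) ^ j" for j \<Gamma>
    unfolding \<psi>_def f'_def by (rule replica_prod_append)
  have "functional (\<lambda>\<Gamma>. \<Sum>j\<le>m. c j * \<psi> j \<Gamma>) (\<Sum>j\<le>m. \<bar>c j\<bar> * C ^ (k + j))"
    unfolding functional_def
  proof (intro conjI allI impI)
    show "(\<lambda>\<Gamma>. \<Sum>j\<le>m. c j * \<psi> j \<Gamma>) \<in> borel_measurable state_space"
      using \<psi>(1) unfolding functional_def
        by (intro borel_measurable_sum borel_measurable_times) auto
    show "(\<lambda>J. \<Sum>j\<le>m. c j * \<psi> j (G n J)) \<in> borel_measurable iid_law" for n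
      using \<psi>(1) unfolding functional_def
        by (intro borel_measurable_sum borel_measurable_times) auto
    fix \<Gamma> assume "admissible \<Gamma>"
    then show "\<bar>\<Sum>j\<le>m. c j * \<psi> j \<Gamma>\<bar>
        \<le> (\<Sum>j\<le>m. \<bar>c j\<bar> * C ^ (k + j))"
      using \<psi>(1) by (intro order_trans[OF sum_abs] sum_mono) (auto simp: abs_mult functional_def intro!: mult_left_mono)
  qed
  moreover have "stable_limit (\<lambda>\<Gamma>. \<Sum>j\<le>m. c j * \<psi> j \<Gamma>)"
    by (rule stable_limit_sum[OF _ \<psi>]) simp
  moreover have "\<bar>tilted_prod k W t f \<Gamma> - (\<Sum>j\<le>m. c j * \<psi> j \<Gamma>)\<bar>
      \<le> \<epsilon>" if adm: "admissible \<Gamma>" for \<Gamma>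
  proof -
    define y where "y = (\<integral>\<sigma>. tilt_weight \<beta> W t \<sigma> \<partial>\<Gamma>)"
    define r where "r = replica_prod k (\<lambda>i \<sigma>. tilt_weight \<beta> W t \<sigma> * f i \<sigma>) \<Gamma>"
    have y: "y \<in> {1 / C..C}"
      using tilt_normalisation[OF adm V(2)] by (simp add: y_def C_def)
    have r: "\<bar>r\<bar> \<le> C ^ k"
      unfolding r_def C_def by (rule abs_replica_prod_le[OF admissible_prob[OF adm]]) (rule tilted_factor[OF V f])
    have "(\<Sum>j\<le>m. c j * \<psi> j \<Gamma>) = r * p y"
      unfolding \<psi>_eq c r_def y_def by (simp add: sum_distrib_left mult_ac)
    then have "\<bar>tilted_prod k W t f \<Gamma> - (\<Sum>j\<le>m. c j * \<psi> j \<Gamma>)\<bar>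
        = \<bar>r\<bar> * \<bar>1 / y ^ k - p y\<bar>"
      unfolding tilted_prod_def r_def[symmetric] y_def[symmetric] abs_mult[symmetric]
        by (simp add: right_diff_distrib)
    also have "\<dots> \<le> C ^ k * (\<epsilon> / C ^ k)"
      using r p(2)[OF y] C by (intro mult_mono) auto
    finally show ?thesis using C by simp
  qed
  ultimately show "\<exists>\<psi>' B'. functional \<psi>' B' \<and> stable_limit \<psi>' \<and> (\<forall>\<Gamma>. admissible \<Gamma> \<longrightarrow> \<bar>tilted_prod k W t f \<Gamma> - \<psi>' \<Gamma>\<bar> \<le> \<epsilon>)"
    by blast
qed

lemma eventually_subset_box:
  assumes "finite V"
  shows "\<forall>\<^sub>F n in sequentially. V \<subseteq> lattice_box (a n) (b n)"
  using boxes eventually_ball_finite[OF assms, of "\<lambda>n x. x \<in> lattice_box (a n) (b n)"]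
  by (auto simp: boxes_to_lattice_def subset_eq)

lemma replica_prod_gibbs_shift:
  assumes W: "W \<subseteq> lattice_box (a n) (b n)"
  shows "replica_prod k f (G n (shift (edges_in W) t J)) = tilted_prod k W t f (G n J)"
proof -
  have w: "tilt_weight \<beta> W t \<sigma> = exp (\<beta> * local_energy W t \<sigma>)"
    if "\<sigma> \<in> configs (a n) (b n)" for \<sigma>
    using that W by (intro tilt_weight_spins) (auto simp: PiE_iff)
  have eq: "(\<integral>\<sigma>. exp (\<beta> * local_energy W t \<sigma>) * g \<sigma> \<partial>G n J) = (\<integral>\<sigma>. tilt_weight \<beta> W t \<sigma> * g \<sigma> \<partial>G n J)" for g :: "_ \<Rightarrow> real"
    unfolding integral_gibbs by (simp add: w)
  show ?thesis
    unfolding replica_prod_def tilted_prod_def integral_gibbs_shift[OF W] eq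
    using eq[of "\<lambda>_. 1"] by (simp add: prod_dividef)
qed

text \<open>Changing finitely many couplings tilts the states of the metastate. In finite volume this is an identity.
  To pass to the limit on the side of the shifted couplings, the integral over \<open>J + t\<close> is rewritten
  as an integral over \<open>J\<close> with the density of the shifted law.\<close>

lemma tilt_covariance:
  assumes V: "finite V" "finite W"
    and f: "\<And>i. f i \<in> local_obs V" "\<And>i \<sigma>. \<bar>f i \<sigma>\<bar> \<le> 1"
  shows "AE J in iid_law. (\<integral>\<Gamma>. replica_prod k f \<Gamma> \<partial>\<kappa> (shift (edges_in W) t J)) = (\<integral>\<Gamma>. tilted_prod k W t f \<Gamma> \<partial>\<kappa> J)"
proof -
  define D where "D = edges_in W"
  have D: "finite D" "D \<subseteq> edges"
    using finite_edges_in[OF V(2)] by (auto simp: D_def edges_in_def)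
  define u where "u J = (\<integral>\<Gamma>. replica_prod k f \<Gamma> \<partial>\<kappa> J)" for J
  define v where "v J = (\<integral>\<Gamma>. tilted_prod k W t f \<Gamma> \<partial>\<kappa> J)" for J
  have fu: "functional (replica_prod k f) (1 ^ k)" by (rule functional_replica_prod[OF V(1) f])
  define B where "B = tilt_bound \<beta> W t ^ k * tilt_bound \<beta> W t ^ k"
  have fv: "functional (tilted_prod k W t f) B" unfolding B_def by (rule functional_tilted_prod[OF V f])
  have um [measurable]: "u \<in> borel_measurable iid_law"
    unfolding u_def by (rule functional_\<kappa>(1)[OF fu])
  have vm [measurable]: "v \<in> borel_measurable iid_law"
    unfolding v_def by (rule functional_\<kappa>(1)[OF fv])
  have sh [measurable]: "shift D s \<in> iid_law \<rightarrow>\<^sub>M iid_law" for s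
    by (rule measurable_shift[OF D(2)])
  have ub: "\<bar>u J\<bar> \<le> 1" if "J \<in> space iid_law" for J
    using functional_\<kappa>(3)[OF fu that] by (simp add: u_def)
  have vb: "\<bar>v J\<bar> \<le> B" if "J \<in> space iid_law" for J
    using functional_\<kappa>(3)[OF fv that] by (simp add: v_def)
  have "AE J in iid_law. u (shift D t J) = v J"
  proof (rule P.AE_eq_of_integral_eq[OF _ _ _ _ closed_cylinders])
    show "\<bar>u (shift D t J)\<bar> \<le> max 1 B" if "J \<in> space iid_law" for J
      using ub[OF measurable_space[OF sh that]] by (simp add: le_max_iff_disj)
    show "\<bar>v J\<bar> \<le> max 1 B" if "J \<in> space iid_law" for J
      using vb[OF that] by (simp add: le_max_iff_disj)
    fix C :: "'d couplings set" assume "C \<in> closed_cylinders"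
    then have C [measurable]: "C \<in> sets iid_law" using closed_cylinders(4) by auto
    obtain \<rho> where \<rho>: "integrable iid_law \<rho>" "\<And>g :: _ \<Rightarrow> real. g \<in> borel_measurable iid_law \<Longrightarrow>
        (\<integral>J. g (shift D t J) \<partial>iid_law) = (\<integral>J. \<rho> J * g J \<partial>iid_law)"
      using shift_density[OF D, of t] by blast
    \<comment> \<open>The function of \<open>J + t\<close> that equals the indicator of \<open>C\<close> at \<open>J\<close>, weighted by the density.\<close>
    define h where "h J = \<rho> J * indicator C (shift D (\<lambda>e. - t e) J)" for J
    have h: "integrable iid_law h"
      unfolding h_def by (rule P.integrable_mult_bounded[where B = 1, OF \<rho>(1)]) (auto split: split_indicator)
    have inv: "shift D (\<lambda>e. - t e) (shift D t J) = J" for J by (auto simp: shift_def)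
    have change: "(\<integral>J. h J * g J \<partial>iid_law)
        = (\<integral>J. indicator C J * g (shift D t J) \<partial>iid_law)"
      if [measurable]: "g \<in> borel_measurable iid_law" for g
      using \<rho>(2)[of "\<lambda>J. indicator C (shift D (\<lambda>e. - t e) J) * g J"]
        by (simp add: h_def inv mult.assoc)
    have "(\<lambda>n. \<integral>J. h J * replica_prod k f (G n J) \<partial>iid_law)
        \<longlonglongrightarrow> (\<integral>J. h J * u J \<partial>iid_law)"
      using stable_limit_replica_prod[OF V(1) f] h unfolding stable_limit_def u_def by auto
    then have "(\<lambda>n. \<integral>J. indicator C J * replica_prod k f (G n (shift D t J)) \<partial>iid_law)
        \<longlonglongrightarrow> (\<integral>J. indicator C J * u (shift D t J) \<partial>iid_law)"
      using fu by (subst (asm) (1 2) change) (auto simp: functional_def)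
    moreover have "\<forall>\<^sub>F n in sequentially. (\<integral>J. indicator C J * replica_prod k f (G n (shift D t J)) \<partial>iid_law)
        = (\<integral>J. indicator C J * tilted_prod k W t f (G n J) \<partial>iid_law)"
      using eventually_subset_box[OF V(2)] unfolding D_def
      by eventually_elim (simp add: replica_prod_gibbs_shift)
    ultimately have "(\<lambda>n. \<integral>J. indicator C J * tilted_prod k W t f (G n J) \<partial>iid_law)
        \<longlonglongrightarrow> (\<integral>J. indicator C J * u (shift D t J) \<partial>iid_law)"
      by (rule Lim_transform_eventually)
    moreover have "integrable iid_law (indicator C :: _ \<Rightarrow> real)"
      by (intro integrable_real_indicator) (simp_all add: P.emeasure_eq_measure)
    then have "(\<lambda>n. \<integral>J. indicator C J * tilted_prod k W t f (G n J) \<partial>iid_law) \<longlonglongrightarrow> (\<integral>J. indicator C J * v J \<partial>iid_law)"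
      using stable_limit_tilted_prod[OF V f] unfolding stable_limit_def v_def by auto
    ultimately show "(\<integral>J. indicator C J * u (shift D t J) \<partial>iid_law)
        = (\<integral>J. indicator C J * v J \<partial>iid_law)"
      by (rule LIMSEQ_unique)
  qed simp_all
  then show ?thesis by (simp add: u_def v_def D_def)
qed

text \<open>Translations of the infinite lattice, acting on edges and on couplings.\<close>

definition translate_edge :: "'d site \<Rightarrow> 'd edge \<Rightarrow> 'd edge" where
  "translate_edge z e = (\<lambda>x. x + z) ` e"

lemma translate_bond: "translate_edge z (bond x i) = bond (x + z) i"
  by (simp add: translate_edge_def bond_def algebra_simps)

lemma translate_translate: "translate_edge z (translate_edge w e) = translate_edge (w + z) e"
  by (simp add: translate_edge_def image_image add.assoc)

lemma translate_edges: "translate_edge z ` edges \<subseteq> edges"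
  by (auto simp: translate_bond elim!: edgeE)

lemma inj_translate: "inj_on (translate_edge z) edges"
proof (rule inj_onI)
  fix e e' :: "'d edge" assume "translate_edge z e = translate_edge z e'"
  then have "translate_edge (- z) (translate_edge z e) = translate_edge (- z) (translate_edge z e')"
    by simp
  then show "e = e'" unfolding translate_translate by (simp add: translate_edge_def)
qed

definition translate :: "'d site \<Rightarrow> 'd couplings \<Rightarrow> 'd couplings" where
  "translate z J = (\<lambda>e\<in>edges. J (translate_edge z e))"

lemma measurable_translate [measurable]: "translate z \<in> iid_law \<rightarrow>\<^sub>M iid_law"
  unfolding translate_def[abs_def] by (rule measurable_reindex[OF translate_edges])

lemma integral_translate:
  "g \<in> borel_measurable iid_law
      \<Longrightarrow> (\<integral>J. g (translate z J) \<partial>iid_law) = (\<integral>J. g J \<partial>iid_law)" for g :: "_ \<Rightarrow> real"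
  unfolding translate_def by (rule integral_reindex[OF inj_translate translate_edges])

lemma all_up_gibbs_torus:
  assumes "S \<subseteq> lattice_box (a n) (b n)" "(\<lambda>x. x + z) ` S \<subseteq> lattice_box (a n) (b n)"
  shows "(\<integral>\<sigma>. all_up S \<sigma> \<partial>G n (\<lambda>e\<in>edges. J (torus_edge (a n) (b n) z e))) = (\<integral>\<sigma>. all_up ((\<lambda>x. x + z) ` S) \<sigma> \<partial>G n J)"
proof -
  have "all_up S (\<lambda>x\<in>lattice_box (a n) (b n). \<sigma> (wrap (a n) (b n) (x + z)))
      = all_up ((\<lambda>x. x + z) ` S) \<sigma>" for \<sigma>
  proof -
    have "all_up ((\<lambda>x. x + z) ` S) \<sigma>
        = (\<Prod>x\<in>S. max 0 (min 1 (\<sigma> (x + z))))"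
      unfolding all_up_def by (subst prod.reindex) (auto simp: inj_on_def)
    also have "\<dots> = all_up S (\<lambda>x\<in>lattice_box (a n) (b n). \<sigma> (wrap (a n) (b n) (x + z)))"
      unfolding all_up_def
    proof (rule prod.cong[OF refl])
      fix x assume "x \<in> S"
      then have "x \<in> lattice_box (a n) (b n)" "x + z \<in> lattice_box (a n) (b n)"
        using assms by auto
      then show "max 0 (min 1 (\<sigma> (x + z))) =
          max 0 (min 1 ((\<lambda>x\<in>lattice_box (a n) (b n). \<sigma> (wrap (a n) (b n) (x + z))) x))"
        by (simp add: wrap_of_box)
    qed
    finally show ?thesis by simp
  qed
  then show ?thesis unfolding integral_gibbs_torus by simp
qed

text \<open>In finite volume the translation on the torus is an exact symmetry. For a fixed cylinder event and fixed
  observables it agrees with the translation of the lattice as soon as the box is large.\<close>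

lemma translation_covariance:
  assumes S: "\<And>i. S i \<subseteq> V" "finite V"
  shows "AE J in iid_law. (\<integral>\<Gamma>. replica_prod k (\<lambda>i. all_up (S i)) \<Gamma> \<partial>\<kappa> (translate z J))
    = (\<integral>\<Gamma>. replica_prod k (\<lambda>i. all_up ((\<lambda>x. x + z) ` S i)) \<Gamma> \<partial>\<kappa> J)"
proof -
  define V' where "V' = (\<lambda>x. x + z) ` V"
  have V': "finite V'" using S(2) by (simp add: V'_def)
  define f where "f i = all_up (S i)" for i
  define f' where "f' i = all_up ((\<lambda>x. x + z) ` S i)" for i
  have f: "f i \<in> local_obs V" "\<bar>f i \<sigma>\<bar> \<le> 1" for i \<sigma>
    unfolding f_def by (auto intro!: all_up_local_obs S all_up_bounds)
  have f': "f' i \<in> local_obs V'" "\<bar>f' i \<sigma>\<bar> \<le> 1" for i \<sigma>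
    unfolding f'_def V'_def by (auto intro!: all_up_local_obs image_mono S all_up_bounds)
  have fu: "functional (replica_prod k f) (1 ^ k)" by (rule functional_replica_prod[OF S(2) f])
  have fv: "functional (replica_prod k f') (1 ^ k)" by (rule functional_replica_prod[OF V' f'])
  define u where "u J = (\<integral>\<Gamma>. replica_prod k f \<Gamma> \<partial>\<kappa> J)" for J
  define v where "v J = (\<integral>\<Gamma>. replica_prod k f' \<Gamma> \<partial>\<kappa> J)" for J
  have um [measurable]: "u \<in> borel_measurable iid_law"
    unfolding u_def by (rule functional_\<kappa>(1)[OF fu])
  have vm [measurable]: "v \<in> borel_measurable iid_law"
    unfolding v_def by (rule functional_\<kappa>(1)[OF fv])
  have ub: "\<bar>u J\<bar> \<le> 1" if "J \<in> space iid_law" for J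
    using functional_\<kappa>(3)[OF fu that] by (simp add: u_def)
  have vb: "\<bar>v J\<bar> \<le> 1" if "J \<in> space iid_law" for J
    using functional_\<kappa>(3)[OF fv that] by (simp add: v_def)
  have "AE J in iid_law. u (translate z J) = v J"
  proof (rule P.AE_eq_of_integral_eq[OF _ _ _ _ closed_cylinders])
    show "\<bar>u (translate z J)\<bar> \<le> 1" if "J \<in> space iid_law" for J
      by (rule ub[OF measurable_space[OF measurable_translate that]])
    show "\<bar>v J\<bar> \<le> 1" if "J \<in> space iid_law" for J by (rule vb[OF that])
    fix C :: "'d couplings set" assume "C \<in> closed_cylinders"
    then obtain A F where C_def: "C
        = {J \<in> edges \<rightarrow>\<^sub>E UNIV. \<forall>e\<in>A. J e \<in> F e}" "finite A" "A \<subseteq> edges" "\<forall>e. closed (F e)"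
      unfolding closed_cylinders_def by blast
    have C [measurable]: "C \<in> sets iid_law"
      using \<open>C \<in> closed_cylinders\<close> closed_cylinders(4) by auto
    \<comment> \<open>A cylinder event that contains the translate of \<open>J\<close> exactly when \<open>C\<close> contains \<open>J\<close>.\<close>
    define C' where "C' = translate (- z) -` C \<inter> space iid_law"
    have C' [measurable]: "C' \<in> sets iid_law" unfolding C'_def by measurable
    have C'_iff: "J \<in> C' \<longleftrightarrow> J \<in> edges \<rightarrow>\<^sub>E UNIV \<and> (\<forall>e\<in>A. J (translate_edge (- z) e) \<in> F e)" for J
      using C_def(3) by (auto simp: C'_def C_def(1) translate_def space_iid)
    have tC: "(indicator C' (translate z J) :: real)
        = indicator C J" if J: "J \<in> space iid_law" for J
    proof -
      have "translate z J (translate_edge (- z) e) = J e" if "e \<in> A" for e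
      proof -
        have "translate_edge (- z) e \<in> edges" "e \<in> edges"
          using that C_def(3) translate_edges by auto
        then show ?thesis by (simp add: translate_def translate_translate) (simp add: translate_edge_def)
      qed
      then have "translate z J \<in> C' \<longleftrightarrow> J \<in> C"
        using J by (simp add: C'_iff C_def(1) space_iid) (simp add: translate_def)
      then show ?thesis by (simp add: indicator_def)
    qed
    have lim1: "(\<lambda>n. \<integral>J. indicator C' J * replica_prod k f (G n J) \<partial>iid_law) \<longlonglongrightarrow> (\<integral>J. indicator C' J * u J \<partial>iid_law)"
    proof -
      have "integrable iid_law (indicator C' :: _ \<Rightarrow> real)"
        by (intro integrable_real_indicator) (simp_all add: P.emeasure_eq_measure)
      then show ?thesis
        using stable_limit_replica_prod[OF S(2) f] unfolding stable_limit_def u_def by auto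
    qed
    have lim2: "(\<lambda>n. \<integral>J. indicator C J * replica_prod k f' (G n J) \<partial>iid_law) \<longlonglongrightarrow> (\<integral>J. indicator C J * v J \<partial>iid_law)"
    proof -
      have "integrable iid_law (indicator C :: _ \<Rightarrow> real)"
        by (intro integrable_real_indicator) (simp_all add: P.emeasure_eq_measure)
      then show ?thesis
        using stable_limit_replica_prod[OF V' f'] unfolding stable_limit_def v_def by auto
    qed
    \<comment> \<open>The finitely many sites that the box has to contain: those of the observables, before and after
      the translation, and the base points of the edges in \<open>A\<close>, before and after it.\<close>
    define X where "X = V \<union> V' \<union> {x. \<exists>i. bond x i \<in> A} \<union> (\<lambda>x. x + (- z)) ` {x. \<exists>i. bond x i \<in> A}"
    have "finite {x. \<exists>i. bond x i \<in> A}"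
    proof -
      have "{x. \<exists>i. bond x i \<in> A} \<subseteq> fst ` ((\<lambda>(x, i). bond x i) -` A)"
      proof
        fix x assume "x \<in> {x. \<exists>i. bond x i \<in> A}"
        then obtain i where "bond x i \<in> A" by auto
        then show "x \<in> fst ` ((\<lambda>(x, i). bond x i) -` A)"
          by (intro image_eqI[of _ _ "(x, i)"]) auto
      qed
      moreover have "finite ((\<lambda>(x, i). bond x i) -` A)"
        by (rule finite_vimageI[OF C_def(2) inj_bond])
      ultimately show ?thesis by (rule finite_subset[OF _ finite_imageI])
    qed
    then have X: "finite X" using V' S(2) by (simp add: X_def)
    have eq: "(\<integral>J. indicator C' J * replica_prod k f (G n J) \<partial>iid_law)
        = (\<integral>J. indicator C J * replica_prod k f' (G n J) \<partial>iid_law)"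
      if n: "X \<subseteq> lattice_box (a n) (b n)" for n
    proof -
      define T where "T J = (\<lambda>e\<in>edges. J (torus_edge (a n) (b n) z e))" for J :: "'d couplings"
      have "(\<integral>J. indicator C' J * replica_prod k f (G n J) \<partial>iid_law)
          = (\<integral>J. indicator C' (T J) * replica_prod k f (G n (T J)) \<partial>iid_law)"
        unfolding T_def
        by (rule integral_reindex[OF torus_edge_inj torus_edge_image, symmetric])
          (intro borel_measurable_times borel_measurable_indicator C', use fu in \<open>simp add: functional_def\<close>)
      also have "\<dots> = (\<integral>J. indicator C J * replica_prod k f' (G n J) \<partial>iid_law)"
      proof (rule Bochner_Integration.integral_cong[OF refl])
        fix J :: "'d couplings" assume J: "J \<in> space iid_law"
        have "T J (translate_edge (- z) e) = J e" if "e \<in> A" for e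
        proof -
          have "e \<in> edges" using that C_def(3) by auto
          then obtain x i where e: "e = bond x i" by (rule edgeE)
          have "x \<in> {x. \<exists>i. bond x i \<in> A}" using that e by auto
          then have "x \<in> X" "x + (- z) \<in> X" unfolding X_def by (blast, blast)
          then have "x \<in> lattice_box (a n) (b n)" "x + (- z) \<in> lattice_box (a n) (b n)"
            using n by auto
          then show ?thesis
            by (simp add: T_def e translate_bond torus_edge_bond wrap_of_box)
        qed
        then have "T J \<in> C' \<longleftrightarrow> J \<in> C"
          using J by (simp add: C'_iff C_def(1) space_iid) (simp add: T_def)
        moreover have "replica_prod k f (G n (T J)) = replica_prod k f' (G n J)"
          unfolding replica_prod_def T_def f_def f'_def
        proof (intro prod.cong refl all_up_gibbs_torus)
          fix i
          have "S i \<subseteq> X" "(\<lambda>x. x + z) ` S i \<subseteq> X"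
            using S(1)[of i] unfolding X_def V'_def by blast+
          then show "S i \<subseteq> lattice_box (a n) (b n)" "(\<lambda>x. x + z) ` S i \<subseteq> lattice_box (a n) (b n)"
            using n by auto
        qed
        ultimately show "indicator C' (T J) * replica_prod k f (G n (T J))
            = indicator C J * replica_prod k f' (G n J)"
          by (simp add: indicator_def)
      qed
      finally show ?thesis .
    qed
    have "(\<integral>J. indicator C J * u (translate z J) \<partial>iid_law)
        = (\<integral>J. indicator C' (translate z J) * u (translate z J) \<partial>iid_law)"
      by (intro Bochner_Integration.integral_cong refl) (simp add: tC)
    also have "\<dots> = (\<integral>J. indicator C' J * u J \<partial>iid_law)"
      by (rule integral_translate) measurable
    also have "\<dots> = (\<integral>J. indicator C J * v J \<partial>iid_law)"
    proof (rule LIMSEQ_unique[OF lim1])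
      show "(\<lambda>n. \<integral>J. indicator C' J * replica_prod k f (G n J) \<partial>iid_law)
          \<longlonglongrightarrow> (\<integral>J. indicator C J * v J \<partial>iid_law)"
        using lim2 by (rule Lim_transform_eventually)
          (use eventually_subset_box[OF X] eq in \<open>auto elim!: eventually_mono\<close>)
    qed
    finally show "(\<integral>J. indicator C J * u (translate z J) \<partial>iid_law)
        = (\<integral>J. indicator C J * v J \<partial>iid_law)" .
  qed simp_all
  then show ?thesis by (simp add: u_def v_def f_def[abs_def] f'_def[abs_def])
qed

end


section \<open>Translation invariance of the edge overlap\<close>

lemma edges_in_cube: "edges_in (cube n)
    = (\<Union>i. (\<lambda>x. bond x i) ` lattice_box (\<chi> j. - int n) ((\<chi> j. int n) - axis i 1))"
proof (intro equalityI subsetI)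
  fix e :: "'a edge" assume e: "e \<in> edges_in (cube n)"
  then obtain x i where xi: "e = bond x i" by (auto simp: edges_in_def elim: edgeE)
  have "x \<in> cube n" "x + axis i 1 \<in> cube n" using e by (auto simp: edges_in_def xi bond_def)
  then have "x \<in> lattice_box (\<chi> j. - int n) ((\<chi> j. int n) - axis i 1)"
    by (auto simp: cube_def lattice_box_def axis_def algebra_simps)
  then show "e \<in> (\<Union>i. (\<lambda>x. bond x i) ` lattice_box (\<chi> j. - int n) ((\<chi> j. int n) - axis i 1))"
    using xi by auto
next
  fix e :: "'a edge" assume "e \<in> (\<Union>i. (\<lambda>x. bond x i) ` lattice_box (\<chi> j. - int n) ((\<chi> j. int n) - axis i 1))"
  then obtain x i where xi: "e = bond x i" "x \<in> lattice_box (\<chi> j. - int n) ((\<chi> j. int n) - axis i 1)" by auto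
  have "x \<in> cube n \<and> x + axis i 1 \<in> cube n"
    unfolding cube_def lattice_box_def
  proof (intro conjI CollectI allI)
    fix j
    have "- int n \<le> x $ j" "x $ j \<le> int n - axis i 1 $ j"
      using xi(2) by (auto simp: lattice_box_def)
    moreover have "(0::int) \<le> axis i 1 $ j" by (simp add: axis_def)
    ultimately show "(\<chi> j. - int n) $ j \<le> x $ j" "x $ j \<le> (\<chi> j. int n) $ j"
      "(\<chi> j. - int n) $ j \<le> (x + axis i 1) $ j" "(x + axis i 1) $ j
          \<le> (\<chi> j. int n) $ j" by auto
  qed
  then show "e \<in> edges_in (cube n)" by (auto simp: edges_in_def xi(1)) (auto simp: bond_def)
qed

lemma finite_cube [simp]: "finite (cube n)"
  by (simp add: cube_def)

lemma card_cube_edges: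
  "card (edges_in (cube n) :: ('d::finite) edge set)
      = CARD('d) * (2 * n * (2 * n + 1) ^ (CARD('d) - 1))"
proof -
  have box: "card (lattice_box (\<chi> j. - int n) ((\<chi> j. int n) - axis i 1) :: 'd site set)
      = 2 * n * (2 * n + 1) ^ (CARD('d) - 1)" for i
  proof -
    have "card (lattice_box (\<chi> j. - int n) ((\<chi> j. int n) - axis i 1) :: 'd site set)
        = (\<Prod>j\<in>UNIV. if j = i then 2 * n else 2 * n + 1)"
      unfolding card_lattice_box by (intro prod.cong refl) (auto simp: axis_def)
    also have "\<dots> = 2 * n * (\<Prod>j\<in>UNIV - {i}. if j = i then 2 * n else 2 * n + 1)"
      by (subst prod.remove[of UNIV i]) auto
    also have "(\<Prod>j\<in>UNIV - {i}. if j = i then 2 * n else 2 * n + 1)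
        = (\<Prod>j\<in>UNIV - {i}. 2 * n + 1)"
      by (rule prod.cong) auto
    finally show ?thesis by (simp add: card_Diff_singleton)
  qed
  have "card (edges_in (cube n) :: 'd edge set) =
      (\<Sum>i\<in>UNIV. card ((\<lambda>x. bond x i) ` (lattice_box (\<chi> j. - int n) ((\<chi> j. int n) - axis i 1) :: 'd site set)))"
    unfolding edges_in_cube by (rule card_UN_disjoint) (auto simp: bond_inject)
  also have "\<dots> = (\<Sum>i\<in>(UNIV :: 'd set). 2 * n * (2 * n + 1) ^ (CARD('d) - 1))"
  proof (rule sum.cong[OF refl])
    fix i :: 'd
    have "inj_on (\<lambda>x. bond x i) (lattice_box (\<chi> j. - int n) ((\<chi> j. int n) - axis i 1))"
      by (rule inj_onI) (simp add: bond_inject)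
    then show "card ((\<lambda>x. bond x i) ` (lattice_box (\<chi> j. - int n) ((\<chi> j. int n) - axis i 1) :: 'd site set))
        = 2 * n * (2 * n + 1) ^ (CARD('d) - 1)"
      by (simp add: card_image box del: mult_Suc_right)
  qed
  finally show ?thesis by simp
qed

lemma card_cube_edges_ratio:
  "(\<lambda>n. real (card (edges_in (cube (n + m)) :: ('d::finite) edge set)) / real (card (edges_in (cube n) :: 'd edge set))) \<longlonglongrightarrow> 1"
proof -
  have "(\<lambda>n. (1 + real m / real n) * (1 + 2 * real m / real (2 * n + 1)) ^ (CARD('d) - 1))
      \<longlonglongrightarrow> (1 + 0) * (1 + 0) ^ (CARD('d) - 1)"
  proof -
    have 1: "(\<lambda>n. real m / real n) \<longlonglongrightarrow> 0" by (rule lim_const_over_n)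
    have "strict_mono (\<lambda>n::nat. 2 * n + 1)" by (simp add: strict_mono_def)
    from LIMSEQ_subseq_LIMSEQ[OF lim_const_over_n[of "2 * real m"] this]
    have 2: "(\<lambda>n. 2 * real m / real (2 * n + 1)) \<longlonglongrightarrow> 0"
      by (simp add: o_def)
    show ?thesis
      by (rule tendsto_mult[OF tendsto_add[OF tendsto_const 1] tendsto_power[OF tendsto_add[OF tendsto_const 2]]])
  qed
  moreover have "\<forall>\<^sub>F n in sequentially. (1 + real m / real n) * (1 + 2 * real m / real (2 * n + 1)) ^ (CARD('d) - 1)
      = real (card (edges_in (cube (n + m)) :: 'd edge set)) / real (card (edges_in (cube n) :: 'd edge set))"
  proof (rule eventually_sequentiallyI[of 1])
    fix n :: nat assume n: "1 \<le> n"
    have 1: "1 + real m / real n = real (n + m) / real n" using n by (simp add: field_simps)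
    have 2: "1 + 2 * real m / real (2 * n + 1) = real (2 * (n + m) + 1) / real (2 * n + 1)"
      by (simp add: field_simps)
    show "(1 + real m / real n) * (1 + 2 * real m / real (2 * n + 1)) ^ (CARD('d) - 1)
      = real (card (edges_in (cube (n + m)) :: 'd edge set)) / real (card (edges_in (cube n) :: 'd edge set))"
    proof -
      define p where "p k = real (2 * k + 1) ^ (CARD('d) - 1)" for k
      have c: "real (card (edges_in (cube k) :: 'd edge set))
          = 2 * real CARD('d) * (real k * p k)" for k
        unfolding card_cube_edges p_def by (simp add: add.commute)
      have "(real (2 * (n + m) + 1) / real (2 * n + 1)) ^ (CARD('d) - 1) = p (n + m) / p n"
        unfolding power_divide p_def ..
      then show ?thesis unfolding 1 2 c by simp
    qed
  qed
  ultimately show ?thesis by (auto intro: Lim_transform_eventually)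
qed

lemma lim_eqI: "(\<And>L. X \<longlonglongrightarrow> L \<longleftrightarrow> Y \<longlonglongrightarrow> L) \<Longrightarrow> lim X = lim Y"
  unfolding lim_def by simp

text \<open>The two sums over the edges of a cube differ only at the boundary, so that the averages have the same
  limit points. In particular the two limits exist simultaneously, and where they do not, both sides are
  the same unspecified constant.\<close>

lemma edge_overlap_translate:
  fixes \<sigma> \<sigma>' :: "('d::finite) config"
  assumes \<sigma>: "\<And>x. \<sigma> x \<in> {-1, 1}" "\<And>x. \<sigma>' x \<in> {-1, 1}"
  shows "edge_overlap (\<lambda>x. \<sigma> (x + z)) (\<lambda>x. \<sigma>' (x + z))
      = edge_overlap \<sigma> \<sigma>'"
proof -
  define E :: "nat \<Rightarrow> 'd edge set" where "E n = edges_in (cube n)" for n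
  define q where "q e = (\<Prod>x\<in>e. \<sigma> x) * (\<Prod>x\<in>e. \<sigma>' x)" for e
  define T where "T e = (\<lambda>x. x + z) ` e" for e
  \<comment> \<open>The translate of a cube of radius \<open>n\<close> by \<open>z\<close> is contained in the cube of radius \<open>n + m\<close>.\<close>
  define m where "m = nat (\<Sum>i\<in>UNIV. \<bar>z $ i\<bar>)"
  have m: "\<bar>z $ i\<bar> \<le> int m" for i
    using member_le_sum[of i UNIV "\<lambda>i. \<bar>z $ i\<bar>"]
      unfolding m_def by (simp add: sum_nonneg)
  have T_bond: "T (bond x i) = bond (x + z) i" for x i by (simp add: T_def bond_def algebra_simps)
  have T_inj: "inj_on T (E n)" for n
    by (rule inj_onI) (auto simp: E_def edges_in_def T_bond bond_inject elim!: edgeE)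
  have fin: "finite (E n)" for n unfolding E_def by (simp add: finite_edges_in)
  have sub: "E n \<subseteq> E (n + m)" for n
    unfolding E_def edges_in_def cube_def lattice_box_def
      by (auto simp: subset_iff) (smt (verit) of_nat_0_le_iff)+
  have T_sub: "T ` E n \<subseteq> E (n + m)" for n
  proof
    fix e assume "e \<in> T ` E n"
    then obtain e' where e': "e' \<in> E n" "e = T e'" by auto
    then obtain x i where xi: "e' = bond x i" by (auto simp: E_def edges_in_def elim: edgeE)
    have "y + z \<in> cube (n + m)" if "y \<in> cube n" for y
      unfolding cube_def lattice_box_def
    proof (intro CollectI allI)
      fix j
      have "- int n \<le> y $ j" "y $ j \<le> int n" using that by (auto simp: cube_def lattice_box_def)
      then show "(\<chi> i. - int (n + m)) $ j \<le> (y + z) $ j \<and> (y + z) $ j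
          \<le> (\<chi> i. int (n + m)) $ j"
        using m[of j] by auto
    qed
    then have "T e' \<subseteq> cube (n + m)" using e'(1) by (auto simp: T_def E_def edges_in_def)
    moreover have "T e' \<in> edges" by (simp add: xi T_bond)
    ultimately show "e \<in> E (n + m)" by (simp add: E_def edges_in_def e'(2))
  qed
  have abs_prod_1: "\<bar>\<Prod>x\<in>e. \<tau> x\<bar> = 1"
    if "\<And>x. \<tau> x \<in> {-1, 1}" for e and \<tau> :: "'d config"
    unfolding abs_prod
  proof (intro prod.neutral ballI)
    fix x show "\<bar>\<tau> x\<bar> = 1" using that[of x] by auto
  qed
  have q1: "\<bar>q e\<bar> = 1" for e unfolding q_def abs_mult using abs_prod_1 \<sigma> by simp
  have est: "\<bar>sum q (E (n + m)) - sum q B\<bar> \<le> real (card (E (n + m))) - real (card B)"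
    if "B \<subseteq> E (n + m)" for n B
  proof -
    have "\<bar>sum q (E (n + m)) - sum q B\<bar> = \<bar>sum q (E (n + m) - B)\<bar>"
      using that fin by (subst sum_diff) auto
    also have "\<dots> \<le> (\<Sum>e\<in>E (n + m) - B. \<bar>q e\<bar>)" by (rule sum_abs)
    also have "\<dots> = real (card (E (n + m) - B))" by (simp add: q1)
    also have "\<dots> = real (card (E (n + m))) - real (card B)"
      using that fin by (simp add: card_Diff_subset finite_subset card_mono of_nat_diff)
    finally show ?thesis .
  qed
  define X where "X n = sum q (E n) / real (card (E n))" for n
  define Y where "Y n = sum q (T ` E n) / real (card (E n))" for n
  have diff: "\<bar>Y n - X n\<bar> \<le> 2 * (real (card (E (n + m))) / real (card (E n)) - 1)"
    if "n \<ge> 1" for n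
  proof -
    have pos: "real (card (E n)) > 0" using that unfolding E_def card_cube_edges by simp
    have "\<bar>sum q (T ` E n) - sum q (E n)\<bar>
        \<le> 2 * (real (card (E (n + m))) - real (card (E n)))"
      using est[OF sub] est[OF T_sub] card_image[OF T_inj] by (simp add: abs_le_iff) (smt (verit))
    then have "\<bar>sum q (T ` E n) - sum q (E n)\<bar> / real (card (E n))
        \<le> 2 * (real (card (E (n + m))) - real (card (E n))) / real (card (E n))"
      using pos by (intro divide_right_mono) auto
    then show ?thesis
      using pos by (simp add: X_def Y_def diff_divide_distrib[symmetric] abs_divide field_simps)
  qed
  have XY: "(\<lambda>n. Y n - X n) \<longlonglongrightarrow> 0"
  proof (rule Lim_null_comparison)
    show "\<forall>\<^sub>F n in sequentially. norm (Y n - X n)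
        \<le> 2 * (real (card (E (n + m))) / real (card (E n)) - 1)"
      using diff by (intro eventually_sequentiallyI[of 1]) auto
    have "(\<lambda>n. 2 * (real (card (E (n + m))) / real (card (E n)) - 1))
        \<longlonglongrightarrow> 2 * (1 - 1)"
      unfolding E_def by (intro tendsto_intros card_cube_edges_ratio)
    then show "(\<lambda>n. 2 * (real (card (E (n + m))) / real (card (E n)) - 1))
        \<longlonglongrightarrow> 0" by simp
  qed
  have "lim Y = lim X"
  proof (rule lim_eqI)
    fix L
    show "Y \<longlonglongrightarrow> L \<longleftrightarrow> X \<longlonglongrightarrow> L"
    proof
      assume "Y \<longlonglongrightarrow> L"
      from tendsto_diff[OF this XY] show "X \<longlonglongrightarrow> L" by simp
    next
      assume "X \<longlonglongrightarrow> L"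
      from tendsto_add[OF this XY] show "Y \<longlonglongrightarrow> L" by simp
    qed
  qed
  moreover have "edge_overlap (\<lambda>x. \<sigma> (x + z)) (\<lambda>x. \<sigma>' (x + z)) = lim Y"
  proof -
    have prodT: "(\<Prod>x\<in>e. \<tau> (x + z)) = (\<Prod>x\<in>T e. \<tau> x)" for e
      and \<tau> :: "'d config"
      unfolding T_def by (subst prod.reindex) (auto simp: inj_on_def)
    have "(\<Sum>e\<in>E n. (\<Prod>x\<in>e. \<sigma> (x + z)) * (\<Prod>x\<in>e. \<sigma>' (x + z))) = sum q (T ` E n)" for n
      by (subst sum.reindex[OF T_inj]) (simp add: q_def prodT)
    then show ?thesis unfolding edge_overlap_def Y_def E_def by simp
  qed
  moreover have "edge_overlap \<sigma> \<sigma>' = lim X"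
    unfolding edge_overlap_def X_def E_def q_def ..
  ultimately show ?thesis by simp
qed

section \<open>The space of replicas\<close>

lemma space_replica: "\<sigma> \<in> space replica_space \<Longrightarrow> \<sigma> i x \<in> {-1, 1}"
  by (auto simp: space_PiM spin_space_def PiE_iff)

lemma space_replica_eq: "space replica_space = {\<sigma>. \<forall>i x. \<sigma> i x \<in> {-1, 1}}"
  by (auto simp: space_PiM spin_space_def PiE_iff)

lemma measurable_spin: "(\<lambda>\<sigma>. \<sigma> i x) \<in> replica_space \<rightarrow>\<^sub>M count_space {-1, 1}"
  unfolding spin_space_def
  by (rule measurable_compose[OF measurable_component_singleton[of i] measurable_component_singleton[of x]]) auto

lemma measurable_spin_borel [measurable]: "(\<lambda>\<sigma>. \<sigma> i x) \<in> borel_measurable replica_space"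
  by (rule measurable_compose[OF measurable_spin]) simp

lemma measurable_edge_overlap [measurable]:
  "(\<lambda>\<sigma>. edge_overlap (\<sigma> i) (\<sigma> j)) \<in> borel_measurable replica_space"
  unfolding edge_overlap_def by (intro borel_measurable_lim_metric) measurable

text \<open>The matrix of overlaps whose law is the random overlap structure.\<close>

definition overlap_matrix :: "(nat \<Rightarrow> ('d::finite) config) \<Rightarrow> nat \<times> nat \<Rightarrow> real" where
  "overlap_matrix \<sigma> = (\<lambda>(i, j). if i = j then 1 else edge_overlap (\<sigma> i) (\<sigma> j))"

lemma measurable_overlap_matrix: "overlap_matrix \<in> replica_space \<rightarrow>\<^sub>M overlap_space"
proof (rule measurable_PiM_single')
  show "(\<lambda>\<sigma>. overlap_matrix \<sigma> p) \<in> borel_measurable replica_space" for p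
    unfolding overlap_matrix_def by (cases p) simp
qed (auto simp: space_PiM)

lemma rost_law_eq: "rost_law K = distr (mixture K) overlap_space overlap_matrix"
  unfolding rost_law_def overlap_matrix_def[abs_def] ..

text \<open>A countable generator of the \<open>\<sigma>\<close>-algebra on sequences of replicas.\<close>

definition up_events :: "(nat \<Rightarrow> ('d::finite) config) set set" where
  "up_events = range (\<lambda>(i, x). {\<sigma> \<in> space replica_space. \<sigma> i x = 1})"

lemma countable_up_events: "countable up_events"
  unfolding up_events_def by simp

lemma up_events_Pow: "up_events \<subseteq> Pow (space replica_space)"
  unfolding up_events_def by auto

lemma sets_replica_space: "sets replica_space
    = sigma_sets (space replica_space) (up_events :: (nat \<Rightarrow> ('d::finite) config) set set)"
proof (rule antisym)
  show "sigma_sets (space replica_space) (up_events :: (nat \<Rightarrow> 'd config) set set) \<subseteq> sets replica_space"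
  proof (rule sets.sigma_sets_subset, unfold up_events_def, clarify)
    fix i and x :: "'d site"
    show "{\<sigma> \<in> space replica_space. \<sigma> i x = 1} \<in> sets replica_space" by measurable
  qed
  define M where "M = sigma (space replica_space) (up_events :: (nat \<Rightarrow> 'd config) set set)"
  have M: "space M = space replica_space" "sets M = sigma_sets (space replica_space) up_events"
    unfolding M_def by (rule space_measure_of[OF up_events_Pow], rule sets_measure_of[OF up_events_Pow])
  have up: "{\<sigma> \<in> space M. \<sigma> i x = 1} \<in> sets M" for i x
    unfolding M by (rule sigma_sets.Basic) (auto simp: up_events_def)
  have spin: "(\<lambda>\<sigma>. \<sigma> i x) \<in> M \<rightarrow>\<^sub>M count_space {-1, 1}" for i x
  proof (subst measurable_count_space_eq2, simp, intro conjI ballI)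
    show "(\<lambda>\<sigma>. \<sigma> i x) \<in> space M \<rightarrow> {- 1, 1}"
      using space_replica by (auto simp: M)
    fix s :: real assume "s \<in> {- 1, 1}"
    then consider "s = 1" | "s = -1" by auto
    then show "(\<lambda>\<sigma>. \<sigma> i x) -` {s} \<inter> space M \<in> sets M"
    proof cases
      case 1
      have "(\<lambda>\<sigma>. \<sigma> i x) -` {s} \<inter> space M
          = {\<sigma> \<in> space M. \<sigma> i x = 1}" using 1 by auto
      then show ?thesis using up by simp
    next
      case 2
      have "(\<lambda>\<sigma>. \<sigma> i x) -` {s} \<inter> space M
          = space M - {\<sigma> \<in> space M. \<sigma> i x = 1}"
        using 2 space_replica by (fastforce simp: M)
      then show ?thesis using up by simp
    qed
  qed
  have "(\<lambda>\<sigma>. \<sigma>) \<in> M \<rightarrow>\<^sub>M replica_space"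
  proof (rule measurable_PiM_single')
    fix i :: nat
    show "(\<lambda>\<sigma>. \<sigma> i) \<in> M \<rightarrow>\<^sub>M spin_space UNIV"
      unfolding spin_space_def
    proof (rule measurable_PiM_single')
      show "(\<lambda>\<sigma>. \<sigma> i) \<in> space M \<rightarrow> UNIV \<rightarrow>\<^sub>E space (count_space {-1, 1})"
        unfolding M(1) PiE_UNIV_domain space_count_space
        by (intro Pi_I space_replica)
    qed (rule spin)
  qed (auto simp: M space_PiM)
  then show "sets replica_space \<subseteq> sigma_sets (space replica_space) (up_events :: (nat \<Rightarrow> 'd config) set set)"
    using measurable_sets[of "\<lambda>\<sigma>. \<sigma>" M replica_space] sets.sets_into_space[of _ "replica_space"]
    unfolding M(2)[symmetric] by (auto simp: M(1) Int_absorb2)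
qed

lemma mixture_prob:
  assumes "K \<in> space (prob_algebra state_space)"
  shows "prob_space (mixture K)" "sets (mixture K) = sets replica_space" "space (mixture K)
      = space replica_space"
  using measurable_space[OF measurable_mixture assms]
    by (auto simp: space_prob_algebra dest: sets_eq_imp_space_eq)

lemma measure_mixture_up:
  assumes K: "K \<in> space (prob_algebra state_space)"
    and S: "finite S" "\<And>i x. (i, x) \<in> S \<Longrightarrow> i < k"
  shows "measure (mixture K) {\<sigma> \<in> space replica_space. \<forall>(i, x)\<in>S. \<sigma> i x = 1}
    = (\<integral>\<Gamma>. replica_prod k (\<lambda>i. all_up {x. (i, x) \<in> S}) \<Gamma> \<partial>K)"
proof -
  interpret M: prob_space "mixture K" by (rule mixture_prob[OF K])
  have K': "space K = space state_space"
    using K by (auto simp: space_prob_algebra dest: sets_eq_imp_space_eq)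
  define V where "V = snd ` S"
  have V: "finite V" "{x. (i, x) \<in> S} \<subseteq> V" for i
    using S(1) by (auto simp: V_def intro: rev_image_eqI)
  have fin: "finite {x. (i, x) \<in> S}" for i using V by (rule finite_subset[rotated])
  have obs: "all_up {x. (i, x) \<in> S} \<in> borel_measurable (spin_space UNIV)" for i
    by (rule measurable_local_obs[OF V(1) all_up_local_obs[OF V(2)]])
  have meas: "(\<lambda>\<sigma>. \<Prod>i<k. all_up {x. (i, x) \<in> S} (\<sigma> i)) \<in> borel_measurable replica_space"
  proof (rule borel_measurable_prod)
    fix i
    show "(\<lambda>\<sigma>. all_up {x. (i, x) \<in> S} (\<sigma> i)) \<in> borel_measurable replica_space"
      using measurable_compose[OF measurable_component_singleton[of i UNIV "\<lambda>_. spin_space UNIV"] obs[of i]] by simp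
  qed
  have ind: "(\<Prod>i<k. all_up {x. (i, x) \<in> S} (\<sigma> i))
      = indicator {\<sigma> \<in> space replica_space. \<forall>(i, x)\<in>S. \<sigma> i x = 1} \<sigma>"
    if \<sigma>: "\<sigma> \<in> space replica_space" for \<sigma>
  proof (cases "\<forall>(i, x)\<in>S. \<sigma> i x = 1")
    case True
    then have "all_up {x. (i, x) \<in> S} (\<sigma> i) = 1" for i
      by (auto simp: all_up_def intro!: prod.neutral)
    then show ?thesis using True \<sigma> by simp
  next
    case False
    then obtain i x where ix: "(i, x) \<in> S" "\<sigma> i x \<noteq> 1" by auto
    then have "\<sigma> i x = -1" using space_replica[OF \<sigma>, of i x] by auto
    then have "all_up {x. (i, x) \<in> S} (\<sigma> i) = 0"
      unfolding all_up_def using fin ix(1) by (intro prod_zero bexI[of _ x]) auto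
    then have "(\<Prod>i<k. all_up {x. (i, x) \<in> S} (\<sigma> i)) = 0"
      using S(2)[OF ix(1)] by (intro prod_zero) auto
    moreover have "\<sigma> \<notin> {\<sigma> \<in> space replica_space. \<forall>(i, x)\<in>S. \<sigma> i x = 1}" using False by blast
    then have "indicator {\<sigma> \<in> space replica_space. \<forall>(i, x)\<in>S. \<sigma> i x = 1} \<sigma> = (0 :: real)"
      by (rule indicator_simps(2))
    ultimately show ?thesis by (rule trans[OF _ sym])
  qed
  have "measure (mixture K) {\<sigma> \<in> space replica_space. \<forall>(i, x)\<in>S. \<sigma> i x = 1}
      = (\<integral>\<sigma>. indicator {\<sigma> \<in> space replica_space. \<forall>(i, x)\<in>S. \<sigma> i x = 1} \<sigma> \<partial>mixture K)"
  proof -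
    have "{\<sigma> \<in> space replica_space. \<forall>(i, x)\<in>S. \<sigma> i x = 1} \<inter> space (mixture K)
        = {\<sigma> \<in> space replica_space. \<forall>(i, x)\<in>S. \<sigma> i x = 1}"
      unfolding mixture_prob(3)[OF K] by (rule Int_absorb2) (rule Collect_subset)
    then show ?thesis by (simp only: Bochner_Integration.integral_indicator)
  qed
  also have "\<dots> = (\<integral>\<sigma>. (\<Prod>i<k. all_up {x. (i, x) \<in> S} (\<sigma> i)) \<partial>mixture K)"
    by (intro Bochner_Integration.integral_cong refl) (simp add: ind mixture_prob(3)[OF K])
  also have "\<dots> = (\<integral>\<Gamma>. \<integral>\<sigma>. (\<Prod>i<k. all_up {x. (i, x) \<in> S} (\<sigma> i)) \<partial>PiM UNIV (\<lambda>_. \<Gamma>) \<partial>K)"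
    by (rule integral_mixture[OF K meas, where B = 1]) (simp add: abs_prod prod_le_1 all_up_bounds)
  also have "\<dots> = (\<integral>\<Gamma>. replica_prod k (\<lambda>i. all_up {x. (i, x) \<in> S}) \<Gamma> \<partial>K)"
  proof (rule Bochner_Integration.integral_cong[OF refl])
    fix \<Gamma> assume "\<Gamma> \<in> space K"
    then have \<Gamma>: "prob_space \<Gamma>" "sets \<Gamma> = sets (spin_space UNIV)"
      by (auto simp: K' space_prob_algebra)
    show "(\<integral>\<sigma>. (\<Prod>i<k. all_up {x. (i, x) \<in> S} (\<sigma> i)) \<partial>PiM UNIV (\<lambda>_. \<Gamma>)) = replica_prod k (\<lambda>i. all_up {x. (i, x) \<in> S}) \<Gamma>"
      unfolding replica_prod_def
      by (rule integral_prod_replicas[OF \<Gamma>(1), where B = 1])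
        (use obs \<Gamma>(2) in \<open>auto simp: all_up_bounds cong: measurable_cong_sets\<close>)
  qed
  finally show ?thesis .
qed

lemma finite_up_events_Inter:
  assumes "finite D" "D \<subseteq> up_events"
  obtains S :: "(nat \<times> ('d::finite) site) set"
    and k where "finite S" "\<And>i x. (i, x) \<in> S \<Longrightarrow> i < k"
    "space replica_space \<inter> \<Inter>D
        = {\<sigma> \<in> space replica_space. \<forall>(i, x)\<in>S. \<sigma> i x = 1}"
proof -
  obtain S where S: "finite S" "D
      = (\<lambda>(i, x). {\<sigma> \<in> space replica_space. \<sigma> i x = 1}) ` S"
    using finite_subset_image[OF assms(1) assms(2)[unfolded up_events_def]]
      by (elim exE conjE) (rule that)
  show ?thesis
  proof (rule that[of S "Suc (Max (fst ` S))"])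
    show "i < Suc (Max (fst ` S))" if "(i, x) \<in> S" for i x
      using that S(1) by (intro le_imp_less_Suc Max_ge) (auto intro: rev_image_eqI)
    show "space replica_space \<inter> \<Inter>D
        = {\<sigma> \<in> space replica_space. \<forall>(i, x)\<in>S. \<sigma> i x = 1}"
      unfolding S(2) by auto
  qed (rule S)
qed


section \<open>The law of the overlaps is almost surely constant\<close>

lemma AE_mixture_eqI:
  fixes K1 K2 :: "'x \<Rightarrow> ('d::finite) config measure measure"
  assumes K1: "\<And>x. x \<in> space M \<Longrightarrow> K1 x \<in> space (prob_algebra state_space)"
    and K2: "\<And>x. x \<in> space M \<Longrightarrow> K2 x \<in> space (prob_algebra state_space)"
    and eq: "\<And>S :: (nat \<times> 'd site) set. \<And>k. finite S \<Longrightarrow> AE x in M.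
      (\<integral>\<Gamma>. replica_prod k (\<lambda>i. all_up {x. (i, x) \<in> S}) \<Gamma> \<partial>K1 x) = (\<integral>\<Gamma>. replica_prod k (\<lambda>i. all_up {x. (i, x) \<in> S}) \<Gamma> \<partial>K2 x)"
  shows "AE x in M. mixture (K1 x) = mixture (K2 x)"
proof (rule AE_measure_eqI_countable_generator[OF countable_up_events up_events_Pow])
  show "prob_space (mixture (K1 x)) \<and> sets (mixture (K1 x))
      = sigma_sets (space replica_space) up_events" if "x \<in> space M" for x
    using mixture_prob[OF K1[OF that]] by (simp add: sets_replica_space)
  show "prob_space (mixture (K2 x)) \<and> sets (mixture (K2 x))
      = sigma_sets (space replica_space) up_events" if "x \<in> space M" for x
    using mixture_prob[OF K2[OF that]] by (simp add: sets_replica_space)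
  fix D :: "(nat \<Rightarrow> 'd config) set set" assume D: "finite D" "D \<subseteq> up_events"
  obtain S k where S: "finite S" "\<And>i x. (i, x) \<in> S \<Longrightarrow> i < k"
    "space replica_space \<inter> \<Inter>D
        = {\<sigma> \<in> space replica_space. \<forall>(i, x)\<in>S. \<sigma> i x = 1}"
    by (rule finite_up_events_Inter[OF D]) blast
  show "AE x in M. measure (mixture (K1 x)) (space replica_space \<inter> \<Inter>D)
      = measure (mixture (K2 x)) (space replica_space \<inter> \<Inter>D)"
    using eq[OF S(1), of k]
    by (rule AE_mp, intro AE_I2 impI) (simp add: S(3) measure_mixture_up[OF K1 S(1,2)] measure_mixture_up[OF K2 S(1,2)])
qed

text \<open>A countable generator of the \<open>\<sigma>\<close>-algebra on matrices of overlaps.\<close>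

definition rational_events :: "(nat \<times> nat \<Rightarrow> real) set set" where
  "rational_events = (\<lambda>(p, r). {q. q p \<le> r}) ` (UNIV \<times> \<rat>)"

lemma countable_rational_events: "countable rational_events"
  unfolding rational_events_def by (intro countable_image countable_SIGMA countable_rat) auto

lemma sets_overlap_space: "sets overlap_space = sigma_sets UNIV rational_events"
proof (rule antisym)
  show "sigma_sets UNIV rational_events \<subseteq> sets overlap_space"
  proof -
    have "{q. q p \<le> r} \<in> sets overlap_space" for p r
    proof -
      have "{q \<in> space overlap_space. q p \<le> r} \<in> sets overlap_space"
        by measurable
      then show ?thesis by (simp add: space_PiM)
    qed
    then have "rational_events \<subseteq> sets overlap_space"
      by (auto simp: rational_events_def)
    from sets.sigma_sets_subset[OF this] show ?thesis by (simp add: space_PiM)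
  qed
  define M where "M = sigma UNIV rational_events"
  have M: "space M = UNIV" "sets M = sigma_sets UNIV rational_events" by (simp_all add: M_def)
  have "(\<lambda>q. q) \<in> M \<rightarrow>\<^sub>M overlap_space"
  proof (rule measurable_PiM_single')
    fix p :: "nat \<times> nat"
    show "(\<lambda>q. q p) \<in> borel_measurable M"
      unfolding borel_measurable_iff_less
    proof
      fix y :: real
      have "{w \<in> space M. w p < y} = (\<Union>r\<in>{r\<in>\<rat>. r < y}. {q. q p \<le> r})"
      proof (intro equalityI subsetI)
        fix w assume "w \<in> {w \<in> space M. w p < y}"
        then have "w p < y" by simp
        then obtain r where "w p < of_rat r" "of_rat r < y" using of_rat_dense by blast
        then show "w \<in> (\<Union>r\<in>{r\<in>\<rat>. r < y}. {q. q p \<le> r})"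
          by (intro UN_I[of "of_rat r"]) auto
      qed (auto simp: M)
      also have "\<dots> \<in> sets M"
      proof (rule sets.countable_UN')
        show "countable {r\<in>\<rat>. r < y}"
          using countable_rat by (rule countable_subset[rotated]) auto
        show "(\<lambda>r. {q. q p \<le> r}) ` {r\<in>\<rat>. r < y} \<subseteq> sets M"
          unfolding M by (auto intro!: sigma_sets.Basic simp: rational_events_def)
      qed
      finally show "{w \<in> space M. w p < y} \<in> sets M" .
    qed
  qed (auto simp: space_PiM)
  then show "sets overlap_space \<subseteq> sigma_sets UNIV rational_events"
    using measurable_sets[of "\<lambda>q. q" M] unfolding M(2)[symmetric] by (fastforce simp: M(1))
qed

lemma measurable_rost_law:
  "rost_law \<in> prob_algebra state_space \<rightarrow>\<^sub>M prob_algebra overlap_space"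
  unfolding rost_law_eq[abs_def]
  by (rule measurable_compose[OF measurable_mixture measurable_distr_prob_space[OF measurable_overlap_matrix]])

lemma overlap_matrix_translate:
  assumes "\<sigma> \<in> space replica_space"
  shows "overlap_matrix (\<lambda>i x. \<sigma> i (x + z)) = overlap_matrix \<sigma>"
  unfolding overlap_matrix_def
  using edge_overlap_translate[of "\<sigma> i" "\<sigma> j" z for i j] space_replica[OF assms]
    by (auto simp: fun_eq_iff)

lemma measurable_translate_replicas: "(\<lambda>\<sigma> i x. \<sigma> i (x + z)) \<in> replica_space \<rightarrow>\<^sub>M replica_space"
proof (rule measurable_PiM_single')
  fix i :: nat
  show "(\<lambda>\<sigma> x. \<sigma> i (x + z)) \<in> replica_space \<rightarrow>\<^sub>M spin_space UNIV"
    unfolding spin_space_def[of UNIV]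
  proof (subst spin_space_def[symmetric], rule measurable_PiM_single')
    show "(\<lambda>\<sigma>. \<sigma> i (x + z)) \<in> replica_space \<rightarrow>\<^sub>M count_space {-1, 1}" for x by (rule measurable_spin)
    show "(\<lambda>\<sigma> x. \<sigma> i (x + z)) \<in> space replica_space \<rightarrow> UNIV \<rightarrow>\<^sub>E space (count_space {-1, 1})"
      unfolding PiE_UNIV_domain space_count_space by (intro Pi_I space_replica)
  qed
qed (auto simp: space_PiM spin_space_def)

context EA_metastate begin

lemma mixture_translate:
  "AE J in iid_law. mixture (\<kappa> (translate z J))
      = distr (mixture (\<kappa> J)) replica_space (\<lambda>\<sigma> i x. \<sigma> i (x + z))"
proof (rule AE_measure_eqI_countable_generator[OF countable_up_events up_events_Pow])
  have tr: "\<kappa> (translate z J) \<in> space (prob_algebra state_space)"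
    if "J \<in> space iid_law" for J
    by (rule \<kappa>_space[OF measurable_space[OF measurable_translate that]])
  show "prob_space (mixture (\<kappa> (translate z J))) \<and> sets (mixture (\<kappa> (translate z J))) = sigma_sets (space replica_space) up_events"
    if "J \<in> space iid_law" for J
    using mixture_prob[OF tr[OF that]] by (simp add: sets_replica_space)
  have meas: "(\<lambda>\<sigma> i x. \<sigma> i (x + z)) \<in> mixture (\<kappa> J) \<rightarrow>\<^sub>M replica_space" if "J \<in> space iid_law" for J
    using measurable_translate_replicas mixture_prob(2)[OF \<kappa>_space[OF that]]
      by (simp cong: measurable_cong_sets)
  show "prob_space (distr (mixture (\<kappa> J)) replica_space (\<lambda>\<sigma> i x. \<sigma> i (x + z))) \<and>
      sets (distr (mixture (\<kappa> J)) replica_space (\<lambda>\<sigma> i x. \<sigma> i (x + z))) = sigma_sets (space replica_space) up_events"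
    if "J \<in> space iid_law" for J
    using prob_space.prob_space_distr[OF mixture_prob(1)[OF \<kappa>_space[OF that]] meas[OF that]]
      by (simp add: sets_replica_space)
  fix D :: "(nat \<Rightarrow> 'd config) set set" assume D: "finite D" "D \<subseteq> up_events"
  obtain S k where S: "finite S" "\<And>i x. (i, x) \<in> S \<Longrightarrow> i < k"
    "space replica_space \<inter> \<Inter>D
        = {\<sigma> \<in> space replica_space. \<forall>(i, x)\<in>S. \<sigma> i x = 1}"
    by (rule finite_up_events_Inter[OF D]) blast
  define S' where "S' = (\<lambda>(i, x). (i, x + z)) ` S"
  have S': "finite S'" "\<And>i x. (i, x) \<in> S' \<Longrightarrow> i < k"
    using S by (auto simp: S'_def)
  have slice: "{x. (i, x) \<in> S'} = (\<lambda>x. x + z) ` {x. (i, x) \<in> S}" for i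
    by (force simp: S'_def)
  have "{x. (i, x) \<in> S} \<subseteq> snd ` S" for i by (auto intro: rev_image_eqI)
  from translation_covariance[OF this, where k = k and z = z] S(1)
  have "AE J in iid_law. (\<integral>\<Gamma>. replica_prod k (\<lambda>i. all_up {x. (i, x) \<in> S}) \<Gamma> \<partial>\<kappa> (translate z J))
      = (\<integral>\<Gamma>. replica_prod k (\<lambda>i. all_up {x. (i, x) \<in> S'}) \<Gamma> \<partial>\<kappa> J)"
    by (simp add: slice)
  then show "AE J in iid_law. measure (mixture (\<kappa> (translate z J))) (space replica_space \<inter> \<Inter>D)
      = measure (distr (mixture (\<kappa> J)) replica_space (\<lambda>\<sigma> i x. \<sigma> i (x + z))) (space replica_space \<inter> \<Inter>D)"
  proof (rule AE_mp, intro AE_I2 impI)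
    fix J :: "'d couplings" assume J: "J \<in> space iid_law"
      and eq: "(\<integral>\<Gamma>. replica_prod k (\<lambda>i. all_up {x. (i, x) \<in> S}) \<Gamma> \<partial>\<kappa> (translate z J))
      = (\<integral>\<Gamma>. replica_prod k (\<lambda>i. all_up {x. (i, x) \<in> S'}) \<Gamma> \<partial>\<kappa> J)"
    have "space replica_space \<inter> \<Inter>D \<in> sigma_sets (space replica_space) up_events"
      by (subst sigma_sets_finite_Inter[OF up_events_Pow, symmetric], rule sigma_sets.Basic) (use D in blast)
    then have E: "{\<sigma> \<in> space replica_space. \<forall>(i, x)\<in>S. \<sigma> i x = 1} \<in> sets replica_space"
      by (simp add: sets_replica_space S(3))
    have "(\<lambda>\<sigma> i x. \<sigma> i (x + z)) -` {\<sigma> \<in> space replica_space. \<forall>(i, x)\<in>S. \<sigma> i x = 1} \<inter> space (mixture (\<kappa> J))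
        = {\<sigma> \<in> space replica_space. \<forall>(i, x)\<in>S'. \<sigma> i x = 1}"
      by (auto simp: mixture_prob(3)[OF \<kappa>_space[OF J]] space_replica_eq S'_def)
    then show "measure (mixture (\<kappa> (translate z J))) (space replica_space \<inter> \<Inter>D)
      = measure (distr (mixture (\<kappa> J)) replica_space (\<lambda>\<sigma> i x. \<sigma> i (x + z))) (space replica_space \<inter> \<Inter>D)"
      unfolding S(3) measure_distr[OF meas[OF J] E]
      by (simp add: measure_mixture_up[OF tr[OF J] S(1,2)] measure_mixture_up[OF \<kappa>_space[OF J] S'] eq)
  qed
qed

lemma rost_law_translate: "AE J in iid_law. rost_law (\<kappa> (translate z J)) = rost_law (\<kappa> J)"
  using mixture_translate[of z]
proof (rule AE_mp, intro AE_I2 impI)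
  fix J :: "'d couplings" assume J: "J \<in> space iid_law"
    and eq: "mixture (\<kappa> (translate z J))
        = distr (mixture (\<kappa> J)) replica_space (\<lambda>\<sigma> i x. \<sigma> i (x + z))"
  note M = mixture_prob(2,3)[OF \<kappa>_space[OF J]]
  have meas: "(\<lambda>\<sigma> i x. \<sigma> i (x + z)) \<in> mixture (\<kappa> J) \<rightarrow>\<^sub>M replica_space"
    using measurable_translate_replicas M by (simp cong: measurable_cong_sets)
  have "rost_law (\<kappa> (translate z J))
      = distr (mixture (\<kappa> J)) overlap_space (overlap_matrix \<circ> (\<lambda>\<sigma> i x. \<sigma> i (x + z)))"
    unfolding rost_law_eq eq by (rule distr_distr[OF measurable_overlap_matrix meas])
  also have "\<dots> = rost_law (\<kappa> J)"
    unfolding rost_law_eq by (intro distr_cong refl) (simp add: overlap_matrix_translate M)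
  finally show "rost_law (\<kappa> (translate z J)) = rost_law (\<kappa> J)" .
qed

lemma translate_edge_disjoint:
  assumes A: "finite A" "A \<subseteq> edges" and B: "finite B" "B \<subseteq> edges"
  shows "\<forall>\<^sub>F n in sequentially. translate_edge (axis k (int n)) ` A \<inter> B = {}"
proof -
  have fin: "finite (\<Union>A')" if "finite A'" "A' \<subseteq> edges" for A' :: "'d edge set"
  proof (rule finite_Union[OF that(1)])
    fix e assume "e \<in> A'"
    then have "e \<in> edges" using that(2) by auto
    then show "finite e" by (rule edgeE) (simp add: bond_def)
  qed
  define V where "V = (\<lambda>x. nat \<bar>x $ k\<bar>) ` (\<Union>A \<union> \<Union>B)"
  have V: "finite V" using fin[OF A] fin[OF B] by (simp add: V_def)
  define m where "m = Max (insert 0 V)"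
  have m: "\<bar>x $ k\<bar> \<le> int m" if "x \<in> \<Union>A \<union> \<Union>B" for x
  proof -
    have "nat \<bar>x $ k\<bar> \<le> m"
      unfolding m_def using V that by (intro Max_ge) (auto simp: V_def)
    then show ?thesis by simp
  qed
  have "translate_edge (axis k (int n)) ` A \<inter> B = {}" if n: "n \<ge> 2 * m + 1" for n
  proof (rule ccontr)
    assume "translate_edge (axis k (int n)) ` A \<inter> B \<noteq> {}"
    then obtain e where e: "e \<in> A" "translate_edge (axis k (int n)) e \<in> B" by auto
    then have "e \<in> edges" using A(2) by auto
    then obtain x i where x: "e = bond x i" by (rule edgeE)
    have "x \<in> \<Union>A" "x + axis k (int n) \<in> \<Union>B"
      using e by (auto simp: x bond_def translate_edge_def)
    then have "\<bar>x $ k\<bar> \<le> int m" "\<bar>(x + axis k (int n)) $ k\<bar> \<le> int m"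
      using m by blast+
    then show False using n by (simp add: axis_def)
  qed
  then show ?thesis by (auto intro: eventually_sequentiallyI)
qed

text \<open>The probability that the overlaps satisfy finitely many inequalities is a function of the couplings that
  is invariant under translations.\<close>

lemma rost_law_const: "\<exists>Q. AE J in iid_law. rost_law (\<kappa> J) = Q"
proof (rule AE_const_measure_of_countable_generator[OF P.prob_space_axioms countable_rational_events])
  have meas: "(\<lambda>J. rost_law (\<kappa> J)) \<in> iid_law \<rightarrow>\<^sub>M prob_algebra overlap_space"
    by (rule measurable_compose[OF \<kappa> measurable_rost_law])
  show *: "prob_space (rost_law (\<kappa> J)) \<and> sets (rost_law (\<kappa> J))
      = sigma_sets UNIV rational_events" if "J \<in> space iid_law" for J
    using measurable_space[OF meas that] by (simp add: space_prob_algebra sets_overlap_space)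
  fix D :: "(nat \<times> nat \<Rightarrow> real) set set" assume D: "finite D" "D \<subseteq> rational_events"
  have "UNIV \<inter> \<Inter>D \<in> sigma_sets UNIV rational_events"
    by (subst sigma_sets_finite_Inter[OF subset_Pow_Union[THEN order_trans], symmetric, of rational_events UNIV])
      (use D in \<open>auto intro!: sigma_sets.Basic\<close>)
  then have E: "\<Inter>D \<in> sets overlap_space"
    by (simp add: sets_overlap_space)
  define \<phi> where "\<phi> J = measure (rost_law (\<kappa> J)) (\<Inter>D)" for J
  define k :: 'd where "k = undefined"
  have "AE J in iid_law. \<phi> J = (\<integral>J. \<phi> J \<partial>iid_law)"
  proof (rule mixing_invariant_const[where \<pi> = "\<lambda>n. translate_edge (axis k (int n))" and B = 1])
    show "\<phi> \<in> borel_measurable iid_law"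
      unfolding \<phi>_def by (rule measurable_compose[OF meas measurable_measure_prob_algebra[OF E]])
    show "\<bar>\<phi> J\<bar> \<le> 1" if "J \<in> space iid_law" for J
      using *[OF that] by (simp add: \<phi>_def prob_space.prob_le_1)
    show "AE J in iid_law. \<phi> (\<lambda>e\<in>edges. J (translate_edge (axis k (int n)) e))
        = \<phi> J" for n
      using rost_law_translate[of "axis k (int n)"]
      unfolding translate_def[symmetric] by (rule AE_mp) (auto intro!: AE_I2 simp: \<phi>_def)
  qed (rule inj_translate translate_edges translate_edge_disjoint; assumption?)+
  then show "\<exists>c. AE J in iid_law. measure (rost_law (\<kappa> J)) (UNIV \<inter> \<Inter>D) = c"
    by (auto simp: \<phi>_def)
qed simp

end


section \<open>Tilted measures\<close>

text \<open>The normalisation of the tilted state.\<close>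

definition tilt_norm :: "real \<Rightarrow> ('d::finite) site set \<Rightarrow> 'd couplings \<Rightarrow> 'd config measure \<Rightarrow> real" where
  "tilt_norm \<beta> W t \<Gamma>
      = (\<integral>\<sigma>. exp (\<beta> * local_energy W t \<sigma>) \<partial>\<Gamma>)"

text \<open>An infinite-volume state \<open>\<Gamma>\<close> and a local perturbation with couplings \<open>t\<close> on a finite set \<open>W\<close> are fixed.\<close>

context
  fixes \<beta> :: real and W :: "('d::finite) site set" and t :: "'d couplings"
    and \<Gamma> :: "'d config measure"
  assumes W: "finite W" and \<Gamma>: "\<Gamma> \<in> space state_space"
begin

interpretation \<Gamma>: prob_space \<Gamma>
  using \<Gamma> by (simp add: space_prob_algebra)

lemma sets_\<Gamma> [measurable_cong]: "sets \<Gamma> = sets (spin_space UNIV)"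
  using \<Gamma> by (simp add: space_prob_algebra)

lemma tilt_weight_eq: "\<sigma> \<in> space \<Gamma>
    \<Longrightarrow> exp (\<beta> * local_energy W t \<sigma>) = tilt_weight \<beta> W t \<sigma>"
  using sets_eq_imp_space_eq[OF sets_\<Gamma>]
  by (intro tilt_weight_spins[symmetric]) (auto simp: spin_space_def space_PiM)

lemma measurable_tilt_weight [measurable]: "tilt_weight \<beta> W t \<in> borel_measurable \<Gamma>"
  using measurable_local_obs[OF W tilt_weight_local_obs] by (simp cong: measurable_cong_sets)

lemma tilt_weight_nonneg [simp]: "0 \<le> tilt_weight \<beta> W t \<sigma>"
  by (simp add: tilt_weight_def)

lemma integrable_tilt_weight: "integrable \<Gamma> (tilt_weight \<beta> W t)"
  by (rule \<Gamma>.integrable_const_bound[where B = "tilt_bound \<beta> W t"])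
    (auto simp: tilt_weight_bounds(2) intro!: AE_I2)

lemma tilt_norm_eq: "tilt_norm \<beta> W t \<Gamma>
    = (\<integral>\<sigma>. tilt_weight \<beta> W t \<sigma> \<partial>\<Gamma>)"
  unfolding tilt_norm_def by (intro Bochner_Integration.integral_cong refl tilt_weight_eq)

lemma tilt_norm_pos: "tilt_norm \<beta> W t \<Gamma> > 0"
proof -
  have "(\<integral>\<sigma>. 1 / tilt_bound \<beta> W t \<partial>\<Gamma>)
      \<le> (\<integral>\<sigma>. tilt_weight \<beta> W t \<sigma> \<partial>\<Gamma>)"
    by (rule integral_mono[OF _ integrable_tilt_weight tilt_weight_bounds(1)]) simp
  then have "1 / tilt_bound \<beta> W t \<le> tilt_norm \<beta> W t \<Gamma>"
    by (simp add: \<Gamma>.prob_space tilt_norm_eq)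
  then show ?thesis using tilt_bound_ge_1[of \<beta> W t] by (smt (verit) divide_pos_pos)
qed

lemma tilt_eq: "tilt \<beta> W t \<Gamma>
    = density \<Gamma> (\<lambda>\<sigma>. ennreal (tilt_weight \<beta> W t \<sigma> / tilt_norm \<beta> W t \<Gamma>))"
proof -
  have "(\<lambda>\<sigma>. ennreal (tilt_weight \<beta> W t \<sigma> / tilt_norm \<beta> W t \<Gamma>)) \<in> borel_measurable \<Gamma>" by measurable
  moreover from this have "(\<lambda>\<sigma>. ennreal (exp (\<beta> * local_energy W t \<sigma>) / tilt_norm \<beta> W t \<Gamma>)) \<in> borel_measurable \<Gamma>"
    by (rule measurable_cong[THEN iffD1, rotated]) (simp add: tilt_weight_eq)
  ultimately show ?thesis
    unfolding tilt_def tilt_norm_def[symmetric]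
    by (intro density_cong) (auto simp: tilt_weight_eq)
qed

lemma integral_tilt:
  fixes f :: "_ \<Rightarrow> real"
  assumes "f \<in> borel_measurable (spin_space UNIV)"
  shows "(\<integral>\<sigma>. f \<sigma> \<partial>tilt \<beta> W t \<Gamma>)
      = (\<integral>\<sigma>. tilt_weight \<beta> W t \<sigma> * f \<sigma> \<partial>\<Gamma>) / (\<integral>\<sigma>. tilt_weight \<beta> W t \<sigma> \<partial>\<Gamma>)"
proof -
  have [measurable]: "f \<in> borel_measurable \<Gamma>"
    using assms by (simp cong: measurable_cong_sets add: sets_\<Gamma>)
  have "(\<integral>\<sigma>. f \<sigma> \<partial>tilt \<beta> W t \<Gamma>)
      = (\<integral>\<sigma>. (tilt_weight \<beta> W t \<sigma> / tilt_norm \<beta> W t \<Gamma>) * f \<sigma> \<partial>\<Gamma>)"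
    unfolding tilt_eq
    by (subst integral_real_density) (auto simp: tilt_norm_pos less_imp_le)
  then show ?thesis by (simp add: tilt_norm_eq)
qed

lemma tilt_in_prob_algebra: "tilt \<beta> W t \<Gamma> \<in> space state_space"
proof -
  have "emeasure (tilt \<beta> W t \<Gamma>) (space (tilt \<beta> W t \<Gamma>))
      = (\<integral>\<^sup>+\<sigma>. ennreal (tilt_weight \<beta> W t \<sigma> / tilt_norm \<beta> W t \<Gamma>) \<partial>\<Gamma>)"
    unfolding tilt_eq by (subst emeasure_density) (auto intro!: nn_integral_cong simp: indicator_def)
  also have "\<dots> = ennreal (\<integral>\<sigma>. tilt_weight \<beta> W t \<sigma> / tilt_norm \<beta> W t \<Gamma> \<partial>\<Gamma>)"
    using integrable_tilt_weight tilt_norm_pos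
    by (intro nn_integral_eq_integral) auto
  also have "\<dots> = 1" using tilt_norm_pos by (simp add: tilt_norm_eq)
  finally have "prob_space (tilt \<beta> W t \<Gamma>)" by (rule prob_spaceI)
  then show ?thesis by (simp add: space_prob_algebra tilt_def sets_\<Gamma>)
qed

lemma PiM_tilt:
  "PiM {..<s::nat} (\<lambda>_. tilt \<beta> W t \<Gamma>) = density (PiM {..<s} (\<lambda>_. \<Gamma>))
     (\<lambda>\<sigma>. \<Prod>i<s. ennreal (tilt_weight \<beta> W t (\<sigma> i) / tilt_norm \<beta> W t \<Gamma>))"
proof -
  interpret T: prob_space "tilt \<beta> W t \<Gamma>"
    using tilt_in_prob_algebra by (simp add: space_prob_algebra)
  interpret P: product_sigma_finite "\<lambda>_::nat. \<Gamma>" by standard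
  interpret TP: product_sigma_finite "\<lambda>_::nat. tilt \<beta> W t \<Gamma>" by standard
  have sets_T: "sets (tilt \<beta> W t \<Gamma>) = sets \<Gamma>" by (simp add: tilt_def)
  show ?thesis
  proof (rule TP.PiM_eqI[symmetric])
  show "sets (density (PiM {..<s} (\<lambda>_. \<Gamma>)) (\<lambda>\<sigma>. \<Prod>i<s. ennreal (tilt_weight \<beta> W t (\<sigma> i) / tilt_norm \<beta> W t \<Gamma>)))
      = sets (PiM {..<s} (\<lambda>_. tilt \<beta> W t \<Gamma>))"
    by (simp add: sets_T cong: sets_PiM_cong)
  fix A assume A: "\<And>i. i \<in> {..<s} \<Longrightarrow> A i \<in> sets (tilt \<beta> W t \<Gamma>)"
  have A' [measurable]: "A i \<in> sets \<Gamma>"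
    if "i < s" for i using A[of i] that by (simp add: sets_T)
  have m: "(\<lambda>\<sigma>. \<Prod>i<s. ennreal (tilt_weight \<beta> W t (\<sigma> i) / tilt_norm \<beta> W t \<Gamma>)) \<in> borel_measurable (PiM {..<s} (\<lambda>_. \<Gamma>))"
    by measurable
  have "emeasure (density (PiM {..<s} (\<lambda>_. \<Gamma>)) (\<lambda>\<sigma>. \<Prod>i<s. ennreal (tilt_weight \<beta> W t (\<sigma> i) / tilt_norm \<beta> W t \<Gamma>))) (PiE {..<s} A)
      = (\<integral>\<^sup>+\<sigma>. (\<Prod>i<s. ennreal (tilt_weight \<beta> W t (\<sigma> i) / tilt_norm \<beta> W t \<Gamma>)) * indicator (PiE {..<s} A) \<sigma> \<partial>PiM {..<s} (\<lambda>_. \<Gamma>))"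
    by (rule emeasure_density[OF m]) (auto intro!: sets_PiM_I_finite A')
  also have "\<dots> = (\<integral>\<^sup>+\<sigma>. (\<Prod>i<s. ennreal (tilt_weight \<beta> W t (\<sigma> i) / tilt_norm \<beta> W t \<Gamma>) * indicator (A i) (\<sigma> i)) \<partial>PiM {..<s} (\<lambda>_. \<Gamma>))"
  proof (rule nn_integral_cong)
    fix \<sigma> assume \<sigma>: "\<sigma> \<in> space (PiM {..<s} (\<lambda>_. \<Gamma>))"
    then have "indicator (PiE {..<s} A) \<sigma>
        = (\<Prod>i<s. indicator (A i) (\<sigma> i) :: ennreal)"
      by (auto simp: indicator_def space_PiM PiE_iff)
    then show "(\<Prod>i<s. ennreal (tilt_weight \<beta> W t (\<sigma> i) / tilt_norm \<beta> W t \<Gamma>)) * indicator (PiE {..<s} A) \<sigma>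
        = (\<Prod>i<s. ennreal (tilt_weight \<beta> W t (\<sigma> i) / tilt_norm \<beta> W t \<Gamma>) * indicator (A i) (\<sigma> i))"
      by (simp add: prod.distrib)
  qed
  also have "\<dots> = (\<Prod>i<s. \<integral>\<^sup>+\<sigma>. ennreal (tilt_weight \<beta> W t \<sigma> / tilt_norm \<beta> W t \<Gamma>) * indicator (A i) \<sigma> \<partial>\<Gamma>)"
    by (rule P.product_nn_integral_prod) auto
  also have "\<dots> = (\<Prod>i<s. emeasure (tilt \<beta> W t \<Gamma>) (A i))"
    unfolding tilt_eq by (intro prod.cong refl emeasure_density[symmetric]) auto
  finally show "emeasure (density (PiM {..<s} (\<lambda>_. \<Gamma>)) (\<lambda>\<sigma>. \<Prod>i<s. ennreal (tilt_weight \<beta> W t (\<sigma> i) / tilt_norm \<beta> W t \<Gamma>))) (PiE {..<s} A)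
      = (\<Prod>i<s. emeasure (tilt \<beta> W t \<Gamma>) (A i))" .
  qed simp
qed

lemma integral_PiM_tilt:
  fixes f :: "(nat \<Rightarrow> 'd config) \<Rightarrow> real"
  assumes f: "f \<in> borel_measurable (PiM {..<s} (\<lambda>_. \<Gamma>))"
  shows "(\<integral>\<sigma>. f \<sigma> \<partial>PiM {..<s} (\<lambda>_. tilt \<beta> W t \<Gamma>)) =
    (\<integral>\<sigma>. exp (\<beta> * (\<Sum>i<s. local_energy W t (\<sigma> i))) * f \<sigma> \<partial>PiM {..<s} (\<lambda>_. \<Gamma>)) / tilt_norm \<beta> W t \<Gamma> ^ s"
proof -
  have eq: "(\<Prod>i<s. ennreal (tilt_weight \<beta> W t (\<sigma> i) / tilt_norm \<beta> W t \<Gamma>)) =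
      ennreal (\<Prod>i<s. tilt_weight \<beta> W t (\<sigma> i) / tilt_norm \<beta> W t \<Gamma>)" for \<sigma> :: "nat \<Rightarrow> 'd config"
    using tilt_norm_pos by (intro prod_ennreal) simp
  have "(\<integral>\<sigma>. f \<sigma> \<partial>PiM {..<s} (\<lambda>_. tilt \<beta> W t \<Gamma>)) =
      (\<integral>\<sigma>. (\<Prod>i<s. tilt_weight \<beta> W t (\<sigma> i) / tilt_norm \<beta> W t \<Gamma>) * f \<sigma> \<partial>PiM {..<s} (\<lambda>_. \<Gamma>))"
    unfolding PiM_tilt eq
  proof (rule integral_real_density)
    show "f \<in> borel_measurable (PiM {..<s} (\<lambda>_. \<Gamma>))" by (rule f)
    show "(\<lambda>\<sigma>. \<Prod>i<s. tilt_weight \<beta> W t (\<sigma> i) / tilt_norm \<beta> W t \<Gamma>) \<in> borel_measurable (PiM {..<s} (\<lambda>_. \<Gamma>))"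
      by measurable
    show "AE \<sigma> in PiM {..<s} (\<lambda>_. \<Gamma>). 0
        \<le> (\<Prod>i<s. tilt_weight \<beta> W t (\<sigma> i) / tilt_norm \<beta> W t \<Gamma>)"
      using tilt_norm_pos by (intro AE_I2 prod_nonneg) simp
  qed
  also have "\<dots> = (\<integral>\<sigma>. (exp (\<beta> * (\<Sum>i<s. local_energy W t (\<sigma> i))) * f \<sigma>) / tilt_norm \<beta> W t \<Gamma> ^ s \<partial>PiM {..<s} (\<lambda>_. \<Gamma>))"
  proof (rule Bochner_Integration.integral_cong[OF refl])
    fix \<sigma> assume \<sigma>: "\<sigma> \<in> space (PiM {..<s} (\<lambda>_. \<Gamma>))"
    have "(\<Prod>i<s. tilt_weight \<beta> W t (\<sigma> i))
        = (\<Prod>i<s. exp (\<beta> * local_energy W t (\<sigma> i)))"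
      using \<sigma> by (intro prod.cong refl tilt_weight_eq[symmetric]) (auto simp: space_PiM PiE_iff)
    also have "\<dots> = exp (\<beta> * (\<Sum>i<s. local_energy W t (\<sigma> i)))"
      by (simp add: exp_sum[symmetric] sum_distrib_left)
    finally show "(\<Prod>i<s. tilt_weight \<beta> W t (\<sigma> i) / tilt_norm \<beta> W t \<Gamma>) * f \<sigma>
        = (exp (\<beta> * (\<Sum>i<s. local_energy W t (\<sigma> i))) * f \<sigma>) / tilt_norm \<beta> W t \<Gamma> ^ s"
      by (simp add: prod_dividef)
  qed
  finally show ?thesis by simp
qed

end

lemma measurable_tilt:
  assumes W: "finite W"
  shows "tilt \<beta> W t \<in> state_space \<rightarrow>\<^sub>M state_space"
proof (rule measurable_prob_algebra_generated[where G = "sets (spin_space UNIV)" and \<Omega> = "space (spin_space UNIV)"])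
  fix A :: "'a config set" assume A: "A \<in> sets (spin_space UNIV)"
  have h [measurable]: "tilt_weight \<beta> W t \<in> borel_measurable (spin_space UNIV)"
    by (rule measurable_local_obs[OF W tilt_weight_local_obs])
  have "emeasure (tilt \<beta> W t \<Gamma>) A
      = ennreal ((\<integral>\<sigma>. tilt_weight \<beta> W t \<sigma> * indicator A \<sigma> \<partial>\<Gamma>) / (\<integral>\<sigma>. tilt_weight \<beta> W t \<sigma> \<partial>\<Gamma>))"
    if \<Gamma>: "\<Gamma> \<in> space state_space" for \<Gamma>
  proof -
    have T: "prob_space (tilt \<beta> W t \<Gamma>)" "sets (tilt \<beta> W t \<Gamma>)
        = sets (spin_space UNIV)"
      using tilt_in_prob_algebra[OF W \<Gamma>] by (auto simp: space_prob_algebra)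
    interpret T: prob_space "tilt \<beta> W t \<Gamma>" by (rule T)
    have "emeasure (tilt \<beta> W t \<Gamma>) A
        = ennreal (\<integral>\<sigma>. indicator A \<sigma> \<partial>tilt \<beta> W t \<Gamma>)"
      using A sets.sets_into_space[of A "tilt \<beta> W t \<Gamma>"]
        by (simp add: T.emeasure_eq_measure T(2) Int_absorb2)
    also have "(\<integral>\<sigma>. indicator A \<sigma> \<partial>tilt \<beta> W t \<Gamma>)
        = (\<integral>\<sigma>. tilt_weight \<beta> W t \<sigma> * indicator A \<sigma> \<partial>\<Gamma>) / (\<integral>\<sigma>. tilt_weight \<beta> W t \<sigma> \<partial>\<Gamma>)"
      by (rule integral_tilt[OF W \<Gamma>]) (use A in simp)
    finally show ?thesis .
  qed
  moreover have "(\<lambda>\<Gamma>. ennreal ((\<integral>\<sigma>. tilt_weight \<beta> W t \<sigma> * indicator A \<sigma> \<partial>\<Gamma>) / (\<integral>\<sigma>. tilt_weight \<beta> W t \<sigma> \<partial>\<Gamma>)))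
      \<in> borel_measurable state_space"
  proof -
    have hA: "(\<lambda>\<sigma>. tilt_weight \<beta> W t \<sigma> * indicator A \<sigma>) \<in> borel_measurable (spin_space UNIV)" using A by measurable
    show ?thesis
      unfolding prob_algebra_def
      by (intro measurable_restrict_space1 measurable_compose[OF borel_measurable_divide[OF
          integral_measurable_subprob_algebra[OF hA] integral_measurable_subprob_algebra[OF h]] measurable_ennreal])
  qed
  ultimately show "(\<lambda>\<Gamma>. emeasure (tilt \<beta> W t \<Gamma>) A) \<in> borel_measurable state_space"
    by (simp cong: measurable_cong)
qed (use tilt_in_prob_algebra[OF W] in \<open>auto simp: space_prob_algebra sets.sigma_sets_eq sets.Int_stable dest: sets.sets_into_space\<close>)

lemma tilted_metastate_in_space:
  assumes "finite W" "K \<in> space (prob_algebra state_space)"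
  shows "tilted_metastate \<beta> W t K \<in> space (prob_algebra state_space)"
  unfolding tilted_metastate_def
  by (rule measurable_space[OF measurable_distr_prob_space[OF measurable_tilt[OF assms(1)]] assms(2)])

lemma integral_tilted_metastate:
  fixes \<psi> :: "_ \<Rightarrow> real"
  assumes W: "finite W" and K: "K \<in> space (prob_algebra state_space)"
    and \<psi>: "\<psi> \<in> borel_measurable state_space"
  shows "(\<integral>\<Gamma>. \<psi> \<Gamma> \<partial>tilted_metastate \<beta> W t K)
      = (\<integral>\<Gamma>. \<psi> (tilt \<beta> W t \<Gamma>) \<partial>K)"
proof -
  have "tilt \<beta> W t \<in> K \<rightarrow>\<^sub>M state_space"
    using measurable_tilt[OF W] K by (simp add: space_prob_algebra cong: measurable_cong_sets)
  then show ?thesis unfolding tilted_metastate_def by (rule integral_distr[OF _ \<psi>])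
qed

section \<open>Functions of finitely many overlaps\<close>

text \<open>The pairs of replicas among the first \<open>s\<close>.\<close>

definition overlap_index :: "nat \<Rightarrow> (nat \<times> nat) set" where
  "overlap_index s = {(i, j). i < j \<and> j < s}"

lemma overlaps_eq: "overlaps s \<sigma> = restrict (overlap_matrix \<sigma>) (overlap_index s)"
  by (auto simp: overlaps_def overlap_matrix_def overlap_index_def restrict_def fun_eq_iff)

text \<open>The averages are bounded by \<open>1\<close>; the second term of the bound is the value of \<open>lim\<close> where the limit does
  not exist.\<close>

lemma edge_overlap_bounded:
  "\<exists>B. \<forall>\<sigma> \<sigma>' :: ('d::finite) config. (\<forall>x. \<sigma> x \<in> {-1, 1}) \<longrightarrow> (\<forall>x. \<sigma>' x \<in> {-1, 1}) \<longrightarrow> \<bar>edge_overlap \<sigma> \<sigma>'\<bar> \<le> B"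
proof (intro exI allI impI)
  fix \<sigma> \<sigma>' :: "'d config" assume \<sigma>: "\<forall>x. \<sigma> x \<in> {-1, 1}" "\<forall>x. \<sigma>' x \<in> {-1, 1}"
  define X where "X n = (\<Sum>e\<in>edges_in (cube n). (\<Prod>x\<in>e. \<sigma> x) * (\<Prod>x\<in>e. \<sigma>' x)) / real (card (edges_in (cube n) :: 'd edge set))" for n
  have X: "edge_overlap \<sigma> \<sigma>' = lim X" by (simp add: edge_overlap_def X_def[abs_def])
  have p: "\<bar>\<Prod>x\<in>e. \<tau> x\<bar> = 1"
    if "\<forall>x. \<tau> x \<in> {-1, 1}" for e and \<tau> :: "'d config"
    unfolding abs_prod
  proof (intro prod.neutral ballI)
    fix x show "\<bar>\<tau> x\<bar> = 1" using that[THEN spec, of x] by auto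
  qed
  have X1: "\<bar>X n\<bar> \<le> 1" for n
  proof -
    have "\<bar>\<Sum>e\<in>edges_in (cube n). (\<Prod>x\<in>e. \<sigma> x) * (\<Prod>x\<in>e. \<sigma>' x)\<bar> \<le> (\<Sum>e\<in>(edges_in (cube n) :: 'd edge set). 1)"
      by (rule order_trans[OF sum_abs]) (simp add: abs_mult p[OF \<sigma>(1)] p[OF \<sigma>(2)])
    then show ?thesis by (simp add: X_def abs_divide divide_le_eq_1) auto
  qed
  show "\<bar>edge_overlap \<sigma> \<sigma>'\<bar> \<le> max 1 \<bar>THE L :: real. False\<bar>"
  proof (cases "convergent X")
    case True
    then have "X \<longlonglongrightarrow> lim X" by (simp add: convergent_LIMSEQ_iff)
    then have "(\<lambda>n. \<bar>X n\<bar>) \<longlonglongrightarrow> \<bar>lim X\<bar>"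
      by (rule tendsto_rabs)
    then have "\<bar>lim X\<bar> \<le> 1" by (rule LIMSEQ_le_const2) (use X1 in auto)
    then show ?thesis by (simp add: X)
  next
    case False
    then have "(\<lambda>L. X \<longlonglongrightarrow> L) = (\<lambda>L. False)"
      by (auto simp: convergent_def)
    then have "lim X = (THE L. False)" by (simp add: lim_def)
    then show ?thesis by (simp add: X)
  qed
qed

lemma bounded_continuous_overlaps:
  fixes F :: "(nat \<times> nat \<Rightarrow> real) \<Rightarrow> real"
  assumes F: "continuous_on UNIV F"
  shows "\<exists>B. \<forall>\<sigma> \<in> space (replica_space :: (nat \<Rightarrow> ('d::finite) config) measure). \<bar>F (overlaps s \<sigma>)\<bar> \<le> B"
proof -
  obtain b where b: "\<And>\<sigma> \<sigma>' :: 'd config. (\<forall>x. \<sigma> x \<in> {-1, 1})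
      \<Longrightarrow> (\<forall>x. \<sigma>' x \<in> {-1, 1}) \<Longrightarrow> \<bar>edge_overlap \<sigma> \<sigma>'\<bar> \<le> b"
    using edge_overlap_bounded by blast
  \<comment> \<open>A compact set that contains all overlaps; \<open>restrict\<close> has the value \<open>undefined\<close> off the index set.\<close>
  define Q where "Q p = (if p \<in> overlap_index s then {-b..b} else {undefined :: real})" for p :: "nat \<times> nat"
  have "compactin (product_topology (\<lambda>_. euclidean) UNIV) (PiE UNIV Q)"
    unfolding compactin_PiE by (simp add: Q_def)
  then have "compact (PiE UNIV Q)" by (simp add: euclidean_product_topology)
  then have "compact (F ` PiE UNIV Q)"
    using F by (intro compact_continuous_image continuous_on_subset[OF F]) auto
  then obtain B where B: "\<And>q. q \<in> PiE UNIV Q \<Longrightarrow> \<bar>F q\<bar> \<le> B"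
    using compact_imp_bounded[of "F ` PiE UNIV Q"] unfolding bounded_iff by auto
  have "overlaps s \<sigma> \<in> PiE UNIV Q"
    if "\<sigma> \<in> space (replica_space :: (nat \<Rightarrow> 'd config) measure)" for \<sigma>
    using b[of "\<sigma> i" "\<sigma> j" for i j] that
    by (auto simp: overlaps_def Q_def overlap_index_def space_replica_eq abs_le_iff minus_le_iff)
  then show ?thesis using B by blast
qed

lemma measurable_overlaps:
  fixes F :: "(nat \<times> nat \<Rightarrow> real) \<Rightarrow> real"
  assumes F: "continuous_on UNIV F"
  shows "(\<lambda>q. F (restrict q (overlap_index s))) \<in> borel_measurable overlap_space"
    "(\<lambda>\<sigma>. F (overlaps s \<sigma>)) \<in> borel_measurable replica_space"
proof -
  have "F \<in> borel_measurable borel" using F by (rule borel_measurable_continuous_onI)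
  then have F': "F \<in> borel_measurable overlap_space"
    by (simp add: measurable_cong_sets[OF sets_PiM_equal_borel refl])
  have "(\<lambda>q. restrict q (overlap_index s)) \<in> overlap_space \<rightarrow>\<^sub>M overlap_space"
  proof (rule measurable_PiM_single')
    show "(\<lambda>q. restrict q (overlap_index s) p) \<in> borel_measurable overlap_space" for p
      by (cases "p \<in> overlap_index s") auto
  qed (auto simp: space_PiM)
  from measurable_compose[OF this F']
  show 1: "(\<lambda>q. F (restrict q (overlap_index s))) \<in> borel_measurable overlap_space" .
  from measurable_compose[OF measurable_overlap_matrix 1]
  show "(\<lambda>\<sigma>. F (overlaps s \<sigma>)) \<in> borel_measurable replica_space"
    by (simp add: overlaps_eq)
qed

lemma measurable_overlaps_finite:
  fixes \<Gamma> :: "('d::finite) config measure"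
    and F :: "(nat \<times> nat \<Rightarrow> real) \<Rightarrow> real"
  assumes F: "continuous_on UNIV F" and \<Gamma>: "\<Gamma> \<in> space state_space"
  shows "(\<lambda>\<sigma>. F (overlaps s \<sigma>)) \<in> borel_measurable (PiM {..<s} (\<lambda>_. \<Gamma>))"
proof -
  \<comment> \<open>The function only depends on the first \<open>s\<close> replicas; the others are filled with a constant.\<close>
  define c :: "'d config" where "c = (\<lambda>_. 1)"
  have "(\<lambda>\<sigma> i. if i < s then \<sigma> i else c) \<in> PiM {..<s} (\<lambda>_. spin_space (UNIV :: 'd site set)) \<rightarrow>\<^sub>M replica_space"
  proof (rule measurable_PiM_single')
    fix i :: nat
    have "c \<in> space (spin_space UNIV)" by (auto simp: c_def spin_space_def space_PiM)
    then show "(\<lambda>\<sigma>. if i < s then \<sigma> i else c) \<in> PiM {..<s} (\<lambda>_. spin_space UNIV) \<rightarrow>\<^sub>M spin_space UNIV"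
      by (cases "i < s") auto
  qed (auto simp: space_PiM c_def spin_space_def PiE_iff)
  from measurable_compose[OF this measurable_overlaps(2)[OF F, of s]]
  have "(\<lambda>\<sigma>. F (overlaps s (\<lambda>i. if i < s then \<sigma> i else c))) \<in> borel_measurable (PiM {..<s} (\<lambda>_. spin_space (UNIV :: 'd site set)))" .
  moreover have "F (overlaps s (\<lambda>i. if i < s then \<sigma> i else c))
      = F (overlaps s \<sigma>)" for \<sigma>
    by (intro arg_cong[where f = F]) (auto simp: overlaps_def restrict_def fun_eq_iff)
  ultimately have "(\<lambda>\<sigma>. F (overlaps s \<sigma>)) \<in> borel_measurable (PiM {..<s} (\<lambda>_. spin_space (UNIV :: 'd site set)))" by simp
  moreover have "sets (PiM {..<s} (\<lambda>_. \<Gamma>))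
      = sets (PiM {..<s} (\<lambda>_. spin_space UNIV))"
    using \<Gamma> by (intro sets_PiM_cong) (auto simp: space_prob_algebra)
  ultimately show ?thesis by (simp cong: measurable_cong_sets)
qed

lemma integral_overlaps_finite:
  fixes \<Gamma> :: "('d::finite) config measure"
    and F :: "(nat \<times> nat \<Rightarrow> real) \<Rightarrow> real"
  assumes F: "continuous_on UNIV F" and \<Gamma>: "\<Gamma> \<in> space state_space"
  shows "(\<integral>\<sigma>. F (overlaps s \<sigma>) \<partial>PiM UNIV (\<lambda>_. \<Gamma>))
      = (\<integral>\<sigma>. F (overlaps s \<sigma>) \<partial>PiM {..<s} (\<lambda>_. \<Gamma>))"
proof -
  interpret product_prob_space "\<lambda>_. \<Gamma>" "UNIV :: nat set"
    by (rule product_prob_spaceI) (use \<Gamma> in \<open>simp add: space_prob_algebra\<close>)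
  have eq: "distr (PiM UNIV (\<lambda>_. \<Gamma>)) (PiM {..<s} (\<lambda>_. \<Gamma>)) (\<lambda>x. restrict x {..<s}) = PiM {..<s} (\<lambda>_. \<Gamma>)"
    by (rule distr_PiM_restrict_finite) auto
  have ext: "F (overlaps s (restrict \<sigma> {..<s}))
      = F (overlaps s \<sigma>)" for \<sigma> :: "nat \<Rightarrow> 'd config"
    by (intro arg_cong[where f = F]) (auto simp: overlaps_def restrict_def fun_eq_iff)
  have "(\<integral>\<sigma>. F (overlaps s \<sigma>) \<partial>PiM {..<s} (\<lambda>_. \<Gamma>))
      = (\<integral>\<sigma>. F (overlaps s (restrict \<sigma> {..<s})) \<partial>PiM UNIV (\<lambda>_. \<Gamma>))"
    by (subst eq[symmetric], rule integral_distr[OF _ measurable_overlaps_finite[OF F \<Gamma>]])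
      (rule measurable_restrict_subset, simp)
  then show ?thesis by (simp add: ext)
qed

lemma integral_rost_law:
  fixes K :: "('d::finite) config measure measure"
    and F :: "(nat \<times> nat \<Rightarrow> real) \<Rightarrow> real"
  assumes K: "K \<in> space (prob_algebra state_space)" and F: "continuous_on UNIV F"
  shows "(\<integral>\<Gamma>. (\<integral>\<sigma>. F (overlaps s \<sigma>) \<partial>PiM {..<s} (\<lambda>_. \<Gamma>)) \<partial>K) = (\<integral>q. F (restrict q (overlap_index s)) \<partial>rost_law K)"
proof -
  have spK: "space K = space state_space"
    using K by (auto simp: space_prob_algebra dest: sets_eq_imp_space_eq)
  obtain B where B: "\<And>\<sigma> :: nat \<Rightarrow> 'd config. \<sigma> \<in> space replica_space \<Longrightarrow> \<bar>F (overlaps s \<sigma>)\<bar> \<le> B"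
    using bounded_continuous_overlaps[OF F] by blast
  have "overlap_matrix \<in> mixture K \<rightarrow>\<^sub>M overlap_space"
    using measurable_overlap_matrix mixture_prob(2)[OF K] by (simp cong: measurable_cong_sets)
  then have "(\<integral>q. F (restrict q (overlap_index s)) \<partial>rost_law K)
      = (\<integral>\<sigma>. F (overlaps s \<sigma>) \<partial>mixture K)"
    unfolding rost_law_eq overlaps_eq by (rule integral_distr[OF _ measurable_overlaps(1)[OF F]])
  also have "\<dots> = (\<integral>\<Gamma>. \<integral>\<sigma>. F (overlaps s \<sigma>) \<partial>PiM UNIV (\<lambda>_. \<Gamma>) \<partial>K)"
    by (rule integral_mixture[OF K measurable_overlaps(2)[OF F] B])
  also have "\<dots> = (\<integral>\<Gamma>. (\<integral>\<sigma>. F (overlaps s \<sigma>) \<partial>PiM {..<s} (\<lambda>_. \<Gamma>)) \<partial>K)"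
    by (intro Bochner_Integration.integral_cong refl integral_overlaps_finite[OF F]) (simp add: spK)
  finally show ?thesis ..
qed

lemma integral_rost_law_tilted:
  fixes K :: "('d::finite) config measure measure"
    and F :: "(nat \<times> nat \<Rightarrow> real) \<Rightarrow> real"
  assumes W: "finite W" and K: "K \<in> space (prob_algebra state_space)" and F: "continuous_on UNIV F"
  shows "(\<integral>\<Gamma>. (\<integral>\<sigma>. exp (\<beta> * (\<Sum>i<s. local_energy W t (\<sigma> i))) * F (overlaps s \<sigma>) \<partial>PiM {..<s} (\<lambda>_. \<Gamma>))
      / (\<integral>\<sigma>. exp (\<beta> * local_energy W t \<sigma>) \<partial>\<Gamma>) ^ s \<partial>K)
    = (\<integral>q. F (restrict q (overlap_index s)) \<partial>rost_law (tilted_metastate \<beta> W t K))"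
proof -
  have spK: "space K = space state_space"
    using K by (auto simp: space_prob_algebra dest: sets_eq_imp_space_eq)
  define \<psi> where "\<psi> \<Gamma>
      = (\<integral>\<sigma>. F (overlaps s \<sigma>) \<partial>PiM {..<s} (\<lambda>_. \<Gamma>))" for \<Gamma> :: "'d config measure"
  have "(\<lambda>\<Gamma>. \<integral>\<sigma>. F (overlaps s \<sigma>) \<partial>PiM UNIV (\<lambda>_. \<Gamma>)) \<in> borel_measurable (prob_algebra (spin_space (UNIV :: 'd site set)))"
    by (rule measurable_compose[OF measurable_prob_algebraD[OF measurable_iid_replicas]
        integral_measurable_subprob_algebra[OF measurable_overlaps(2)[OF F]]])
  then have \<psi>: "\<psi> \<in> borel_measurable state_space"
    by (rule measurable_cong[THEN iffD1, rotated]) (simp add: \<psi>_def integral_overlaps_finite[OF F])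
  have "(\<integral>q. F (restrict q (overlap_index s)) \<partial>rost_law (tilted_metastate \<beta> W t K)) = (\<integral>\<Gamma>. \<psi> \<Gamma> \<partial>tilted_metastate \<beta> W t K)"
    unfolding \<psi>_def by (rule integral_rost_law[OF tilted_metastate_in_space[OF W K] F, symmetric])
  also have "\<dots> = (\<integral>\<Gamma>. \<psi> (tilt \<beta> W t \<Gamma>) \<partial>K)"
    by (rule integral_tilted_metastate[OF W K \<psi>])
  also have "\<dots> = (\<integral>\<Gamma>. (\<integral>\<sigma>. exp (\<beta> * (\<Sum>i<s. local_energy W t (\<sigma> i))) * F (overlaps s \<sigma>) \<partial>PiM {..<s} (\<lambda>_. \<Gamma>))
      / (\<integral>\<sigma>. exp (\<beta> * local_energy W t \<sigma>) \<partial>\<Gamma>) ^ s \<partial>K)"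
  proof (rule Bochner_Integration.integral_cong[OF refl])
    fix \<Gamma> assume "\<Gamma> \<in> space K"
    then have \<Gamma>: "\<Gamma> \<in> space state_space" by (simp add: spK)
    show "\<psi> (tilt \<beta> W t \<Gamma>)
        = (\<integral>\<sigma>. exp (\<beta> * (\<Sum>i<s. local_energy W t (\<sigma> i))) * F (overlaps s \<sigma>) \<partial>PiM {..<s} (\<lambda>_. \<Gamma>))
      / (\<integral>\<sigma>. exp (\<beta> * local_energy W t \<sigma>) \<partial>\<Gamma>) ^ s"
      unfolding \<psi>_def integral_PiM_tilt[OF W \<Gamma> measurable_overlaps_finite[OF F \<Gamma>]] tilt_norm_def ..
  qed
  finally show ?thesis ..
qed

section \<open>Local stability\<close>

context EA_metastate begin

lemma measurable_tilted_prod_pair: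
  assumes W: "finite W" and V: "finite V" and f: "\<And>i. f i \<in> local_obs V"
  shows "(\<lambda>(J, t). \<integral>\<Gamma>. tilted_prod k W t f \<Gamma> \<partial>\<kappa> J) \<in> borel_measurable (iid_law \<Otimes>\<^sub>M PiM (edges_in W) (\<lambda>_. \<nu>\<^sub>0))"
proof -
  define D where "D = edges_in W"
  define M where "M = iid_law \<Otimes>\<^sub>M PiM D (\<lambda>_. \<nu>\<^sub>0)"
  define R where "R = M \<Otimes>\<^sub>M prob_algebra (spin_space (UNIV :: 'd site set))"
  have t_meas: "(\<lambda>x. snd (fst (fst x)) e) \<in> borel_measurable (R \<Otimes>\<^sub>M spin_space UNIV)" if e: "e \<in> D" for e
  proof -
    have "(\<lambda>x. snd (fst (fst x))) \<in> R \<Otimes>\<^sub>M spin_space UNIV \<rightarrow>\<^sub>M PiM D (\<lambda>_. \<nu>\<^sub>0)"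
      unfolding R_def M_def by measurable
    from measurable_compose[OF this measurable_component_singleton[OF e]]
    show ?thesis by (simp add: measurable_cong_sets[OF refl sets_N])
  qed
  have spin: "(\<lambda>\<sigma>. \<sigma> x) \<in> borel_measurable (spin_space (UNIV :: 'd site set))" for x
    unfolding spin_space_def
    by (rule measurable_compose[OF measurable_component_singleton[of x]]) auto
  have clip_meas: "(\<lambda>y. clip (snd y x)) \<in> borel_measurable (R \<Otimes>\<^sub>M spin_space UNIV)" for x :: "'d site"
  proof -
    have "(\<lambda>y. snd y x) \<in> borel_measurable (R \<Otimes>\<^sub>M spin_space UNIV)"
      using measurable_compose[OF measurable_snd[of R "spin_space UNIV"] spin[of x]] by simp
    then show ?thesis
      unfolding clip_def by (intro borel_measurable_max borel_measurable_min borel_measurable_const)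
  qed
  have w: "(\<lambda>y. tilt_weight \<beta> W (snd (fst (fst y))) (snd y)) \<in> borel_measurable (R \<Otimes>\<^sub>M spin_space UNIV)"
    unfolding tilt_weight_def local_energy_def
    by (intro borel_measurable_exp[THEN measurable_compose[rotated]] borel_measurable_times borel_measurable_const
        borel_measurable_sum borel_measurable_prod clip_meas t_meas) (simp add: D_def)
  have fm: "(\<lambda>y. f i (snd y)) \<in> borel_measurable (R \<Otimes>\<^sub>M spin_space UNIV)" for i
    by (rule measurable_compose[OF measurable_snd measurable_local_obs[OF V f]])
  have sndR: "snd \<in> R \<rightarrow>\<^sub>M state_space" unfolding R_def by (rule measurable_snd)
  have num: "(\<lambda>r. \<integral>\<sigma>. tilt_weight \<beta> W (snd (fst r)) \<sigma> * f i \<sigma> \<partial>snd r) \<in> borel_measurable R" for i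
    by (rule integral_measurable_kernel[OF _ sndR]) (use borel_measurable_times[OF w fm[of i]] in \<open>simp add: split_beta'\<close>)
  have den: "(\<lambda>r. \<integral>\<sigma>. tilt_weight \<beta> W (snd (fst r)) \<sigma> \<partial>snd r) \<in> borel_measurable R"
    by (rule integral_measurable_kernel[OF _ sndR]) (use w in \<open>simp add: split_beta'\<close>)
  have "(\<lambda>r. tilted_prod k W (snd (fst r)) f (snd r)) \<in> borel_measurable R"
    unfolding tilted_prod_def replica_prod_def
    by (intro borel_measurable_divide borel_measurable_power borel_measurable_prod num den)
  then have tp: "(\<lambda>(x, \<Gamma>). tilted_prod k W (snd x) f \<Gamma>) \<in> borel_measurable (M \<Otimes>\<^sub>M state_space)"
    by (simp add: R_def split_beta')
  have "(\<lambda>x. \<kappa> (fst x)) \<in> M \<rightarrow>\<^sub>M prob_algebra state_space"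
    unfolding M_def by (rule measurable_compose[OF measurable_fst \<kappa>])
  from integral_measurable_kernel[OF tp this] show ?thesis
    by (simp add: M_def D_def split_beta')
qed

text \<open>For fixed \<open>t\<close> the covariance holds for almost all \<open>J\<close>, separately for each of countably many observables.
  Joint measurability allows the quantifiers to be exchanged.\<close>

lemma AE_mixture_tilted:
  assumes W: "finite W"
  shows "AE J in iid_law. AE t in PiM (edges_in W) (\<lambda>_. \<nu>\<^sub>0).
    mixture (tilted_metastate \<beta> W t (\<kappa> J)) = mixture (\<kappa> (shift (edges_in W) t J))"
proof -
  define D where "D = edges_in W"
  have D: "finite D" "D \<subseteq> edges"
    using finite_edges_in[OF W] by (auto simp: D_def edges_in_def)
  define T where "T = PiM D (\<lambda>_. \<nu>\<^sub>0)"
  interpret T: prob_space T unfolding T_def by (intro prob_space_PiM prob_space_axioms)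
  interpret PT: pair_sigma_finite iid_law T by standard
  define obs where "obs S = (\<lambda>i :: nat. all_up {x :: 'd site. (i, x) \<in> S})" for S
  have step: "AE J in iid_law. AE t in T. (\<integral>\<Gamma>. replica_prod k (obs S) \<Gamma> \<partial>\<kappa> (shift D t J)) = (\<integral>\<Gamma>. tilted_prod k W t (obs S) \<Gamma> \<partial>\<kappa> J)"
    if S: "finite S" for S k
  proof -
    define V where "V = snd ` S"
    have V: "finite V" using S by (simp add: V_def)
    have f: "obs S i \<in> local_obs V" "\<bar>obs S i \<sigma>\<bar> \<le> 1" for i \<sigma>
      unfolding obs_def by (auto intro!: all_up_local_obs all_up_bounds simp: V_def intro: rev_image_eqI)
    have "functional (replica_prod k (obs S)) (1 ^ k)" by (rule functional_replica_prod[OF V f])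
    then have m1: "(\<lambda>J. \<integral>\<Gamma>. replica_prod k (obs S) \<Gamma> \<partial>\<kappa> J) \<in> borel_measurable iid_law" by (rule functional_\<kappa>(1))
    have m1': "(\<lambda>x. \<integral>\<Gamma>. replica_prod k (obs S) \<Gamma> \<partial>\<kappa> (shift D (snd x) (fst x))) \<in> borel_measurable (iid_law \<Otimes>\<^sub>M T)"
      using measurable_compose[OF measurable_shift_pair[OF D(2)] m1] by (simp add: T_def split_beta')
    have m2: "(\<lambda>x. \<integral>\<Gamma>. tilted_prod k W (snd x) (obs S) \<Gamma> \<partial>\<kappa> (fst x)) \<in> borel_measurable (iid_law \<Otimes>\<^sub>M T)"
      using measurable_tilted_prod_pair[OF W V f(1), of k] by (simp add: T_def D_def split_beta')
    have "{x \<in> space (iid_law \<Otimes>\<^sub>M T). (\<integral>\<Gamma>. replica_prod k (obs S) \<Gamma> \<partial>\<kappa> (shift D (snd x) (fst x)))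
        = (\<integral>\<Gamma>. tilted_prod k W (snd x) (obs S) \<Gamma> \<partial>\<kappa> (fst x))} \<in> sets (iid_law \<Otimes>\<^sub>M T)"
      by (rule borel_measurable_eq[OF m1' m2])
    from PT.AE_commute[OF this]
    show ?thesis using tilt_covariance[OF V W f] by (auto simp: D_def)
  qed
  have count: "countable {S :: (nat \<times> 'd site) set. finite S}"
    using countable_Collect_finite[where ?'a = "nat \<times> 'd site"] by simp
  have "AE J in iid_law. \<forall>(S, k)\<in>{S. finite S} \<times> UNIV. AE t in T.
      (\<integral>\<Gamma>. replica_prod k (obs S) \<Gamma> \<partial>\<kappa> (shift D t J)) = (\<integral>\<Gamma>. tilted_prod k W t (obs S) \<Gamma> \<partial>\<kappa> J)"
    by (subst AE_ball_countable) (use count step in auto)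
  with AE_space show ?thesis
    unfolding D_def[symmetric] T_def[symmetric]
  proof eventually_elim
    fix J :: "'d couplings" assume J: "J \<in> space iid_law"
      and all: "\<forall>(S, k)\<in>{S. finite S} \<times> UNIV. AE t in T.
      (\<integral>\<Gamma>. replica_prod k (obs S) \<Gamma> \<partial>\<kappa> (shift D t J)) = (\<integral>\<Gamma>. tilted_prod k W t (obs S) \<Gamma> \<partial>\<kappa> J)"
    show "AE t in T. mixture (tilted_metastate \<beta> W t (\<kappa> J))
        = mixture (\<kappa> (shift D t J))"
    proof (rule AE_mixture_eqI)
      show "tilted_metastate \<beta> W t (\<kappa> J) \<in> space (prob_algebra state_space)" for t
        by (rule tilted_metastate_in_space[OF W \<kappa>_space[OF J]])
      show "\<kappa> (shift D t J) \<in> space (prob_algebra state_space)" for t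
        by (rule \<kappa>_space[OF measurable_space[OF measurable_shift[OF D(2)] J]])
      fix S :: "(nat \<times> 'd site) set" and k assume S: "finite S"
      define V where "V = snd ` S"
      have V: "finite V" using S by (simp add: V_def)
      have f: "obs S i \<in> local_obs V" for i
        unfolding obs_def by (auto intro!: all_up_local_obs simp: V_def intro: rev_image_eqI)
      have om: "obs S i \<in> borel_measurable (spin_space UNIV)" for i
        by (rule measurable_local_obs[OF V f])
      have tilted: "(\<integral>\<Gamma>. replica_prod k (obs S) \<Gamma> \<partial>tilted_metastate \<beta> W t (\<kappa> J)) = (\<integral>\<Gamma>. tilted_prod k W t (obs S) \<Gamma> \<partial>\<kappa> J)" for t
      proof -
        have "(\<integral>\<Gamma>. replica_prod k (obs S) \<Gamma> \<partial>tilted_metastate \<beta> W t (\<kappa> J)) = (\<integral>\<Gamma>. replica_prod k (obs S) (tilt \<beta> W t \<Gamma>) \<partial>\<kappa> J)"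
          by (rule integral_tilted_metastate[OF W \<kappa>_space[OF J] measurable_replica_prod[OF om]])
        also have "\<dots> = (\<integral>\<Gamma>. tilted_prod k W t (obs S) \<Gamma> \<partial>\<kappa> J)"
        proof (rule Bochner_Integration.integral_cong[OF refl])
          fix \<Gamma> assume "\<Gamma> \<in> space (\<kappa> J)"
          then have \<Gamma>: "\<Gamma> \<in> space state_space"
            using sets_eq_imp_space_eq[OF \<kappa>_sets[OF J]] by simp
          show "replica_prod k (obs S) (tilt \<beta> W t \<Gamma>) = tilted_prod k W t (obs S) \<Gamma>"
            unfolding replica_prod_def tilted_prod_def integral_tilt[OF W \<Gamma> om]
              by (simp add: prod_dividef)
        qed
        finally show ?thesis .
      qed
      have "AE t in T. (\<integral>\<Gamma>. replica_prod k (obs S) \<Gamma> \<partial>\<kappa> (shift D t J)) = (\<integral>\<Gamma>. tilted_prod k W t (obs S) \<Gamma> \<partial>\<kappa> J)"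
        using all S by auto
      then show "AE t in T. (\<integral>\<Gamma>. replica_prod k (\<lambda>i. all_up {x. (i, x) \<in> S}) \<Gamma> \<partial>tilted_metastate \<beta> W t (\<kappa> J))
          = (\<integral>\<Gamma>. replica_prod k (\<lambda>i. all_up {x. (i, x) \<in> S}) \<Gamma> \<partial>\<kappa> (shift D t J))"
        unfolding obs_def[symmetric] by eventually_elim (simp add: tilted)
    qed
  qed
qed

lemma rost_law_tilted:
  assumes W: "finite W"
  shows "AE J in iid_law. AE t in PiM (edges_in W) (\<lambda>_. \<nu>\<^sub>0). rost_law (tilted_metastate \<beta> W t (\<kappa> J)) = rost_law (\<kappa> J)"
proof -
  obtain Q where Q: "AE J in iid_law. rost_law (\<kappa> J) = Q" using rost_law_const by blast
  have D: "finite (edges_in W)" "edges_in W \<subseteq> edges"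
    using finite_edges_in[OF W] by (auto simp: edges_in_def)
  have "AE J in iid_law. AE t in PiM (edges_in W) (\<lambda>_. \<nu>\<^sub>0). rost_law (\<kappa> (shift (edges_in W) t J)) = Q"
    by (rule AE_AE_shift[OF D Q])
  with AE_mixture_tilted[OF W] Q show ?thesis
  proof eventually_elim
    case (elim J)
    from elim(1,3) show ?case by eventually_elim (use elim(2) in \<open>simp add: rost_law_def\<close>)
  qed
qed

end

theorem theorem4p1:
  fixes \<nu>\<^sub>0 :: "real measure" and \<beta> :: real
    and \<kappa> :: "('d::finite) couplings \<Rightarrow> 'd config measure measure"
    and W :: "'d site set"
  assumes "\<beta> > 0"
    and "symmetric_law \<nu>\<^sub>0" and "continuous_full_support \<nu>\<^sub>0"
    and "metastate \<nu>\<^sub>0 \<beta> \<kappa>"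
    and "finite W"
  shows
    "(\<forall>(s::nat) (F :: (nat \<times> nat \<Rightarrow> real) \<Rightarrow> real). continuous_on UNIV F \<longrightarrow>
       (AE J in coupling_law \<nu>\<^sub>0. AE J' in PiM (edges_in W) (\<lambda>_. \<nu>\<^sub>0).
          (\<integral>\<Gamma>. (\<integral>\<sigma>. exp (\<beta> * (\<Sum>i<s. local_energy W J' (\<sigma> i))) * F (overlaps s \<sigma>) \<partial>PiM {..<s} (\<lambda>_. \<Gamma>))
                 / (\<integral>\<sigma>. exp (\<beta> * local_energy W J' \<sigma>) \<partial>\<Gamma>) ^ s \<partial>\<kappa> J)
          = (\<integral>\<Gamma>. (\<integral>\<sigma>. F (overlaps s \<sigma>) \<partial>PiM {..<s} (\<lambda>_. \<Gamma>)) \<partial>\<kappa> J)))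
     \<and>
     (AE J in coupling_law \<nu>\<^sub>0. AE J' in PiM (edges_in W) (\<lambda>_. \<nu>\<^sub>0).
       rost_law (tilted_metastate \<beta> W J' (\<kappa> J)) = rost_law (\<kappa> J))"
proof -
  obtain a b \<kappa>' where \<kappa>': "\<kappa>' \<in> coupling_law \<nu>\<^sub>0 \<rightarrow>\<^sub>M prob_algebra state_space"
    "boxes_to_lattice a b" "AE J in coupling_law \<nu>\<^sub>0. \<kappa> J = \<kappa>' J"
    "fdd_converges
      (\<lambda>n. replica_law \<nu>\<^sub>0 (lattice_box (a n) (b n)) (\<lambda>J. PiM UNIV (\<lambda>_. gibbs \<beta> (a n) (b n) J)))
      (replica_law \<nu>\<^sub>0 UNIV (\<lambda>J. mixture (\<kappa>' J)))"
    using assms(4) unfolding metastate_def by blast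
  obtain f where f: "f \<in> borel_measurable borel" "AE x in lborel. 0 < f x" "\<nu>\<^sub>0 = density lborel (\<lambda>x. ennreal (f x))"
    using assms(3) unfolding continuous_full_support_def by blast
  interpret \<nu>: prob_space \<nu>\<^sub>0 using assms(2) by (simp add: symmetric_law_def)
  interpret EA_metastate \<nu>\<^sub>0 \<beta> a b \<kappa>'
  proof unfold_locales
    show "sets \<nu>\<^sub>0 = sets borel" using assms(2) by (simp add: symmetric_law_def)
    show "AE x in \<nu>\<^sub>0. x + t \<in> S" if "S \<in> sets borel" "AE x in \<nu>\<^sub>0. x \<in> S" for t S
      by (rule AE_shift_of_positive_density[OF f that])
    show "\<kappa>' \<in> PiM edges (\<lambda>_. \<nu>\<^sub>0) \<rightarrow>\<^sub>M prob_algebra state_space"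
      using \<kappa>'(1) by (simp add: coupling_law_def)
  qed (rule \<kappa>'(2,4))+
  have J: "AE J in coupling_law \<nu>\<^sub>0. \<kappa>' J \<in> space (prob_algebra state_space)"
    using measurable_space[OF \<kappa>'(1)] by (rule AE_I2)
  have main: "AE J in coupling_law \<nu>\<^sub>0. AE J' in PiM (edges_in W) (\<lambda>_. \<nu>\<^sub>0). rost_law (tilted_metastate \<beta> W J' (\<kappa> J)) = rost_law (\<kappa> J)"
    using rost_law_tilted[OF assms(5)] \<kappa>'(3) unfolding coupling_law_eq by eventually_elim simp
  show ?thesis
  proof (intro conjI allI impI)
    show "AE J in coupling_law \<nu>\<^sub>0. AE J' in PiM (edges_in W) (\<lambda>_. \<nu>\<^sub>0). rost_law (tilted_metastate \<beta> W J' (\<kappa> J)) = rost_law (\<kappa> J)"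
      by (rule main)
    fix s :: nat and F :: "(nat \<times> nat \<Rightarrow> real) \<Rightarrow> real" assume F: "continuous_on UNIV F"
    from main J \<kappa>'(3)
    show "AE J in coupling_law \<nu>\<^sub>0. AE J' in PiM (edges_in W) (\<lambda>_. \<nu>\<^sub>0).
          (\<integral>\<Gamma>. (\<integral>\<sigma>. exp (\<beta> * (\<Sum>i<s. local_energy W J' (\<sigma> i))) * F (overlaps s \<sigma>) \<partial>PiM {..<s} (\<lambda>_. \<Gamma>))
                 / (\<integral>\<sigma>. exp (\<beta> * local_energy W J' \<sigma>) \<partial>\<Gamma>) ^ s \<partial>\<kappa> J)
          = (\<integral>\<Gamma>. (\<integral>\<sigma>. F (overlaps s \<sigma>) \<partial>PiM {..<s} (\<lambda>_. \<Gamma>)) \<partial>\<kappa> J)"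
    proof eventually_elim
      case (elim J)
      have K: "\<kappa> J \<in> space (prob_algebra state_space)" using elim(2,3) by simp
      from elim(1) show ?case
        by eventually_elim (simp add: integral_rost_law_tilted[OF assms(5) K F] integral_rost_law[OF K F])
    qed
  qed
qed

end
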